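(* Let $Y$ be a locally finite monoid. The $Y$-plethystic bialgebra $\mathcal P^{Y}$ is isomorphic to the homotopy cardinality of the incidence bialgebra of the simplicial groupoid $\mathcal B\,\mathcal T_{\mathsf S^{\mathrm r}}(Y)$.
   Context: A monoid $Y$ is locally finite if every $m\in Y$ has only finitely many factorizations $m=nk$ with $n,k\in Y$. $Y$ is regarded as a category internal to groupoids with one object and discrete groupoid of arrows $Y$. Monad. $\mathsf{S}^{\mathrm r}$ is the monad on the category of groupoids sending $A$ to $\bigsqcup_{n\ge1}A^n/\!/\mathfrak S_n$: objects nonempty tuples, morphisms generated by componentwise morphisms and isomorphisms $(a_1,\dots,a_n)\to(a_{\sigma(1)},\dots,a_{\sigma(n)})$ for $\sigma\in\mathfrak S_n$; unit $a\mapsto (a)$, multiplication $\mu$ concatenation. An $\mathsf S^{\mathrm r}$-operad $Q$ consists of groupoids $Q_0$ (colours), $Q_1$ (operations), functors $s\colon Q_1\to\mathsf S^{\mathrm r}Q_0$, $t\colon Q_1\to Q_0$, composition $m\colon\mathsf S^{\mathrm r}Q_1\times_{\mathsf S^{\mathrm r}Q_0}Q_1\to Q_1$ (the $Q_1$ factor the root) and units, with the usual laws. $\mathcal T$-construction. For a category $C$ internal to groupoids with discrete $C_0$, $\mathcal T_{\mathsf S^{\mathrm r}}(C)$ is the $\mathsf S^{\mathrm r}$-operad with colours $C_0$ whose operations are the pullback of $\mathsf S^{\mathrm r}(\text{target})$ along $C_0\times\mathsf S^{\mathrm r}1\to\mathsf S^{\mathrm r}C_0$, $(c,(\ast,\dots,\ast))\mapsto(c,\dots,c)$: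 nonempty tuples $(f_1,\dots,f_n)$ of arrows with common target $c$ (inputs the sources, output $c$) with the morphisms of $\mathsf S^{\mathrm r}C_1$; composition $(f_1,\dots,f_k)\circ((g^1_j)_j,\dots,(g^k_j)_j)=(f_1g^1_1,\dots,f_1g^1_{n_1},\dots,f_kg^k_{n_k})$; units identities. For $C=Y$: one colour, operations nonempty tuples of elements of $Y$ up to permutation, composition by multiplication in $Y$ as displayed. Bar construction. For an $\mathsf S^{\mathrm r}$-operad $Q$, $Q_n:=\mathsf S^{\mathrm r}Q_{n-1}\times_{\mathsf S^{\mathrm r}Q_0}Q_1$ ($n\ge2$). $\mathcal BQ$ has $n$-simplices $\mathsf S^{\mathrm r}Q_n$; $d_0$ discards the top (leafward) level keeping outputs, $d_n$ discards the root level and flattens via $\mu$, inner faces compose adjacent levels via $m$, degeneracies insert units. Incidence bialgebra. $|G|=\sum_{[x]}1/|\mathrm{Aut}(x)|$. For $X=\mathcal BQ$, $\mathbb Q_{\pi_0X_1}$ has basis $\delta_a$; $\Delta(\delta_f)=\sum_{a,b}\frac{|\Phi_{f;a,b}|}{|\mathrm{Aut}(a)||\mathrm{Aut}(b)|}\delta_a\otimes\delta_b$ with $\Phi_{f;a,b}$ the homotopy fibre over $(a,b)$ of $(d_2,d_0)$ restricted to the homotopy fibre of $d_1$ over $f$; $\epsilon(\delta_f)=$ cardinality of the homotopy fibre of $s_0$ over $f$; product by juxtaposition (unit adjoined). $Y$-plethysm. Let $\Lambda$ be the set of maps $\lambda\colon Y\to\mathbb N$ with finite support, not identically zero; $\mathbf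 x^\lambda=\prod_{m}x_m^{\lambda_m}$, $\lambda!=\prod_m\lambda_m!$. Elements of the ring of power series in variables $(x_m)_{m\in Y}$ without constant term are written $F=\sum_{\lambda\in\Lambda}f_\lambda\mathbf x^\lambda/\lambda!$. For $m\in Y$ let $F_m$ be obtained from $F$ by replacing each $x_n$ by $x_{mn}$, and set $(G\circledast F)$ to be obtained from $G$ by replacing each $x_m$ by $F_m$. $\mathcal P^{Y}$ is the polynomial algebra $\mathbb Q[a_\lambda:\lambda\in\Lambda]$, $a_\lambda(F)=f_\lambda$, with comultiplication $\Delta(a_\lambda)(F,G)=a_\lambda(G\circledast F)$ and counit $\epsilon(a_\lambda)=a_\lambda(x_1)$, $1$ the unit of $Y$. *)

theory Defs
  imports
    Complex_Main
    "HOL-Library.Multiset"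
    "HOL-Library.Poly_Mapping"
    "HOL-Library.Product_Plus"
    "HOL-Library.Groups_Big_Fun"
    "HOL-Combinatorics.Permutations"
begin

section \<open>Groupoids\<close>

text \<open>
  The records of this file carry data only.  The axioms (associativity, functoriality,
  operad laws, simplicial identities, ...) are not part of them: the constructions below do
  not use these axioms, and they are only applied to concrete structures.
\<close>

text \<open>\<open>cmp G b a\<close> is ``first \<open>a\<close>, then \<open>b\<close>'', meaningful if \<open>cd G a = dm G b\<close>.\<close>

record ('o, 'a) gpd =
  obj :: "'o set"
  arr :: "'a set"
  dm :: "'a \<Rightarrow> 'o"
  cd :: "'a \<Rightarrow> 'o"
  idt :: "'o \<Rightarrow> 'a"
  cmp :: "'a \<Rightarrow> 'a \<Rightarrow> 'a"

record ('o, 'a, 'p, 'b) gfun =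
  ob :: "'o \<Rightarrow> 'p"
  ar :: "'a \<Rightarrow> 'b"

definition hom :: "('o, 'a) gpd \<Rightarrow> 'o \<Rightarrow> 'o \<Rightarrow> 'a set" where
  "hom G x y = {a \<in> arr G. dm G a = x \<and> cd G a = y}"

definition aut :: "('o, 'a) gpd \<Rightarrow> 'o \<Rightarrow> 'a set" where
  "aut G x = hom G x x"

definition iso_rel :: "('o, 'a) gpd \<Rightarrow> ('o \<times> 'o) set" where
  "iso_rel G = {(x, y). x \<in> obj G \<and> y \<in> obj G \<and> hom G x y \<noteq> {}}"

definition pi0 :: "('o, 'a) gpd \<Rightarrow> 'o set set" where
  "pi0 G = obj G // iso_rel G"

definition rep :: "'o set \<Rightarrow> 'o" where
  "rep C = (SOME x. x \<in> C)"

definition homotopy_finite :: "('o, 'a) gpd \<Rightarrow> bool" where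
  "homotopy_finite G \<longleftrightarrow> finite (pi0 G) \<and> (\<forall>x\<in>obj G. finite (aut G x))"

definition hcard :: "('o, 'a) gpd \<Rightarrow> rat" where
  "hcard G = (\<Sum>C\<in>pi0 G. 1 / of_nat (card (aut G (rep C))))"

definition gid :: "('o, 'a, 'o, 'a) gfun" where
  "gid = \<lparr>ob = (\<lambda>x. x), ar = (\<lambda>a. a)\<rparr>"

definition gcomp :: "('p, 'b, 'q, 'c) gfun \<Rightarrow> ('o, 'a, 'p, 'b) gfun \<Rightarrow> ('o, 'a, 'q, 'c) gfun"
    (infixr "\<odot>" 55) where
  "G \<odot> F = \<lparr>ob = ob G \<circ> ob F, ar = ar G \<circ> ar F\<rparr>"

definition gfst :: "('o \<times> 'p, 'a \<times> 'b, 'o, 'a) gfun" where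
  "gfst = \<lparr>ob = fst, ar = fst\<rparr>"

definition gsnd :: "('o \<times> 'p, 'a \<times> 'b, 'p, 'b) gfun" where
  "gsnd = \<lparr>ob = snd, ar = snd\<rparr>"

definition gpair ::
  "('o, 'a, 'p, 'b) gfun \<Rightarrow> ('o, 'a, 'q, 'c) gfun \<Rightarrow> ('o, 'a, 'p \<times> 'q, 'b \<times> 'c) gfun" where
  "gpair F G = \<lparr>ob = (\<lambda>x. (ob F x, ob G x)), ar = (\<lambda>a. (ar F a, ar G a))\<rparr>"

definition ginv :: "('o, 'a, 'p, 'b) gfun \<Rightarrow> ('p, 'b, 'o, 'a) gfun" where
  "ginv F = \<lparr>ob = inv (ob F), ar = inv (ar F)\<rparr>"

text \<open>The isomorphic copy of \<open>G\<close> along a pair \<open>R\<close> of injective maps.\<close>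

definition relabel :: "('o, 'a, 'p, 'b) gfun \<Rightarrow> ('o, 'a) gpd \<Rightarrow> ('p, 'b) gpd" where
  "relabel R G =
    \<lparr>obj = ob R ` obj G,
     arr = ar R ` arr G,
     dm = (\<lambda>a. ob R (dm G (inv (ar R) a))),
     cd = (\<lambda>a. ob R (cd G (inv (ar R) a))),
     idt = (\<lambda>x. ar R (idt G (inv (ob R) x))),
     cmp = (\<lambda>b a. ar R (cmp G (inv (ar R) b) (inv (ar R) a)))\<rparr>"

definition discrete :: "'o set \<Rightarrow> ('o, 'o) gpd" where
  "discrete S =
    \<lparr>obj = S, arr = S, dm = (\<lambda>x. x), cd = (\<lambda>x. x), idt = (\<lambda>x. x), cmp = (\<lambda>y x. x)\<rparr>"

definition full_sub :: "('o, 'a) gpd \<Rightarrow> 'o set \<Rightarrow> ('o, 'a) gpd" where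
  "full_sub G S =
    \<lparr>obj = obj G \<inter> S,
     arr = {a \<in> arr G. dm G a \<in> S \<and> cd G a \<in> S},
     dm = dm G, cd = cd G, idt = idt G, cmp = cmp G\<rparr>"

definition gprod :: "('o, 'a) gpd \<Rightarrow> ('p, 'b) gpd \<Rightarrow> ('o \<times> 'p, 'a \<times> 'b) gpd" where
  "gprod A B =
    \<lparr>obj = obj A \<times> obj B,
     arr = arr A \<times> arr B,
     dm = (\<lambda>(a, b). (dm A a, dm B b)),
     cd = (\<lambda>(a, b). (cd A a, cd B b)),
     idt = (\<lambda>(x, y). (idt A x, idt B y)),
     cmp = (\<lambda>(a', b') (a, b). (cmp A a' a, cmp B b' b))\<rparr>"

text \<open>The strict pullback of groupoids.\<close>

definition pullback ::
  "('o, 'a) gpd \<Rightarrow> ('p, 'b) gpd \<Rightarrow> ('o, 'a, 'q, 'c) gfun \<Rightarrow> ('p, 'b, 'q, 'c) gfun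
    \<Rightarrow> ('o \<times> 'p, 'a \<times> 'b) gpd" where
  "pullback A B F G =
    (gprod A B)
      \<lparr>obj := {(x, y). x \<in> obj A \<and> y \<in> obj B \<and> ob F x = ob G y},
       arr := {(a, b). a \<in> arr A \<and> b \<in> arr B \<and> ar F a = ar G b}\<rparr>"

text \<open>
  Objects of the homotopy fibre of \<open>F : G \<rightarrow> B\<close> over \<open>b\<close> are pairs \<open>(x, u)\<close> with
  \<open>u : F x \<rightarrow> b\<close>.  The triple \<open>(u, a, u')\<close> is the arrow \<open>a : (x, u) \<rightarrow> (x', u')\<close>.
\<close>

definition hofib ::
  "('o, 'a) gpd \<Rightarrow> ('p, 'b) gpd \<Rightarrow> ('o, 'a, 'p, 'b) gfun \<Rightarrow> 'p \<Rightarrow> ('o \<times> 'b, 'b \<times> 'a \<times> 'b) gpd" where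
  "hofib G B F b =
    \<lparr>obj = {(x, u). x \<in> obj G \<and> u \<in> hom B (ob F x) b},
     arr = {(u, a, u'). a \<in> arr G \<and> u \<in> hom B (ob F (dm G a)) b \<and>
              u' \<in> hom B (ob F (cd G a)) b \<and> cmp B u' (ar F a) = u},
     dm = (\<lambda>(u, a, u'). (dm G a, u)),
     cd = (\<lambda>(u, a, u'). (cd G a, u')),
     idt = (\<lambda>(x, u). (u, idt G x, u)),
     cmp = (\<lambda>(v, c, v') (u, a, u'). (u, cmp G c a, v'))\<rparr>"

definition hofib_proj :: "('o \<times> 'b, 'b \<times> 'a \<times> 'b, 'o, 'a) gfun" where
  "hofib_proj = \<lparr>ob = fst, ar = (\<lambda>(u, a, u'). a)\<rparr>"

section \<open>The monad of nonempty tuples up to symmetry\<close>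

text \<open>
  The arrow \<open>(\<sigma>, [f\<^sub>0, ..., f\<^sub>k])\<close> with \<open>f\<^sub>i : a\<^sub>i \<rightarrow> b\<^sub>i\<close> goes from \<open>[a\<^sub>0, ..., a\<^sub>k]\<close> to
  \<open>[b\<^bsub>\<sigma> 0\<^esub>, ..., b\<^bsub>\<sigma> k\<^esub>]\<close>: first apply the \<open>f\<^sub>i\<close>, then permute.
\<close>

type_synonym 'a srarr = "(nat \<Rightarrow> nat) \<times> 'a list"

definition Sr :: "('o, 'a) gpd \<Rightarrow> ('o list, 'a srarr) gpd" where
  "Sr A =
    \<lparr>obj = {xs. xs \<noteq> [] \<and> set xs \<subseteq> obj A},
     arr = {(\<sigma>, fs). fs \<noteq> [] \<and> set fs \<subseteq> arr A \<and> \<sigma> permutes {..<length fs}},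
     dm = (\<lambda>(\<sigma>, fs). map (dm A) fs),
     cd = (\<lambda>(\<sigma>, fs). permute_list \<sigma> (map (cd A) fs)),
     idt = (\<lambda>xs. (id, map (idt A) xs)),
     cmp = (\<lambda>(\<tau>, gs) (\<sigma>, fs). (\<sigma> \<circ> \<tau>, map2 (cmp A) (permute_list (inv \<sigma>) gs) fs))\<rparr>"

definition Sr_map :: "('o, 'a, 'p, 'b) gfun \<Rightarrow> ('o list, 'a srarr, 'p list, 'b srarr) gfun" where
  "Sr_map F = \<lparr>ob = map (ob F), ar = (\<lambda>(\<sigma>, fs). (\<sigma>, map (ar F) fs))\<rparr>"

definition Sr_unit :: "('o, 'a, 'o list, 'a srarr) gfun" where
  "Sr_unit = \<lparr>ob = (\<lambda>x. [x]), ar = (\<lambda>a. (id, [a]))\<rparr>"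

text \<open>
  The permutation underlying the concatenation of an arrow \<open>\<sigma>\<close> of tuples whose components
  are themselves arrows of tuples, with permutations \<open>\<tau>s\<close> and lengths \<open>ns\<close>: the positions in
  the \<open>i\<close>-th block are permuted by the \<open>i\<close>-th entry of \<open>\<tau>s\<close>, and the blocks by \<open>\<sigma>\<close>.  Thus
  permuting \<open>concat xss\<close> by it is the concatenation of
  \<open>permute_list \<sigma> (map2 permute_list \<tau>s xss)\<close>.
\<close>

definition flat_perm :: "(nat \<Rightarrow> nat) \<Rightarrow> (nat \<Rightarrow> nat) list \<Rightarrow> nat list \<Rightarrow> nat \<Rightarrow> nat" where
  "flat_perm \<sigma> \<tau>s ns k =
    (if k < sum_list ns
     then concat (permute_list \<sigma>
            (map (\<lambda>i. map (\<lambda>r. sum_list (take i ns) + (\<tau>s ! i) r) [0..<ns ! i])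
              [0..<length ns])) ! k
     else k)"

definition Sr_mult :: "('o list list, 'a srarr srarr, 'o list, 'a srarr) gfun" where
  "Sr_mult =
    \<lparr>ob = concat,
     ar = (\<lambda>(\<sigma>, ps). (flat_perm \<sigma> (map fst ps) (map (length \<circ> snd) ps), concat (map snd ps)))\<rparr>"

section \<open>Operads over this monad and their bar construction\<close>

record ('c, 'ca, 'q, 'qa) operad =
  colours :: "('c, 'ca) gpd"
  opers :: "('q, 'qa) gpd"
  src :: "('q, 'qa, 'c list, 'ca srarr) gfun"
  tgt :: "('q, 'qa, 'c, 'ca) gfun"
  mul :: "('q list \<times> 'q, 'qa srarr \<times> 'qa, 'q, 'qa) gfun"
  unt :: "('c, 'ca, 'q, 'qa) gfun"

text \<open>
  \<open>Q\<^sub>n\<close> is obtained by iterated pullback; to have all of them in one type, elements of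
  \<open>Q\<^sub>0\<close>, \<open>Q\<^sub>1\<close> and \<open>Q\<^sub>n\<close> (for \<open>n \<ge> 2\<close>) are tagged by \<open>Col\<close>, \<open>Op\<close> and \<open>Graft\<close>.
\<close>

datatype ('c, 'q) lev = Col 'c | Op 'q | Graft "('c, 'q) lev list \<times> 'q"

datatype ('ca, 'qa) levarr =
  ColA 'ca | OpA 'qa | GraftA "((nat \<Rightarrow> nat) \<times> ('ca, 'qa) levarr list) \<times> 'qa"

definition gCol :: "('c, 'ca, ('c, 'q) lev, ('ca, 'qa) levarr) gfun" where
  "gCol = \<lparr>ob = Col, ar = ColA\<rparr>"

definition gOp :: "('q, 'qa, ('c, 'q) lev, ('ca, 'qa) levarr) gfun" where
  "gOp = \<lparr>ob = Op, ar = OpA\<rparr>"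

definition gGraft ::
  "(('c, 'q) lev list \<times> 'q, ('ca, 'qa) levarr srarr \<times> 'qa, ('c, 'q) lev, ('ca, 'qa) levarr) gfun" where
  "gGraft = \<lparr>ob = Graft, ar = GraftA\<rparr>"

text \<open>For \<open>n \<ge> 1\<close>: the root operation of an element of \<open>Q\<^sub>n\<close>.\<close>

fun root :: "nat \<Rightarrow> (('c, 'q) lev, ('ca, 'qa) levarr, 'q, 'qa) gfun" where
  "root 0 = undefined"
| "root (Suc 0) = ginv gOp"
| "root (Suc (Suc n)) = gsnd \<odot> ginv gGraft"

fun outp :: "('c, 'ca, 'q, 'qa) operad \<Rightarrow> nat \<Rightarrow> (('c, 'q) lev, ('ca, 'qa) levarr, 'c, 'ca) gfun" where
  "outp Q 0 = ginv gCol"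
| "outp Q (Suc n) = tgt Q \<odot> root (Suc n)"

text \<open>For \<open>n \<ge> 1\<close>: discard the root, giving a tuple of elements of \<open>Q\<^bsub>n-1\<^esub>\<close>.\<close>

fun children ::
  "('c, 'ca, 'q, 'qa) operad \<Rightarrow> nat
    \<Rightarrow> (('c, 'q) lev, ('ca, 'qa) levarr, ('c, 'q) lev list, ('ca, 'qa) levarr srarr) gfun" where
  "children Q 0 = undefined"
| "children Q (Suc 0) = Sr_map gCol \<odot> src Q \<odot> ginv gOp"
| "children Q (Suc (Suc n)) = gfst \<odot> ginv gGraft"

fun level :: "('c, 'ca, 'q, 'qa) operad \<Rightarrow> nat \<Rightarrow> (('c, 'q) lev, ('ca, 'qa) levarr) gpd" where
  "level Q 0 = relabel gCol (colours Q)"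
| "level Q (Suc 0) = relabel gOp (opers Q)"
| "level Q (Suc (Suc n)) =
    relabel gGraft
      (pullback (Sr (level Q (Suc n))) (opers Q) (Sr_map (outp Q (Suc n))) (src Q))"

text \<open>
  \<open>level_face Q n i : Q\<^sub>n \<rightarrow> Q\<^bsub>n-1\<^esub>\<close> for \<open>i < n\<close>.  Counting levels from the leaves (\<open>1\<close>) to the
  root (\<open>n\<close>), it discards level \<open>1\<close> if \<open>i = 0\<close> and composes the levels \<open>i\<close> and \<open>i + 1\<close>
  otherwise.
\<close>

fun level_face ::
  "('c, 'ca, 'q, 'qa) operad \<Rightarrow> nat \<Rightarrow> nat
    \<Rightarrow> (('c, 'q) lev, ('ca, 'qa) levarr, ('c, 'q) lev, ('ca, 'qa) levarr) gfun" where
  "level_face Q 0 i = undefined"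
| "level_face Q (Suc 0) i = gCol \<odot> tgt Q \<odot> ginv gOp"
| "level_face Q (Suc (Suc n)) i =
    (if i \<le> n then
       (if n = 0 then gOp \<odot> gsnd \<odot> ginv gGraft
        else gGraft \<odot> gpair (Sr_map (level_face Q (Suc n) i) \<odot> gfst) gsnd \<odot> ginv gGraft)
     else
       (let new_root = mul Q \<odot> gpair (Sr_map (root (Suc n)) \<odot> gfst) gsnd \<odot> ginv gGraft
        in if n = 0 then gOp \<odot> new_root
           else gGraft \<odot>
             gpair (Sr_mult \<odot> Sr_map (children Q (Suc n)) \<odot> gfst \<odot> ginv gGraft) new_root))"

text \<open>
  \<open>level_degen Q n i : Q\<^sub>n \<rightarrow> Q\<^bsub>n+1\<^esub>\<close> for \<open>i \<le> n\<close> inserts a level of units between the levels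
  \<open>i\<close> and \<open>i + 1\<close>.
\<close>

fun level_degen ::
  "('c, 'ca, 'q, 'qa) operad \<Rightarrow> nat \<Rightarrow> nat
    \<Rightarrow> (('c, 'q) lev, ('ca, 'qa) levarr, ('c, 'q) lev, ('ca, 'qa) levarr) gfun" where
  "level_degen Q 0 i = gOp \<odot> unt Q \<odot> ginv gCol"
| "level_degen Q (Suc n) i =
    (if i \<le> n then
       (if n = 0 then gGraft \<odot> gpair (Sr_map (gOp \<odot> unt Q) \<odot> src Q) gid \<odot> ginv gOp
        else gGraft \<odot> gpair (Sr_map (level_degen Q n i) \<odot> gfst) gsnd \<odot> ginv gGraft)
     else gGraft \<odot> gpair Sr_unit (unt Q \<odot> outp Q (Suc n)))"

record ('o, 'a) sgpd =
  simplices :: "nat \<Rightarrow> ('o, 'a) gpd"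
  face :: "nat \<Rightarrow> nat \<Rightarrow> ('o, 'a, 'o, 'a) gfun"
  degen :: "nat \<Rightarrow> nat \<Rightarrow> ('o, 'a, 'o, 'a) gfun"

text \<open>
  \<open>face X n i\<close> is \<open>d\<^sub>i : X\<^sub>n \<rightarrow> X\<^bsub>n-1\<^esub>\<close> (for \<open>i \<le> n\<close>, \<open>n \<ge> 1\<close>) and \<open>degen X n i\<close> is
  \<open>s\<^sub>i : X\<^sub>n \<rightarrow> X\<^bsub>n+1\<^esub>\<close> (for \<open>i \<le> n\<close>).
\<close>

definition bar ::
  "('c, 'ca, 'q, 'qa) operad \<Rightarrow> (('c, 'q) lev list, ('ca, 'qa) levarr srarr) sgpd" where
  "bar Q =
    \<lparr>simplices = (\<lambda>n. Sr (level Q n)),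
     face = (\<lambda>n i. if i < n then Sr_map (level_face Q n i)
                   else Sr_mult \<odot> Sr_map (children Q n)),
     degen = (\<lambda>n i. Sr_map (level_degen Q n i))\<rparr>"

section \<open>The T-construction\<close>

text \<open>
  Categories internal to groupoids.  \<open>ccmp\<close> sends a pair \<open>(f, g)\<close> with
  source of \<open>f\<close> = target of \<open>g\<close> to the composite \<open>f g\<close>.
\<close>

record ('c, 'ca, 'f, 'fa) intcat =
  cobj :: "('c, 'ca) gpd"
  carr :: "('f, 'fa) gpd"
  csrc :: "('f, 'fa, 'c, 'ca) gfun"
  ctgt :: "('f, 'fa, 'c, 'ca) gfun"
  ccmp :: "('f \<times> 'f, 'fa \<times> 'fa, 'f, 'fa) gfun"
  cid :: "('c, 'ca, 'f, 'fa) gfun"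

definition monoid_cat :: "(unit, unit, 'y::monoid_mult, 'y) intcat" where
  "monoid_cat =
    \<lparr>cobj = discrete UNIV,
     carr = discrete UNIV,
     csrc = \<lparr>ob = (\<lambda>_. ()), ar = (\<lambda>_. ())\<rparr>,
     ctgt = \<lparr>ob = (\<lambda>_. ()), ar = (\<lambda>_. ())\<rparr>,
     ccmp = \<lparr>ob = (\<lambda>(f, g). f * g), ar = (\<lambda>(f, g). f * g)\<rparr>,
     cid = \<lparr>ob = (\<lambda>_. 1), ar = (\<lambda>_. 1)\<rparr>\<rparr>"

text \<open>
  For internal categories whose groupoid of objects is discrete.  An operation of the
  pullback defining the construction is determined by its tuple \<open>(f\<^sub>1, ..., f\<^sub>n)\<close> of arrows,
  and so are its morphisms.
\<close>

definition T_Sr :: "('c, 'ca, 'f, 'fa) intcat \<Rightarrow> ('c, 'ca, 'f list, 'fa srarr) operad" where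
  "T_Sr C =
    \<lparr>colours = cobj C,
     opers = full_sub (Sr (carr C)) {fs. \<exists>c\<in>obj (cobj C). \<forall>f\<in>set fs. ob (ctgt C) f = c},
     src = Sr_map (csrc C),
     tgt = \<lparr>ob = (\<lambda>fs. ob (ctgt C) (hd fs)), ar = (\<lambda>(\<sigma>, fs). ar (ctgt C) (hd fs))\<rparr>,
     mul = Sr_mult \<odot>
       \<lparr>ob = (\<lambda>(gss, fs). map2 (\<lambda>f gs. map (\<lambda>g. ob (ccmp C) (f, g)) gs) fs gss),
        ar = (\<lambda>((\<sigma>, gss), (\<sigma>', fs)).
          (\<sigma>, map2 (\<lambda>f (\<tau>, gs). (\<tau>, map (\<lambda>g. ar (ccmp C) (f, g)) gs)) fs gss))\<rparr>,
     unt = Sr_unit \<odot> cid C\<rparr>"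

section \<open>Bialgebras\<close>

text \<open>
  Bialgebra data over \<open>\<rat>\<close> on a vector space with a chosen basis.  The vector space consists
  of the finitely supported functions with support in \<open>basis\<close>; its tensor square is realised
  as the finitely supported functions with support in \<open>basis \<times> basis\<close>.
\<close>

record 'b bialg =
  basis :: "'b set"
  bmult :: "('b \<Rightarrow>\<^sub>0 rat) \<Rightarrow> ('b \<Rightarrow>\<^sub>0 rat) \<Rightarrow> ('b \<Rightarrow>\<^sub>0 rat)"
  bone :: "'b \<Rightarrow>\<^sub>0 rat"
  comult :: "('b \<Rightarrow>\<^sub>0 rat) \<Rightarrow> ('b \<times> 'b \<Rightarrow>\<^sub>0 rat)"
  counit :: "('b \<Rightarrow>\<^sub>0 rat) \<Rightarrow> rat"

definition carrier_of :: "'b bialg \<Rightarrow> ('b \<Rightarrow>\<^sub>0 rat) set" where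
  "carrier_of H = {p. Poly_Mapping.keys p \<subseteq> basis H}"

definition scale :: "rat \<Rightarrow> ('b \<Rightarrow>\<^sub>0 rat) \<Rightarrow> ('b \<Rightarrow>\<^sub>0 rat)" where
  "scale c p = Poly_Mapping.map ((*) c) p"

definition lin_ext :: "('b \<Rightarrow> ('d \<Rightarrow>\<^sub>0 rat)) \<Rightarrow> ('b \<Rightarrow>\<^sub>0 rat) \<Rightarrow> ('d \<Rightarrow>\<^sub>0 rat)" where
  "lin_ext h p = (\<Sum>b\<in>Poly_Mapping.keys p. scale (Poly_Mapping.lookup p b) (h b))"

definition tensor :: "('b \<Rightarrow>\<^sub>0 rat) \<Rightarrow> ('d \<Rightarrow>\<^sub>0 rat) \<Rightarrow> ('b \<times> 'd \<Rightarrow>\<^sub>0 rat)" where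
  "tensor p q =
    (\<Sum>a\<in>Poly_Mapping.keys p. \<Sum>b\<in>Poly_Mapping.keys q.
       Poly_Mapping.single (a, b) (Poly_Mapping.lookup p a * Poly_Mapping.lookup q b))"

definition tensor_map ::
  "(('b \<Rightarrow>\<^sub>0 rat) \<Rightarrow> ('d \<Rightarrow>\<^sub>0 rat)) \<Rightarrow> ('b \<times> 'b \<Rightarrow>\<^sub>0 rat) \<Rightarrow> ('d \<times> 'd \<Rightarrow>\<^sub>0 rat)" where
  "tensor_map \<phi> =
    lin_ext (\<lambda>(a, b). tensor (\<phi> (Poly_Mapping.single a 1)) (\<phi> (Poly_Mapping.single b 1)))"

definition bialg_iso :: "'b bialg \<Rightarrow> 'd bialg \<Rightarrow> (('b \<Rightarrow>\<^sub>0 rat) \<Rightarrow> ('d \<Rightarrow>\<^sub>0 rat)) \<Rightarrow> bool" where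
  "bialg_iso H K \<phi> \<longleftrightarrow>
     bij_betw \<phi> (carrier_of H) (carrier_of K) \<and>
     (\<forall>p\<in>carrier_of H. \<forall>q\<in>carrier_of H. \<phi> (p + q) = \<phi> p + \<phi> q) \<and>
     (\<forall>c. \<forall>p\<in>carrier_of H. \<phi> (scale c p) = scale c (\<phi> p)) \<and>
     (\<forall>p\<in>carrier_of H. \<forall>q\<in>carrier_of H. \<phi> (bmult H p q) = bmult K (\<phi> p) (\<phi> q)) \<and>
     \<phi> (bone H) = bone K \<and>
     (\<forall>p\<in>carrier_of H. comult K (\<phi> p) = tensor_map \<phi> (comult H p)) \<and>
     (\<forall>p\<in>carrier_of H. counit K (\<phi> p) = counit H p)"

definition bialg_isomorphic :: "'b bialg \<Rightarrow> 'd bialg \<Rightarrow> bool" where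
  "bialg_isomorphic H K \<longleftrightarrow> (\<exists>\<phi>. bialg_iso H K \<phi>)"

section \<open>The incidence bialgebra\<close>

text \<open>
  \<open>\<Phi>\<^bsub>f;a,b\<^esub>\<close>: the homotopy fibre over \<open>(a, b)\<close> of \<open>(d\<^sub>2, d\<^sub>0)\<close> restricted to the homotopy
  fibre of \<open>d\<^sub>1 : X\<^sub>2 \<rightarrow> X\<^sub>1\<close> over \<open>f\<close>.
\<close>

definition Phi ::
  "('o, 'a) sgpd \<Rightarrow> 'o \<Rightarrow> 'o \<Rightarrow> 'o
    \<Rightarrow> (('o \<times> 'a) \<times> 'a \<times> 'a, ('a \<times> 'a) \<times> ('a \<times> 'a \<times> 'a) \<times> ('a \<times> 'a)) gpd" where
  "Phi X f a b =
    hofib (hofib (simplices X 2) (simplices X 1) (face X 2 1) f)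
          (gprod (simplices X 1) (simplices X 1))
          (gpair (face X 2 2) (face X 2 0) \<odot> hofib_proj)
          (a, b)"

definition section_coeff :: "('o, 'a) sgpd \<Rightarrow> 'o \<Rightarrow> 'o \<Rightarrow> 'o \<Rightarrow> rat" where
  "section_coeff X f a b =
    hcard (Phi X f a b) / (of_nat (card (aut (simplices X 1) a)) * of_nat (card (aut (simplices X 1) b)))"

text \<open>The finiteness needed for the homotopy cardinalities to yield maps of vector spaces.\<close>

definition incidence_finite :: "('o, 'a) sgpd \<Rightarrow> bool" where
  "incidence_finite X \<longleftrightarrow>
     (\<forall>a\<in>obj (simplices X 1). finite (aut (simplices X 1) a)) \<and>
     (\<forall>f\<in>obj (simplices X 1). homotopy_finite (hofib (simplices X 0) (simplices X 1) (degen X 0 0) f)) \<and>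
     (\<forall>f\<in>obj (simplices X 1). \<forall>a\<in>obj (simplices X 1). \<forall>b\<in>obj (simplices X 1). homotopy_finite (Phi X f a b)) \<and>
     (\<forall>f\<in>obj (simplices X 1).
        finite {(A, B). A \<in> pi0 (simplices X 1) \<and> B \<in> pi0 (simplices X 1) \<and>
                        section_coeff X f (rep A) (rep B) \<noteq> 0})"

text \<open>
  The basis element \<open>Some C\<close> is \<open>\<delta>\<^sub>f\<close> for \<open>f\<close> in the isomorphism class \<open>C\<close>; \<open>None\<close> is the
  adjoined unit, which would correspond to the empty tuple.
\<close>

definition juxtapose ::
  "('x list, 'a) sgpd \<Rightarrow> 'x list set option \<Rightarrow> 'x list set option \<Rightarrow> 'x list set option" where
  "juxtapose X u v =
    (case u of
       None \<Rightarrow> v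
     | Some A \<Rightarrow>
         (case v of
            None \<Rightarrow> u
          | Some B \<Rightarrow> Some (iso_rel (simplices X 1) `` {rep A @ rep B})))"

definition delta_comult ::
  "('o, 'a) sgpd \<Rightarrow> 'o set option \<Rightarrow> ('o set option \<times> 'o set option \<Rightarrow>\<^sub>0 rat)" where
  "delta_comult X u =
    (case u of
       None \<Rightarrow> Poly_Mapping.single (None, None) 1
     | Some C \<Rightarrow>
         Abs_poly_mapping
           (\<lambda>(v, w).
              case (v, w) of
                (Some A, Some B) \<Rightarrow>
                  (if A \<in> pi0 (simplices X 1) \<and> B \<in> pi0 (simplices X 1)
                   then section_coeff X (rep C) (rep A) (rep B) else 0)
              | _ \<Rightarrow> 0))"

definition delta_counit :: "('o, 'a) sgpd \<Rightarrow> 'o set option \<Rightarrow> rat" where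
  "delta_counit X u =
    (case u of
       None \<Rightarrow> 1
     | Some C \<Rightarrow> hcard (hofib (simplices X 0) (simplices X 1) (degen X 0 0) (rep C)))"

definition incidence_bialgebra :: "('x list, 'a) sgpd \<Rightarrow> 'x list set option bialg" where
  "incidence_bialgebra X =
    \<lparr>basis = insert None (Some ` pi0 (simplices X 1)),
     bmult = (\<lambda>p q. lin_ext (\<lambda>(u, v). Poly_Mapping.single (juxtapose X u v) 1) (tensor p q)),
     bone = Poly_Mapping.single None 1,
     comult = lin_ext (delta_comult X),
     counit = (\<lambda>p. \<Sum>u\<in>Poly_Mapping.keys p. Poly_Mapping.lookup p u * delta_counit X u)\<rparr>"

section \<open>Power series in arbitrarily many variables\<close>

text \<open>Exponents are multisets of variables, i.e. finitely supported maps to \<open>\<nat>\<close>.\<close>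

typedef ('v, 'r) mps = "UNIV :: ('v multiset \<Rightarrow> 'r) set"
  morphisms mcoeff Abs_mps ..

setup_lifting type_definition_mps

lemma mps_eqI: "(\<And>\<kappa>. mcoeff F \<kappa> = mcoeff G \<kappa>) \<Longrightarrow> F = G"
  by (metis mcoeff_inject ext)

lemma finite_submultisets: "finite {\<mu>. \<mu> \<subseteq># (\<kappa> :: 'v multiset)}"
proof (induction \<kappa>)
  case empty
  then show ?case by simp
next
  case (add x \<kappa>)
  have "{\<mu>. \<mu> \<subseteq># add_mset x \<kappa>} \<subseteq> {\<mu>. \<mu> \<subseteq># \<kappa>} \<union> add_mset x ` {\<mu>. \<mu> \<subseteq># \<kappa>}"
  proof
    fix \<mu> assume "\<mu> \<in> {\<mu>. \<mu> \<subseteq># add_mset x \<kappa>}"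
    then have le: "\<mu> \<subseteq># add_mset x \<kappa>" by simp
    show "\<mu> \<in> {\<mu>. \<mu> \<subseteq># \<kappa>} \<union> add_mset x ` {\<mu>. \<mu> \<subseteq># \<kappa>}"
    proof (cases "x \<in># \<mu>")
      case True
      then obtain \<nu> where "\<mu> = add_mset x \<nu>" by (meson mset_add)
      with le show ?thesis by auto
    next
      case False
      with le have "\<mu> \<subseteq># \<kappa>"
        by (metis diff_single_trivial subset_eq_diff_conv add_mset_add_single)
      then show ?thesis by simp
    qed
  qed
  with add show ?case by (meson finite_UnI finite_imageI finite_subset)
qed

instantiation mps :: (type, comm_ring_1) comm_ring_1
begin

lift_definition zero_mps :: "('a, 'b) mps" is "\<lambda>_. 0" .
lift_definition one_mps :: "('a, 'b) mps" is "\<lambda>\<kappa>. if \<kappa> = {#} then 1 else 0" .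
lift_definition plus_mps :: "('a, 'b) mps \<Rightarrow> ('a, 'b) mps \<Rightarrow> ('a, 'b) mps"
  is "\<lambda>F G \<kappa>. F \<kappa> + G \<kappa>" .
lift_definition minus_mps :: "('a, 'b) mps \<Rightarrow> ('a, 'b) mps \<Rightarrow> ('a, 'b) mps"
  is "\<lambda>F G \<kappa>. F \<kappa> - G \<kappa>" .
lift_definition uminus_mps :: "('a, 'b) mps \<Rightarrow> ('a, 'b) mps"
  is "\<lambda>F \<kappa>. - F \<kappa>" .
lift_definition times_mps :: "('a, 'b) mps \<Rightarrow> ('a, 'b) mps \<Rightarrow> ('a, 'b) mps"
  is "\<lambda>F G \<kappa>. \<Sum>\<mu> | \<mu> \<subseteq># \<kappa>. F \<mu> * G (\<kappa> - \<mu>)" .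

instance
proof
  fix F G H :: "('a, 'b) mps"
  show "F + G + H = F + (G + H)" by transfer (simp add: add.assoc)
  show "F + G = G + F" by transfer (simp add: add.commute)
  show "0 + F = F" by transfer simp
  show "- F + F = 0" by transfer simp
  show "F - G = F + - G" by transfer simp
  show "(F + G) * H = F * H + G * H"
    by transfer (simp add: distrib_right sum.distrib)
  show "(0 :: ('a, 'b) mps) \<noteq> 1" by transfer (metis zero_neq_one)
  show "F * G = G * F"
  proof (rule mps_eqI)
    fix \<kappa> :: "'a multiset"
    have *: "\<kappa> - (\<kappa> - \<mu>) = \<mu>" if "\<mu> \<subseteq># \<kappa>" for \<mu>
      using that by (simp add: multiset_eq_iff subseteq_mset_def)
    show "mcoeff (F * G) \<kappa> = mcoeff (G * F) \<kappa>"
      unfolding times_mps.rep_eq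
      by (rule sum.reindex_bij_witness[of _ "\<lambda>\<mu>. \<kappa> - \<mu>" "\<lambda>\<mu>. \<kappa> - \<mu>"])
         (auto simp: * mult.commute)
  qed
  show "1 * F = F"
  proof (rule mps_eqI)
    fix \<kappa>
    have "mcoeff (1 * F) \<kappa> = (\<Sum>\<mu> | \<mu> \<subseteq># \<kappa>. if \<mu> = {#} then mcoeff F \<kappa> else 0)"
      unfolding times_mps.rep_eq one_mps.rep_eq by (rule sum.cong) auto
    also have "\<dots> = mcoeff F \<kappa>"
      by (simp add: finite_submultisets)
    finally show "mcoeff (1 * F) \<kappa> = mcoeff F \<kappa>" .
  qed
  show "F * G * H = F * (G * H)"
  proof (rule mps_eqI)
    fix \<kappa>
    have "mcoeff (F * G * H) \<kappa> =
        (\<Sum>(\<mu>, \<nu>)\<in>(SIGMA \<mu>:{\<mu>. \<mu> \<subseteq># \<kappa>}. {\<nu>. \<nu> \<subseteq># \<mu>}).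
           mcoeff F \<nu> * mcoeff G (\<mu> - \<nu>) * mcoeff H (\<kappa> - \<mu>))"
      unfolding times_mps.rep_eq
      by (simp add: sum_distrib_right sum.Sigma finite_submultisets)
    also have "\<dots> =
        (\<Sum>(\<nu>, \<rho>)\<in>(SIGMA \<nu>:{\<nu>. \<nu> \<subseteq># \<kappa>}. {\<rho>. \<rho> \<subseteq># \<kappa> - \<nu>}).
           mcoeff F \<nu> * (mcoeff G \<rho> * mcoeff H (\<kappa> - \<nu> - \<rho>)))"
    proof (rule sum.reindex_bij_witness[of _ "\<lambda>(\<nu>, \<rho>). (\<nu> + \<rho>, \<nu>)" "\<lambda>(\<mu>, \<nu>). (\<nu>, \<mu> - \<nu>)"],
           goal_cases)
      case (1 a)
      then show ?case by (auto simp: subset_mset.add_diff_inverse)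
    next
      case (2 a)
      then show ?case by (auto simp: subseteq_mset_def diff_le_mono intro: order_trans)
    next
      case (3 b)
      then show ?case by auto
    next
      case (4 b)
      then show ?case
        by (auto simp: subset_mset.le_diff_conv2 add.commute)
    next
      case (5 a)
      then show ?case by (auto simp: mult.assoc subset_mset.add_diff_inverse)
    qed
    also have "\<dots> = mcoeff (F * (G * H)) \<kappa>"
      unfolding times_mps.rep_eq
      by (simp add: sum_distrib_left sum.Sigma finite_submultisets)
    finally show "mcoeff (F * G * H) \<kappa> = mcoeff (F * (G * H)) \<kappa>" .
  qed
qed

end

definition Var :: "'v \<Rightarrow> ('v, 'r::comm_ring_1) mps" where
  "Var m = Abs_mps (\<lambda>\<kappa>. if \<kappa> = {#m#} then 1 else 0)"

text \<open>
  Substitution of \<open>H m\<close> for every variable \<open>m\<close> in \<open>G\<close>.  It is meaningful if, for each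
  exponent \<open>\<kappa>\<close>, only finitely many monomials of \<open>G\<close> contribute to the coefficient at \<open>\<kappa>\<close>;
  over a locally finite monoid this is so for both uses below.
\<close>

definition mps_subst ::
  "('v, 'r) mps \<Rightarrow> ('v \<Rightarrow> ('w, 'r) mps) \<Rightarrow> ('w, 'r::comm_ring_1) mps" where
  "mps_subst G H =
    Abs_mps (\<lambda>\<kappa>. Sum_any (\<lambda>\<mu>. mcoeff G \<mu> * mcoeff (\<Prod>m\<in>#\<mu>. H m) \<kappa>))"

section \<open>Plethysm and the plethystic bialgebra of a monoid\<close>

definition shift :: "'y::monoid_mult \<Rightarrow> ('y, rat) mps \<Rightarrow> ('y, rat) mps" where
  "shift m F = mps_subst F (\<lambda>n. Var (m * n))"

definition plethysm ::
  "('y::monoid_mult, rat) mps \<Rightarrow> ('y, rat) mps \<Rightarrow> ('y, rat) mps" (infixl "\<circledast>" 70) where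
  "G \<circledast> F = mps_subst G (\<lambda>m. shift m F)"

definition no_const :: "('v, rat) mps set" where
  "no_const = {F. mcoeff F {#} = 0}"

definition mset_fact :: "'v multiset \<Rightarrow> nat" where
  "mset_fact \<mu> = (\<Prod>m\<in>set_mset \<mu>. fact (count \<mu> m))"

text \<open>The coordinate function \<open>a\<^sub>\<mu>(F) = f\<^sub>\<mu>\<close>, where \<open>F = \<Sum>\<^sub>\<mu> f\<^sub>\<mu> x\<^sup>\<mu> / \<mu>!\<close>.\<close>

definition coord :: "'v multiset \<Rightarrow> ('v, rat) mps \<Rightarrow> rat" where
  "coord \<mu> F = of_nat (mset_fact \<mu>) * mcoeff F \<mu>"

definition Lambda :: "'v multiset set" where
  "Lambda = {\<mu>. \<mu> \<noteq> {#}}"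

text \<open>
  The polynomial algebra \<open>\<rat>[a\<^sub>\<mu> : \<mu> \<in> \<Lambda>]\<close> is the monoid algebra of the monoid of
  finite multisets of elements of \<open>\<Lambda>\<close>, the monomials.  Its tensor square is the monoid
  algebra of pairs of monomials.
\<close>

type_synonym 'v monom = "'v multiset multiset"

definition monomials :: "'v monom set" where
  "monomials = {M. set_mset M \<subseteq> Lambda}"

definition eval_monom :: "'v monom \<Rightarrow> ('v, rat) mps \<Rightarrow> rat" where
  "eval_monom M F = (\<Prod>\<mu>\<in>#M. coord \<mu> F)"

definition eval_poly :: "('v monom \<Rightarrow>\<^sub>0 rat) \<Rightarrow> ('v, rat) mps \<Rightarrow> rat" where
  "eval_poly p F = (\<Sum>M\<in>Poly_Mapping.keys p. Poly_Mapping.lookup p M * eval_monom M F)"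

text \<open>\<open>(p \<otimes> q)(F, G) = p(F) q(G)\<close>\<close>

definition eval_tensor ::
  "('v monom \<times> 'v monom \<Rightarrow>\<^sub>0 rat) \<Rightarrow> ('v, rat) mps \<Rightarrow> ('v, rat) mps \<Rightarrow> rat" where
  "eval_tensor D F G =
    (\<Sum>(M, N)\<in>Poly_Mapping.keys D.
       Poly_Mapping.lookup D (M, N) * eval_monom M F * eval_monom N G)"

definition is_coord_comult ::
  "'y::monoid_mult multiset \<Rightarrow> ('y monom \<times> 'y monom \<Rightarrow>\<^sub>0 rat) \<Rightarrow> bool" where
  "is_coord_comult \<mu> D \<longleftrightarrow>
     Poly_Mapping.keys D \<subseteq> monomials \<times> monomials \<and>
     (\<forall>F\<in>no_const. \<forall>G\<in>no_const. eval_tensor D F G = coord \<mu> (G \<circledast> F))"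

definition coord_comult :: "'y::monoid_mult multiset \<Rightarrow> ('y monom \<times> 'y monom \<Rightarrow>\<^sub>0 rat)" where
  "coord_comult \<mu> = (THE D. is_coord_comult \<mu> D)"

text \<open>The comultiplication is the algebra homomorphism extending \<open>coord_comult\<close>.\<close>

definition plethystic_bialgebra :: "'y::monoid_mult monom bialg" where
  "plethystic_bialgebra =
    \<lparr>basis = monomials,
     bmult = (*),
     bone = 1,
     comult = lin_ext (\<lambda>M. \<Prod>\<mu>\<in>#M. coord_comult \<mu>),
     counit = (\<lambda>p. eval_poly p (Var 1))\<rparr>"

end

theory Submission
  imports Defs "HOL-Combinatorics.Multiset_Permutations"
begin

text \<open>
  By orbit counting, the homotopy cardinality of a finite groupoid is the sum over its objects \<open>x\<close> of
  \<open>1 / n\<^sub>x\<close>, where \<open>n\<^sub>x\<close> is the number of arrows starting at \<open>x\<close>; and an object of a homotopy fibre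
  starts as many arrows as its underlying object does.  So the coefficient of
  \<open>\<delta>\<^sub>a \<otimes> \<delta>\<^sub>b\<close> in \<open>\<Delta>(\<delta>\<^sub>f)\<close> is a sum over the \<open>2\<close>-simplices
  \<open>x\<close> with \<open>d\<^sub>2 x \<cong> a\<close> and \<open>d\<^sub>0 x \<cong> b\<close> of the number of arrows \<open>d\<^sub>1 x \<rightarrow> f\<close> divided by \<open>n\<^sub>x\<close>.  A \<open>2\<close>-simplex
  is a tuple of two-level trees, and \<open>n\<^sub>x\<close> is a product of factorials of lengths of lists, so that
  this sum is multiplicative in \<open>f\<close>.

  On the other side, a power series \<open>\<Sum>\<^sub>\<mu> f\<^sub>\<mu> x\<^sup>\<mu> / \<mu>!\<close> is a sum over lists, each list \<open>l\<close> contributing the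
  coordinate of its multiset divided by \<open>(length l)!\<close>, since \<open>\<mu>\<close> is the multiset of \<open>|\<mu>|! / \<mu>!\<close> lists.  Expanded
  in this way, the coefficients of \<open>G \<circledast> F\<close> agree term by term with the sum over two-level trees for a
  one-element tuple \<open>f\<close>.
\<close>

section \<open>Groupoids and homotopy fibres\<close>

text \<open>Multiplicativity in \<open>f\<close> is not visible at once: an arrow of tuples carries
  a permutation that mixes the entries. As the star of a \<open>k\<close>-tuple has the factor
  \<open>k!\<close>, averaging over permutations matches entries one by one, and a sum over tuples
  of trees becomes a product of sums over single trees. The conditions on \<open>d\<^sub>2\<close>
  and \<open>d\<^sub>0\<close> see only isomorphism types. The type of a tuple is a multiset of
  multisets, i.e. a monomial, and types add under juxtaposition; so these conditions pick out a
  coefficient of a product in the tensor square of the polynomial algebra. The leafward level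
  belongs to \<open>F\<close> and the first tensor factor, the root to \<open>G\<close> and the
  second. Local finiteness bounds the trees: their entries are left or right factors of the entries
  of the composite. Two obligations lie outside the counting. The records carry no axioms, so the
  groupoid laws and the functoriality of the faces, concatenation included, have to be proved. And
  the comultiplication of a coordinate is a definite description, so a polynomial must be determined
  by its values; this is the independence of characters.\<close>

locale groupoid =
  fixes G :: "('o, 'a) gpd"
  assumes dm_obj: "a \<in> arr G \<Longrightarrow> dm G a \<in> obj G"
    and cd_obj: "a \<in> arr G \<Longrightarrow> cd G a \<in> obj G"
    and idt_hom: "x \<in> obj G \<Longrightarrow> idt G x \<in> hom G x x"
    and cmp_hom: "\<lbrakk>a \<in> arr G; b \<in> arr G; cd G a = dm G b\<rbrakk> \<Longrightarrow> cmp G b a \<in> hom G (dm G a) (cd G b)"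
    and cmp_assoc: "\<lbrakk>a \<in> arr G; b \<in> arr G; c \<in> arr G; cd G a = dm G b; cd G b = dm G c\<rbrakk>
      \<Longrightarrow> cmp G c (cmp G b a) = cmp G (cmp G c b) a"
    and cmp_idt_right: "a \<in> arr G \<Longrightarrow> cmp G a (idt G (dm G a)) = a"
    and cmp_idt_left: "a \<in> arr G \<Longrightarrow> cmp G (idt G (cd G a)) a = a"
    and inverse_ex: "a \<in> arr G \<Longrightarrow>
      \<exists>b\<in>arr G. dm G b = cd G a \<and> cd G b = dm G a \<and>
        cmp G b a = idt G (dm G a) \<and> cmp G a b = idt G (cd G a)"

text \<open>\<open>card (star G x)\<close> is the \<open>n\<^sub>x\<close> of the overview. Stars
  are preferred to automorphism groups because their size survives passage to a homotopy fibre and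
  factors over the entries of a tuple, without any choice of representatives.\<close>

definition star :: "('o, 'a) gpd \<Rightarrow> 'o \<Rightarrow> 'a set" where
  "star G x = {a \<in> arr G. dm G a = x}"

locale gfunctor =
  fixes F :: "('o, 'a, 'p, 'b) gfun" and G :: "('o, 'a) gpd" and H :: "('p, 'b) gpd"
  assumes ob_obj: "x \<in> obj G \<Longrightarrow> ob F x \<in> obj H"
    and ar_arr: "a \<in> arr G \<Longrightarrow> ar F a \<in> arr H"
    and dm_ar: "a \<in> arr G \<Longrightarrow> dm H (ar F a) = ob F (dm G a)"
    and cd_ar: "a \<in> arr G \<Longrightarrow> cd H (ar F a) = ob F (cd G a)"
    and ar_cmp: "\<lbrakk>a \<in> arr G; b \<in> arr G; cd G a = dm G b\<rbrakk>
      \<Longrightarrow> ar F (cmp G b a) = cmp H (ar F b) (ar F a)"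

context groupoid
begin

lemma idt_simps [simp]:
  "x \<in> obj G \<Longrightarrow> idt G x \<in> arr G" "x \<in> obj G \<Longrightarrow> dm G (idt G x) = x" "x \<in> obj G \<Longrightarrow> cd G (idt G x) = x"
  using idt_hom by (auto simp: hom_def)

lemma cmp_simps [simp]:
  assumes "a \<in> arr G" "b \<in> arr G" "cd G a = dm G b"
  shows "cmp G b a \<in> arr G" "dm G (cmp G b a) = dm G a" "cd G (cmp G b a) = cd G b"
  using cmp_hom[OF assms] by (auto simp: hom_def)

lemma bij_betw_cmp_left:
  assumes g: "g \<in> hom G y z"
  shows "bij_betw (cmp G g) (hom G x y) (hom G x z)"
proof -
  from g obtain h where gA: "g \<in> arr G" "dm G g = y" "cd G g = z"
    and h: "h \<in> arr G" "dm G h = z" "cd G h = y"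
    and hg: "cmp G h g = idt G y" and gh: "cmp G g h = idt G z"
    using inverse_ex[of g] by (auto simp: hom_def)
  show ?thesis
  proof (rule bij_betw_byWitness[where f' = "cmp G h"])
    show "\<forall>a\<in>hom G x y. cmp G h (cmp G g a) = a"
      using cmp_assoc[OF _ gA(1) h(1)] gA h hg cmp_idt_left by (fastforce simp: hom_def)
    show "\<forall>a\<in>hom G x z. cmp G g (cmp G h a) = a"
      using cmp_assoc[OF _ h(1) gA(1)] gA h gh cmp_idt_left by (fastforce simp: hom_def)
  qed (use gA h in \<open>auto simp: hom_def\<close>)
qed

lemma bij_betw_cmp_right:
  assumes g: "g \<in> hom G x y"
  shows "bij_betw (\<lambda>a. cmp G a g) (hom G y z) (hom G x z)"
proof -
  from g obtain h where gA: "g \<in> arr G" "dm G g = x" "cd G g = y"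
    and h: "h \<in> arr G" "dm G h = y" "cd G h = x"
    and hg: "cmp G h g = idt G x" and gh: "cmp G g h = idt G y"
    using inverse_ex[of g] by (auto simp: hom_def)
  show ?thesis
  proof (rule bij_betw_byWitness[where f' = "\<lambda>a. cmp G a h"])
    show "\<forall>a\<in>hom G y z. cmp G (cmp G a g) h = a"
      using cmp_assoc[OF h(1) gA(1), symmetric] gA h gh cmp_idt_right by (fastforce simp: hom_def)
    show "\<forall>a\<in>hom G x z. cmp G (cmp G a h) g = a"
      using cmp_assoc[OF gA(1) h(1), symmetric] gA h hg cmp_idt_right by (fastforce simp: hom_def)
  qed (use gA h in \<open>auto simp: hom_def\<close>)
qed

lemma hom_sym: "hom G x y \<noteq> {} \<Longrightarrow> hom G y x \<noteq> {}"
  using inverse_ex by (force simp: hom_def)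

lemma hom_trans: "\<lbrakk>hom G x y \<noteq> {}; hom G y z \<noteq> {}\<rbrakk> \<Longrightarrow> hom G x z \<noteq> {}"
  using bij_betw_cmp_left unfolding bij_betw_def by fastforce

lemma equiv_iso_rel: "equiv (obj G) (iso_rel G)"
proof (rule equivI)
  show "iso_rel G \<subseteq> obj G \<times> obj G" by (auto simp: iso_rel_def)
  show "refl_on (obj G) (iso_rel G)"
    using idt_hom by (auto simp: refl_on_def iso_rel_def)
  show "sym (iso_rel G)" using hom_sym by (auto simp: sym_def iso_rel_def)
  show "trans (iso_rel G)"
    using hom_trans by (auto simp: trans_def iso_rel_def)
qed

text \<open>Composing with one chosen arrow from \<open>x\<close> to \<open>y\<close>, before or
  after, identifies \<open>hom G x y\<close> with either automorphism group.\<close>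

lemma hom_card_aut:
  assumes "(x, y) \<in> iso_rel G"
  shows "card (hom G x y) = card (aut G x)" "card (hom G x y) = card (aut G y)"
    "finite (hom G x y) \<longleftrightarrow> finite (aut G x)"
proof -
  from assms obtain g where g: "g \<in> hom G x y" by (auto simp: iso_rel_def)
  show "card (hom G x y) = card (aut G x)"
    using bij_betw_same_card[OF bij_betw_cmp_left[OF g, of x]] by (simp add: aut_def)
  show "card (hom G x y) = card (aut G y)"
    using bij_betw_same_card[OF bij_betw_cmp_right[OF g, of y]] by (simp add: aut_def)
  show "finite (hom G x y) \<longleftrightarrow> finite (aut G x)"
    using bij_betw_finite[OF bij_betw_cmp_left[OF g, of x]] by (simp add: aut_def)
qed

lemma pi0_class:
  assumes "C \<in> pi0 G"
  shows "C \<subseteq> obj G" "rep C \<in> C" "rep C \<in> obj G" "x \<in> C \<Longrightarrow> C = iso_rel G `` {x}"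
    "x \<in> C \<Longrightarrow> y \<in> C \<Longrightarrow> (x, y) \<in> iso_rel G"
proof -
  note e = equiv_iso_rel
  have q: "C \<in> obj G // iso_rel G" using assms by (simp add: pi0_def)
  show 1: "C \<subseteq> obj G" using in_quotient_imp_subset[OF e q] .
  have "C \<noteq> {}" using in_quotient_imp_non_empty[OF e q] .
  then show 2: "rep C \<in> C" unfolding rep_def by (simp add: some_in_eq)
  show "rep C \<in> obj G" using 1 2 by blast
  show *: "x \<in> C \<Longrightarrow> y \<in> C \<Longrightarrow> (x, y) \<in> iso_rel G" for x y
    using quotient_eq_iff[OF e q q] by blast
  show "x \<in> C \<Longrightarrow> C = iso_rel G `` {x}"
    using q equiv_class_eq[OF e] by (auto elim!: quotientE)
qed

text \<open>Sort the arrows out of \<open>x\<close> by target. Every object of the class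
  \<open>C\<close> is a target, and each of the hom-sets is as large as the automorphism
  group.\<close>

lemma card_star:
  assumes C: "C \<in> pi0 G" and x: "x \<in> C" and fin: "finite C" "finite (aut G (rep C))"
  shows "card (star G x) = card C * card (aut G (rep C))"
proof -
  have r: "(x, rep C) \<in> iso_rel G" "(rep C, x) \<in> iso_rel G" using pi0_class[OF C] x by blast+
  have ax: "card (aut G x) = card (aut G (rep C))" "finite (aut G x)"
    using hom_card_aut(1,2)[OF r(1)] hom_card_aut(3)[OF r(2)] hom_card_aut(3)[OF r(1)] fin(2)
      bij_betw_finite[OF bij_betw_cmp_right] r
    by (auto simp: aut_def iso_rel_def)
  have "star G x = (\<Union>y\<in>C. hom G x y)"
  proof (intro equalityI subsetI)
    fix a assume a: "a \<in> star G x"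
    then have "(x, cd G a) \<in> iso_rel G"
      using dm_obj cd_obj by (auto simp: star_def iso_rel_def hom_def)
    then have "cd G a \<in> C" using pi0_class(4)[OF C x] by blast
    with a show "a \<in> (\<Union>y\<in>C. hom G x y)" by (auto simp: star_def hom_def)
  qed (auto simp: star_def hom_def)
  also have "card \<dots> = (\<Sum>y\<in>C. card (hom G x y))"
    by (rule card_UN_disjoint)
      (use fin ax pi0_class(5)[OF C x] hom_card_aut(3) in \<open>auto simp: hom_def\<close>)
  also have "\<dots> = (\<Sum>y\<in>C. card (aut G (rep C)))"
    using pi0_class(5)[OF C x] hom_card_aut(1) ax by (intro sum.cong) auto
  finally show ?thesis by simp
qed

lemma finite_pi0: "finite (obj G) \<Longrightarrow> finite (pi0 G)"
  unfolding pi0_def quotient_def by auto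

text \<open>Orbit counting: a class \<open>C\<close> contributes \<open>card C\<close> equal terms.\<close>

lemma hcard_eq_sum_star:
  assumes fin: "finite (obj G)" "\<And>x. x \<in> obj G \<Longrightarrow> finite (aut G x)"
  shows "hcard G = (\<Sum>x\<in>obj G. 1 / of_nat (card (star G x)))"
proof -
  have "(\<Sum>x\<in>obj G. 1 / of_nat (card (star G x)) :: rat)
      = (\<Sum>x\<in>\<Union>(pi0 G). 1 / of_nat (card (star G x)))"
    using Union_quotient[OF equiv_iso_rel] by (simp add: pi0_def)
  also have "\<dots> = (\<Sum>C\<in>pi0 G. \<Sum>x\<in>C. 1 / of_nat (card (star G x)))"
  proof (subst sum.Union_disjoint)
    show "\<forall>A\<in>pi0 G. finite A" using pi0_class(1) fin(1) finite_subset by blast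
    show "\<forall>A\<in>pi0 G. \<forall>B\<in>pi0 G. A \<noteq> B \<longrightarrow> A \<inter> B = {}"
      using quotient_disj[OF equiv_iso_rel] by (auto simp: pi0_def)
  qed simp
  also have "\<dots> = (\<Sum>C\<in>pi0 G. 1 / of_nat (card (aut G (rep C))))"
  proof (rule sum.cong[OF refl])
    fix C assume C: "C \<in> pi0 G"
    have f: "finite C" "finite (aut G (rep C))" "C \<noteq> {}"
      using pi0_class[OF C] fin finite_subset by blast+
    have "(\<Sum>x\<in>C. 1 / of_nat (card (star G x)) :: rat)
        = (\<Sum>x\<in>C. 1 / of_nat (card C * card (aut G (rep C))))"
      using card_star[OF C _ f(1,2)] by (intro sum.cong) auto
    also have "\<dots> = 1 / of_nat (card (aut G (rep C)))" using f by simp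
    finally show "(\<Sum>x\<in>C. 1 / of_nat (card (star G x)) :: rat) = 1 / of_nat (card (aut G (rep C)))" .
  qed
  finally show ?thesis by (simp add: hcard_def)
qed

end

section \<open>Functors, products, pullbacks, homotopy fibres and relabelling\<close>

lemma gfunctor_gcomp:
  assumes "gfunctor F A B" "gfunctor F' B C"
  shows "gfunctor (F' \<odot> F) A C"
proof -
  interpret F: gfunctor F A B by fact
  interpret F': gfunctor F' B C by fact
  show ?thesis
    by unfold_locales
      (auto simp: gcomp_def F.ob_obj F.ar_arr F.dm_ar F.cd_ar F.ar_cmp F'.ob_obj F'.ar_arr F'.dm_ar F'.cd_ar F'.ar_cmp)
qed

text \<open>The image of an identity is idempotent, and in a groupoid an idempotent arrow can be
  cancelled against its left inverse \<open>b\<close>.\<close>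

lemma gfunctor_idt:
  assumes "gfunctor F G H" "groupoid G" "groupoid H" and x: "x \<in> obj G"
  shows "ar F (idt G x) = idt H (ob F x)"
proof -
  interpret F: gfunctor F G H by fact
  interpret G: groupoid G by fact
  interpret H: groupoid H by fact
  let ?e = "ar F (idt G x)"
  have e: "?e \<in> arr H" "dm H ?e = ob F x" "cd H ?e = ob F x"
    using x by (auto simp: F.ar_arr F.dm_ar F.cd_ar)
  have ee: "cmp H ?e ?e = ?e"
    using F.ar_cmp[of "idt G x" "idt G x"] x G.cmp_idt_left[of "idt G x"] by simp
  obtain b where b: "b \<in> arr H" "dm H b = ob F x" "cd H b = ob F x" "cmp H b ?e = idt H (ob F x)"
    using H.inverse_ex[OF e(1)] e by auto
  have "?e = cmp H (cmp H b ?e) ?e" using b e H.cmp_idt_left by metis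
  also have "\<dots> = cmp H b (cmp H ?e ?e)" using b e H.cmp_assoc by simp
  finally show ?thesis using ee b by simp
qed

lemma groupoid_discrete: "groupoid (discrete S)"
  by unfold_locales (auto simp: discrete_def hom_def)

lemma groupoid_gprod:
  assumes "groupoid A" "groupoid B"
  shows "groupoid (gprod A B)"
proof -
  interpret A: groupoid A by fact
  interpret B: groupoid B by fact
  show ?thesis
  proof
    fix a assume a: "a \<in> arr (gprod A B)"
    then obtain a1 a2 where [simp]: "a = (a1, a2)" and "a1 \<in> arr A" "a2 \<in> arr B"
      by (auto simp: gprod_def)
    with A.inverse_ex[of a1] B.inverse_ex[of a2]
    show "\<exists>b\<in>arr (gprod A B). dm (gprod A B) b = cd (gprod A B) a \<and> cd (gprod A B) b = dm (gprod A B) a \<and>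
        cmp (gprod A B) b a = idt (gprod A B) (dm (gprod A B) a) \<and>
        cmp (gprod A B) a b = idt (gprod A B) (cd (gprod A B) a)"
      by (fastforce simp: gprod_def)
  qed (auto simp: gprod_def hom_def A.dm_obj A.cd_obj B.dm_obj B.cd_obj A.cmp_assoc B.cmp_assoc
      A.cmp_idt_left B.cmp_idt_left A.cmp_idt_right B.cmp_idt_right)
qed

lemma hom_gprod: "hom (gprod A B) (x, y) (x', y') = hom A x x' \<times> hom B y y'"
  by (auto simp: gprod_def hom_def)

lemma gfunctor_gpair:
  assumes "gfunctor F A B" "gfunctor F' A C"
  shows "gfunctor (gpair F F') A (gprod B C)"
proof -
  interpret F: gfunctor F A B by fact
  interpret F': gfunctor F' A C by fact
  show ?thesis
    by unfold_locales
      (auto simp: gpair_def gprod_def F.ob_obj F.ar_arr F.dm_ar F.cd_ar F.ar_cmp F'.ob_obj F'.ar_arr F'.dm_ar F'.cd_ar F'.ar_cmp)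
qed

lemma pullback_simps [simp]:
  "obj (pullback A B F K) = {(x, y). x \<in> obj A \<and> y \<in> obj B \<and> ob F x = ob K y}"
  "arr (pullback A B F K) = {(a, b). a \<in> arr A \<and> b \<in> arr B \<and> ar F a = ar K b}"
  "dm (pullback A B F K) (a, b) = (dm A a, dm B b)"
  "cd (pullback A B F K) (a, b) = (cd A a, cd B b)"
  "idt (pullback A B F K) (x, y) = (idt A x, idt B y)"
  "cmp (pullback A B F K) (a', b') (a, b) = (cmp A a' a, cmp B b' b)"
  by (auto simp: pullback_def gprod_def)

lemma groupoid_pullback:
  assumes "groupoid A" "groupoid B" "groupoid C" "gfunctor F A C" "gfunctor K B C"
  shows "groupoid (pullback A B F K)"
proof -
  interpret A: groupoid A by fact
  interpret B: groupoid B by fact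
  interpret C: groupoid C by fact
  interpret F: gfunctor F A C by fact
  interpret K: gfunctor K B C by fact
  note Fidt = gfunctor_idt[OF assms(4) assms(1,3)]
  note Kidt = gfunctor_idt[OF assms(5) assms(2,3)]
  let ?P = "pullback A B F K"
  have dmcd: "ob F (dm A a) = ob K (dm B b)" "ob F (cd A a) = ob K (cd B b)"
    if "a \<in> arr A" "b \<in> arr B" "ar F a = ar K b" for a b
    using that F.dm_ar F.cd_ar K.dm_ar K.cd_ar by metis+
  show ?thesis
  proof
    fix a assume a: "a \<in> arr ?P"
    then obtain a1 a2 where [simp]: "a = (a1, a2)" and aa: "a1 \<in> arr A" "a2 \<in> arr B" and e: "ar F a1 = ar K a2"
      by auto
    obtain b1 where b1: "b1 \<in> arr A" "dm A b1 = cd A a1" "cd A b1 = dm A a1"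
      "cmp A b1 a1 = idt A (dm A a1)" "cmp A a1 b1 = idt A (cd A a1)" using A.inverse_ex[OF aa(1)] by auto
    obtain b2 where b2: "b2 \<in> arr B" "dm B b2 = cd B a2" "cd B b2 = dm B a2"
      "cmp B b2 a2 = idt B (dm B a2)" "cmp B a2 b2 = idt B (cd B a2)" using B.inverse_ex[OF aa(2)] by auto
    let ?c = "ar F a1"
    have c: "?c \<in> arr C" "dm C ?c = ob F (dm A a1)" "cd C ?c = ob F (cd A a1)"
      using aa F.ar_arr F.dm_ar F.cd_ar by auto
    have i1: "cmp C (ar F b1) ?c = idt C (ob F (dm A a1))"
      using F.ar_cmp[OF aa(1) b1(1)] b1 Fidt[OF A.dm_obj[OF aa(1)]] by simp
    have i2: "cmp C (ar K b2) ?c = idt C (ob F (dm A a1))"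
      using K.ar_cmp[OF aa(2) b2(1)] b2 Kidt[OF B.dm_obj[OF aa(2)]] e dmcd[OF aa e] by simp
    \<comment> \<open>The inverses \<open>b1\<close> and \<open>b2\<close> are chosen independently,
      so they must be shown to agree in \<open>C\<close>. Both images are left inverses of the
      common image \<open>?c\<close>, and left inverses are unique.\<close>
    have "inj_on (\<lambda>u. cmp C u ?c) (hom C (ob F (cd A a1)) (ob F (dm A a1)))"
      using C.bij_betw_cmp_right[of ?c] c by (auto simp: hom_def bij_betw_def)
    moreover have "ar F b1 \<in> hom C (ob F (cd A a1)) (ob F (dm A a1))"
      "ar K b2 \<in> hom C (ob F (cd A a1)) (ob F (dm A a1))"
      using b1 b2 dmcd[OF aa e] by (auto simp: hom_def F.ar_arr F.dm_ar F.cd_ar K.ar_arr K.dm_ar K.cd_ar)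
    ultimately have "ar F b1 = ar K b2" using i1 i2 by (metis (no_types, lifting) inj_onD)
    then have "(b1, b2) \<in> arr ?P" using b1 b2 by simp
    then show "\<exists>b\<in>arr ?P. dm ?P b = cd ?P a \<and> cd ?P b = dm ?P a \<and>
        cmp ?P b a = idt ?P (dm ?P a) \<and> cmp ?P a b = idt ?P (cd ?P a)"
      using b1 b2 by (intro bexI[of _ "(b1, b2)"]) auto
  qed (auto simp: hom_def A.dm_obj A.cd_obj B.dm_obj B.cd_obj A.cmp_assoc B.cmp_assoc
      A.cmp_idt_left B.cmp_idt_left A.cmp_idt_right B.cmp_idt_right dmcd Fidt Kidt F.ar_cmp K.ar_cmp)
qed

lemma gfunctor_pullback_fst: "gfunctor gfst (pullback A B F K) A"
  by unfold_locales (auto simp: gfst_def)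

lemma gfunctor_pullback_snd: "gfunctor gsnd (pullback A B F K) B"
  by unfold_locales (auto simp: gsnd_def)

lemma hofib_simps [simp]:
  "obj (hofib G B F b) = {(x, u). x \<in> obj G \<and> u \<in> hom B (ob F x) b}"
  "arr (hofib G B F b) = {(u, a, u'). a \<in> arr G \<and> u \<in> hom B (ob F (dm G a)) b \<and>
              u' \<in> hom B (ob F (cd G a)) b \<and> cmp B u' (ar F a) = u}"
  "dm (hofib G B F b) (u, a, u') = (dm G a, u)"
  "cd (hofib G B F b) (u, a, u') = (cd G a, u')"
  "idt (hofib G B F b) (x, u) = (u, idt G x, u)"
  "cmp (hofib G B F b) (v, c, v') (u, a, u') = (u, cmp G c a, v')"
  by (auto simp: hofib_def)

lemma groupoid_hofib:
  assumes "groupoid G" "groupoid B" "gfunctor F G B"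
  shows "groupoid (hofib G B F b)"
proof -
  interpret G: groupoid G by fact
  interpret B: groupoid B by fact
  interpret F: gfunctor F G B by fact
  note Fidt = gfunctor_idt[OF assms(3) assms(1,2)]
  let ?P = "hofib G B F b"
  have assoc: "cmp B u (ar F (cmp G c a)) = cmp B (cmp B u (ar F c)) (ar F a)"
    if "a \<in> arr G" "c \<in> arr G" "cd G a = dm G c" "u \<in> hom B (ob F (cd G c)) b" for a c u
    using that B.cmp_assoc[of "ar F a" "ar F c" u] by (auto simp: hom_def F.ar_cmp F.ar_arr F.dm_ar F.cd_ar)
  have right_idt: "cmp B u (ar F (idt G x)) = u" if "x \<in> obj G" "u \<in> hom B (ob F x) b" for x u
    using that B.cmp_idt_right[of u] by (auto simp: hom_def Fidt)
  show ?thesis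
  proof
    fix a assume a: "a \<in> arr ?P"
    then obtain u c u' where [simp]: "a = (u, c, u')" and c: "c \<in> arr G" and u: "u \<in> hom B (ob F (dm G c)) b"
      and u': "u' \<in> hom B (ob F (cd G c)) b" and e: "cmp B u' (ar F c) = u" by auto
    obtain d where d: "d \<in> arr G" "dm G d = cd G c" "cd G d = dm G c"
      "cmp G d c = idt G (dm G c)" "cmp G c d = idt G (cd G c)" using G.inverse_ex[OF c] by auto
    have "cmp B u (ar F d) = u'"
      using assoc[of d c u'] d c u' right_idt[of "cd G c" u'] G.cd_obj[OF c] e by simp
    then have "(u', d, u) \<in> arr ?P" using d u u' by simp
    then show "\<exists>b'\<in>arr ?P. dm ?P b' = cd ?P a \<and> cd ?P b' = dm ?P a \<and>
        cmp ?P b' a = idt ?P (dm ?P a) \<and> cmp ?P a b' = idt ?P (cd ?P a)"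
      using d by (intro bexI[of _ "(u', d, u)"]) auto
  next
    fix x assume "x \<in> obj ?P"
    then show "idt ?P x \<in> hom ?P x x" using right_idt by (auto simp: hom_def[of ?P])
  next
    fix a a' assume "a \<in> arr ?P" "a' \<in> arr ?P" "cd ?P a = dm ?P a'"
    then show "cmp ?P a' a \<in> hom ?P (dm ?P a) (cd ?P a')" using assoc by (auto simp: hom_def[of ?P])
  qed (auto simp: hom_def[of ?P] G.dm_obj G.cd_obj G.cmp_assoc G.cmp_idt_left G.cmp_idt_right)
qed

lemma gfunctor_hofib_proj: "gfunctor hofib_proj (hofib G B F b) G"
  by unfold_locales (auto simp: hofib_proj_def)

text \<open>The projection from a homotopy fibre lifts arrows uniquely: for \<open>a\<close> out of
  \<open>x\<close>, the arrow \<open>u'\<close> at the target has to satisfy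
  \<open>cmp B u' (ar F a) = u\<close>, and composition with \<open>ar F a\<close> is
  bijective.\<close>

lemma card_star_hofib:
  assumes "groupoid G" "groupoid B" "gfunctor F G B" and x: "(x, u) \<in> obj (hofib G B F b)"
  shows "card (star (hofib G B F b) (x, u)) = card (star G x)"
proof -
  interpret G: groupoid G by fact
  interpret B: groupoid B by fact
  interpret F: gfunctor F G B by fact
  have u: "x \<in> obj G" "u \<in> hom B (ob F x) b" using x by auto
  have mem_star: "(v, a, u') \<in> star (hofib G B F b) (x, u) \<longleftrightarrow>
      v = u \<and> a \<in> star G x \<and> u' \<in> hom B (ob F (cd G a)) b \<and> cmp B u' (ar F a) = u" for v a u'
    using u(2) unfolding star_def by auto
  have ex1: "\<exists>!u'. u' \<in> hom B (ob F (cd G a)) b \<and> cmp B u' (ar F a) = u" if a: "a \<in> star G x" for a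
  proof -
    have "ar F a \<in> hom B (ob F x) (ob F (cd G a))"
      using a by (auto simp: star_def hom_def F.ar_arr F.dm_ar F.cd_ar)
    note bij = B.bij_betw_cmp_right[OF this, of b]
    then have "u \<in> (\<lambda>v. cmp B v (ar F a)) ` hom B (ob F (cd G a)) b"
      using u(2) by (simp add: bij_betw_def)
    then obtain u' where u': "u' \<in> hom B (ob F (cd G a)) b" "cmp B u' (ar F a) = u" by blast
    show ?thesis
    proof (rule ex1I[of _ u'])
      fix v assume "v \<in> hom B (ob F (cd G a)) b \<and> cmp B v (ar F a) = u"
      with u' inj_onD[OF bij_betw_imp_inj_on[OF bij], of v u'] show "v = u'" by simp
    qed (use u' in simp)
  qed
  have "bij_betw (\<lambda>(u, a, u'). a) (star (hofib G B F b) (x, u)) (star G x)"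
    unfolding bij_betw_def
  proof
    show "inj_on (\<lambda>(u, a, u'). a) (star (hofib G B F b) (x, u))"
    proof (rule inj_onI)
      fix p q
      assume pq: "p \<in> star (hofib G B F b) (x, u)" "q \<in> star (hofib G B F b) (x, u)"
        and e: "(case p of (u, a, u') \<Rightarrow> a) = (case q of (u, a, u') \<Rightarrow> a)"
      obtain u1 a u1' where p: "p = (u1, a, u1')" by (rule prod_cases3)
      obtain u2 a' u2' where q: "q = (u2, a', u2')" by (rule prod_cases3)
      from e p q have "a' = a" by simp
      with pq ex1[of a] have "u1 = u2 \<and> u1' = u2'" unfolding p q mem_star by blast
      with p q \<open>a' = a\<close> show "p = q" by simp
    qed
    show "(\<lambda>(u, a, u'). a) ` star (hofib G B F b) (x, u) = star G x"
    proof (intro equalityI subsetI)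
      fix a assume a: "a \<in> star G x"
      then obtain u' where "u' \<in> hom B (ob F (cd G a)) b" "cmp B u' (ar F a) = u" using ex1 by blast
      then have "(u, a, u') \<in> star (hofib G B F b) (x, u)" using a u by (simp add: mem_star)
      then show "a \<in> (\<lambda>(u, a, u'). a) ` star (hofib G B F b) (x, u)"
        by (rule rev_image_eqI) simp
    qed (auto simp: mem_star)
  qed
  then show ?thesis by (rule bij_betw_same_card)
qed

lemma relabel_simps [simp]:
  assumes "inj (ob R)" "inj (ar R)"
  shows "obj (relabel R G) = ob R ` obj G" "arr (relabel R G) = ar R ` arr G"
    "dm (relabel R G) (ar R a) = ob R (dm G a)" "cd (relabel R G) (ar R a) = ob R (cd G a)"
    "idt (relabel R G) (ob R x) = ar R (idt G x)"
    "cmp (relabel R G) (ar R b) (ar R a) = ar R (cmp G b a)"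
  using assms by (auto simp: relabel_def)

lemma hom_relabel:
  assumes "inj (ob R)" "inj (ar R)"
  shows "hom (relabel R G) (ob R x) (ob R y) = ar R ` hom G x y"
  using assms by (auto simp: hom_def inj_eq)

lemma star_relabel:
  assumes "inj (ob R)" "inj (ar R)"
  shows "star (relabel R G) (ob R x) = ar R ` star G x"
  using assms by (auto simp: star_def inj_eq)

lemma groupoid_relabel:
  assumes R: "inj (ob R)" "inj (ar R)" and "groupoid G"
  shows "groupoid (relabel R G)"
proof -
  interpret G: groupoid G by fact
  note [simp] = relabel_simps[OF R] hom_relabel[OF R]
  show ?thesis
  proof
    fix a assume "a \<in> arr (relabel R G)"
    then obtain a' where a': "a' \<in> arr G" and [simp]: "a = ar R a'" by auto
    obtain d where d: "d \<in> arr G" "dm G d = cd G a'" "cd G d = dm G a'"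
      "cmp G d a' = idt G (dm G a')" "cmp G a' d = idt G (cd G a')" using G.inverse_ex[OF a'] by auto
    then show "\<exists>b\<in>arr (relabel R G). dm (relabel R G) b = cd (relabel R G) a \<and>
       cd (relabel R G) b = dm (relabel R G) a \<and>
       cmp (relabel R G) b a = idt (relabel R G) (dm (relabel R G) a) \<and>
       cmp (relabel R G) a b = idt (relabel R G) (cd (relabel R G) a)"
      by (intro bexI[of _ "ar R d"]) auto
  qed (auto simp: G.dm_obj G.cd_obj G.cmp_assoc G.cmp_idt_left G.cmp_idt_right G.idt_hom G.cmp_hom inj_eq[OF R(1)])
qed

lemma gfunctor_relabel:
  assumes "inj (ob R)" "inj (ar R)"
  shows "gfunctor R G (relabel R G)"
  using assms by unfold_locales auto

lemma gfunctor_ginv_relabel: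
  assumes "inj (ob R)" "inj (ar R)"
  shows "gfunctor (ginv R) (relabel R G) G"
  using assms by unfold_locales (auto simp: ginv_def inj_eq)

section \<open>Tuples up to symmetry\<close>

lemma Sr_simps [simp]:
  "obj (Sr A) = {xs. xs \<noteq> [] \<and> set xs \<subseteq> obj A}"
  "arr (Sr A) = {(\<sigma>, fs). fs \<noteq> [] \<and> set fs \<subseteq> arr A \<and> \<sigma> permutes {..<length fs}}"
  "dm (Sr A) (\<sigma>, fs) = map (dm A) fs"
  "cd (Sr A) (\<sigma>, fs) = permute_list \<sigma> (map (cd A) fs)"
  "idt (Sr A) xs = (id, map (idt A) xs)"
  by (auto simp: Sr_def)

text \<open>Entry \<open>j\<close> of the target of \<open>(\<sigma>, fs)\<close> is the target of
  \<open>fs ! \<sigma> j\<close>. Hence \<open>fs ! i\<close> ends at position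
  \<open>inv \<sigma> i\<close>, and this is the component of \<open>gs\<close> that follows
  it.\<close>

lemma Sr_cmp:
  assumes "length gs = length fs" "\<sigma> permutes {..<length fs}"
  shows "cmp (Sr A) (\<tau>, gs) (\<sigma>, fs) = (\<sigma> \<circ> \<tau>, map (\<lambda>i. cmp A (gs ! inv \<sigma> i) (fs ! i)) [0..<length fs])"
proof -
  have "inv \<sigma> permutes {..<length gs}" using assms by (simp add: permutes_inv)
  then show ?thesis
    using assms by (auto simp: Sr_def intro!: nth_equalityI simp: permute_list_nth)
qed

lemma permutes_nth_less:
  "\<sigma> permutes {..<n} \<Longrightarrow> i < n \<Longrightarrow> \<sigma> i < n" "\<sigma> permutes {..<n} \<Longrightarrow> i < n \<Longrightarrow> inv \<sigma> i < n"
  using permutes_in_image[of \<sigma> "{..<n}" i] permutes_in_image[OF permutes_inv, of \<sigma> "{..<n}" i] by auto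

lemma permute_list_eq_Nil_iff [simp]: "permute_list \<sigma> xs = [] \<longleftrightarrow> xs = []"
  using length_permute_list[of \<sigma> xs] by fastforce

lemma groupoid_Sr:
  assumes "groupoid A"
  shows "groupoid (Sr A)"
proof -
  interpret A: groupoid A by fact
  show ?thesis
  proof
    fix x assume "x \<in> obj (Sr A)"
    then show "idt (Sr A) x \<in> hom (Sr A) x x"
      by (auto simp: hom_def permutes_id intro!: map_idI A.idt_hom)
  next
    fix a assume "a \<in> arr (Sr A)"
    then obtain \<sigma> fs where [simp]: "a = (\<sigma>, fs)" and ne: "fs \<noteq> []" and fs: "set fs \<subseteq> arr A"
      and \<sigma>: "\<sigma> permutes {..<length fs}" by auto
    note pl = permutes_nth_less[OF \<sigma>]
    have nth: "i < length fs \<Longrightarrow> fs ! i \<in> arr A" for i using fs by auto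
    show "dm (Sr A) a \<in> obj (Sr A)" "cd (Sr A) a \<in> obj (Sr A)"
      using ne fs A.dm_obj A.cd_obj \<sigma> by auto
    show "cmp (Sr A) a (idt (Sr A) (dm (Sr A) a)) = a"
      using nth A.cmp_idt_right by (auto simp: Sr_cmp permutes_id intro!: nth_equalityI)
    show "cmp (Sr A) (idt (Sr A) (cd (Sr A) a)) a = a"
      using nth A.cmp_idt_left \<sigma>
      by (auto simp: Sr_cmp permute_list_nth pl permutes_inverses intro!: nth_equalityI)
    have "\<forall>f\<in>set fs. \<exists>g. g \<in> arr A \<and> dm A g = cd A f \<and> cd A g = dm A f \<and>
        cmp A g f = idt A (dm A f) \<and> cmp A f g = idt A (cd A f)"
      using fs A.inverse_ex by blast
    then obtain h where h: "\<And>f. f \<in> set fs \<Longrightarrow> h f \<in> arr A" "\<And>f. f \<in> set fs \<Longrightarrow> dm A (h f) = cd A f"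
      "\<And>f. f \<in> set fs \<Longrightarrow> cd A (h f) = dm A f" "\<And>f. f \<in> set fs \<Longrightarrow> cmp A (h f) f = idt A (dm A f)"
      "\<And>f. f \<in> set fs \<Longrightarrow> cmp A f (h f) = idt A (cd A f)" by (metis (no_types, lifting))
    \<comment> \<open>The componentwise inverses start at the targets, which are listed in the order
      given by \<open>\<sigma>\<close>; so they have to be permuted as well.\<close>
    let ?b = "(inv \<sigma>, permute_list \<sigma> (map h fs))"
    have b: "?b \<in> arr (Sr A)" using ne h \<sigma> by (auto simp: permutes_inv)
    show "\<exists>b\<in>arr (Sr A). dm (Sr A) b = cd (Sr A) a \<and> cd (Sr A) b = dm (Sr A) a \<and>
        cmp (Sr A) b a = idt (Sr A) (dm (Sr A) a) \<and> cmp (Sr A) a b = idt (Sr A) (cd (Sr A) a)"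
      by (intro bexI[OF _ b])
        (use \<sigma> h in \<open>auto simp: Sr_cmp permutes_inv permute_list_nth pl permutes_inverses
            permutes_inv_inv permutes_inv_o intro!: nth_equalityI\<close>)
  next
    fix a b assume ab: "a \<in> arr (Sr A)" "b \<in> arr (Sr A)" "cd (Sr A) a = dm (Sr A) b"
    obtain \<sigma> fs \<tau> gs where [simp]: "a = (\<sigma>, fs)" "b = (\<tau>, gs)" by fastforce
    from ab have fg: "fs \<noteq> []" "set fs \<subseteq> arr A" "\<sigma> permutes {..<length fs}" "set gs \<subseteq> arr A"
      "\<tau> permutes {..<length gs}" and e: "permute_list \<sigma> (map (cd A) fs) = map (dm A) gs" by auto
    from arg_cong[OF e, of length] have len: "length gs = length fs" by simp
    note pl = permutes_nth_less[OF fg(3)] permutes_nth_less[OF fg(5)[unfolded len]]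
    have nth: "fs ! i \<in> arr A" "gs ! i \<in> arr A" if "i < length fs" for i
      using fg len nth_mem that by (metis subsetD)+
    have eq: "cd A (fs ! \<sigma> i) = dm A (gs ! i)" if "i < length fs" for i
      using arg_cong[OF e, of "\<lambda>xs. xs ! i"] that len fg by (simp add: permute_list_nth pl)
    have eq': "cd A (fs ! i) = dm A (gs ! inv \<sigma> i)" if "i < length fs" for i
      using eq[of "inv \<sigma> i"] that fg by (simp add: pl permutes_inverses)
    show "cmp (Sr A) b a \<in> hom (Sr A) (dm (Sr A) a) (cd (Sr A) b)"
      using fg len nth eq eq'
      by (auto simp: hom_def Sr_cmp permutes_compose pl permute_list_nth permutes_inverses
          intro!: nth_equalityI)
  next
    fix a b c assume abc: "a \<in> arr (Sr A)" "b \<in> arr (Sr A)" "c \<in> arr (Sr A)"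
      "cd (Sr A) a = dm (Sr A) b" "cd (Sr A) b = dm (Sr A) c"
    obtain \<sigma> fs \<tau> gs \<rho> hs where [simp]: "a = (\<sigma>, fs)" "b = (\<tau>, gs)" "c = (\<rho>, hs)" by fastforce
    from abc have fg: "set fs \<subseteq> arr A" "\<sigma> permutes {..<length fs}" "set gs \<subseteq> arr A"
      "\<tau> permutes {..<length gs}" "set hs \<subseteq> arr A" and e: "permute_list \<sigma> (map (cd A) fs) = map (dm A) gs"
      "permute_list \<tau> (map (cd A) gs) = map (dm A) hs" by auto
    from e[THEN arg_cong, of length] have len: "length gs = length fs" "length hs = length fs" by simp_all
    note pl = permutes_nth_less[OF fg(2)] permutes_nth_less[OF fg(4)[unfolded len]]
    have nth: "fs ! i \<in> arr A" "gs ! i \<in> arr A" "hs ! i \<in> arr A" if "i < length fs" for i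
      using fg len nth_mem that by (metis subsetD)+
    have "cd A (fs ! \<sigma> i) = dm A (gs ! i)" "cd A (gs ! \<tau> i) = dm A (hs ! i)" if "i < length fs" for i
      using e[THEN arg_cong, of "\<lambda>xs. xs ! i"] that len fg by (simp_all add: permute_list_nth pl)
    then have "cd A (fs ! i) = dm A (gs ! inv \<sigma> i)" "cd A (gs ! i) = dm A (hs ! inv \<tau> i)" if "i < length fs" for i
      using that fg len by (metis pl(2,4) permutes_inverses(1))+
    then show "cmp (Sr A) c (cmp (Sr A) b a) = cmp (Sr A) (cmp (Sr A) c b) a"
      using fg len nth
      by (auto simp: Sr_cmp permutes_compose pl o_assoc permutes_inv_o A.cmp_assoc o_inv_distrib
          permutes_bij intro!: nth_equalityI)
  qed
qed

lemma gfunctor_Sr_map: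
  assumes "gfunctor F A B"
  shows "gfunctor (Sr_map F) (Sr A) (Sr B)"
proof -
  interpret F: gfunctor F A B by fact
  show ?thesis
  proof
    fix a b assume ab: "a \<in> arr (Sr A)" "b \<in> arr (Sr A)" "cd (Sr A) a = dm (Sr A) b"
    obtain \<sigma> fs \<tau> gs where [simp]: "a = (\<sigma>, fs)" "b = (\<tau>, gs)" by fastforce
    from ab have fg: "fs \<noteq> []" "set fs \<subseteq> arr A" "\<sigma> permutes {..<length fs}" "set gs \<subseteq> arr A"
      "\<tau> permutes {..<length gs}" and e: "permute_list \<sigma> (map (cd A) fs) = map (dm A) gs" by auto
    from arg_cong[OF e, of length] have len: "length gs = length fs" by simp
    note pl = permutes_nth_less[OF fg(3)] permutes_nth_less[OF fg(5)[unfolded len]]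
    have nth: "fs ! i \<in> arr A" "gs ! i \<in> arr A" if "i < length fs" for i
      using fg len nth_mem that by (metis subsetD)+
    have eq: "cd A (fs ! \<sigma> i) = dm A (gs ! i)" if "i < length fs" for i
      using arg_cong[OF e, of "\<lambda>xs. xs ! i"] that len fg by (simp add: permute_list_nth pl)
    have eq': "cd A (fs ! i) = dm A (gs ! inv \<sigma> i)" if "i < length fs" for i
      using eq[of "inv \<sigma> i"] that fg by (simp add: pl permutes_inverses)
    show "ar (Sr_map F) (cmp (Sr A) b a) = cmp (Sr B) (ar (Sr_map F) b) (ar (Sr_map F) a)"
      using fg len nth eq' by (auto simp: Sr_map_def Sr_cmp pl F.ar_cmp intro!: nth_equalityI)
  qed (auto simp: Sr_map_def F.ob_obj F.ar_arr F.dm_ar F.cd_ar permute_list_map[symmetric] subset_iff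
      intro!: arg_cong[of _ _ "permute_list _"])
qed

section \<open>Concatenation of permutations and functoriality of the monad multiplication\<close>

text \<open>This cuts the list of all indices into blocks of lengths \<open>ns\<close>. A
  permutation is later recovered from its action on that list, and the blocks are what
  \<open>flat_perm\<close> acts on.\<close>

lemma concat_offsets:
  "concat (map (\<lambda>i. map (\<lambda>r. sum_list (take i ns) + r) [0..<ns ! i]) [0..<length ns]) = [0..<sum_list ns]"
proof (induction ns rule: rev_induct)
  case (snoc n ns)
  have "concat (map (\<lambda>i. map (\<lambda>r. sum_list (take i (ns @ [n])) + r) [0..<(ns @ [n]) ! i]) [0..<length ns])
      = concat (map (\<lambda>i. map (\<lambda>r. sum_list (take i ns) + r) [0..<ns ! i]) [0..<length ns])"
    by (intro arg_cong[of _ _ concat] map_cong) (auto simp: nth_append)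
  moreover have "map (\<lambda>r. k + r) [0..<n] = [k..<k + n]" for k
    by (intro nth_equalityI) auto
  ultimately show ?case using snoc by (simp add: upt_add_eq_append[of 0, simplified])
qed simp

lemma concat_nth_offset:
  assumes "i < length xss" "r < length (xss ! i)"
  shows "sum_list (take i (map length xss)) + r < length (concat xss)"
    "concat xss ! (sum_list (take i (map length xss)) + r) = xss ! i ! r"
proof -
  have "concat xss = concat (take i xss) @ xss ! i @ concat (drop (Suc i) xss)"
    using assms by (metis concat.simps(2) concat_append id_take_nth_drop)
  moreover have "sum_list (take i (map length xss)) = length (concat (take i xss))"
    by (simp add: length_concat take_map)
  ultimately show "sum_list (take i (map length xss)) + r < length (concat xss)"
    "concat xss ! (sum_list (take i (map length xss)) + r) = xss ! i ! r"
    using assms by (simp_all add: nth_append)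
qed

lemma mset_concat_sum: "mset (concat xss) = \<Sum>\<^sub># (image_mset mset (mset xss))"
  by (induction xss) simp_all

locale flat =
  fixes \<sigma> :: "nat \<Rightarrow> nat" and \<tau>s :: "(nat \<Rightarrow> nat) list" and ns :: "nat list"
  assumes sigma: "\<sigma> permutes {..<length ns}"
    and len: "length \<tau>s = length ns"
    and tau: "\<And>i. i < length ns \<Longrightarrow> (\<tau>s ! i) permutes {..<ns ! i}"
begin

definition indices :: "nat list" where
  "indices = concat (permute_list \<sigma>
            (map (\<lambda>i. map (\<lambda>r. sum_list (take i ns) + (\<tau>s ! i) r) [0..<ns ! i])
              [0..<length ns]))"

text \<open>Permuting inside the blocks and permuting the blocks both preserve the multiset of the
  concatenation. So the values of \<open>flat_perm\<close> are a rearrangement of all indices, which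
  makes it a permutation.\<close>

lemma mset_indices: "mset indices = mset [0..<sum_list ns]"
proof -
  have *: "mset (map (\<lambda>r. sum_list (take i ns) + (\<tau>s ! i) r) [0..<ns ! i])
      = mset (map (\<lambda>r. sum_list (take i ns) + r) [0..<ns ! i])" if "i < length ns" for i
  proof -
    have "mset (permute_list (\<tau>s ! i) [0..<ns ! i]) = mset [0..<ns ! i]"
      using tau[OF that] by simp
    also have "permute_list (\<tau>s ! i) [0..<ns ! i] = map (\<tau>s ! i) [0..<ns ! i]"
      using permutes_nth_less(1)[OF tau[OF that]] by (auto simp: permute_list_def)
    finally have "image_mset ((+) (sum_list (take i ns))) (mset (map (\<tau>s ! i) [0..<ns ! i]))
      = image_mset ((+) (sum_list (take i ns))) (mset [0..<ns ! i])" by simp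
    then show ?thesis by (simp only: mset_map[symmetric] map_map o_def)
  qed
  have "mset (concat (map (\<lambda>i. map (\<lambda>r. sum_list (take i ns) + (\<tau>s ! i) r) [0..<ns ! i]) [0..<length ns]))
    = mset (concat (map (\<lambda>i. map (\<lambda>r. sum_list (take i ns) + r) [0..<ns ! i]) [0..<length ns]))"
    unfolding mset_concat map_map o_def
    by (intro arg_cong[of _ _ sum_list] map_cong[OF refl]) (simp only: * set_upt atLeastLessThan_iff)
  moreover have "mset (concat (permute_list \<sigma> xss)) = mset (concat xss)" if "length xss = length ns" for xss :: "nat list list"
    using sigma that by (simp add: mset_concat_sum)
  ultimately have "mset indices
    = mset (concat (map (\<lambda>i. map (\<lambda>r. sum_list (take i ns) + r) [0..<ns ! i]) [0..<length ns]))"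
    by (simp add: indices_def)
  then show ?thesis by (simp only: concat_offsets)
qed

lemma length_indices: "length indices = sum_list ns"
  using arg_cong[OF mset_indices, of size] by simp

lemma flat_perm_nth: "k < sum_list ns \<Longrightarrow> flat_perm \<sigma> \<tau>s ns k = indices ! k"
  by (simp only: flat_perm_def indices_def if_True)

lemma flat_perm_permutes: "flat_perm \<sigma> \<tau>s ns permutes {..<sum_list ns}"
proof (rule bij_imp_permutes)
  have "distinct indices" "set indices = {..<sum_list ns}"
    using mset_eq_imp_distinct_iff[OF mset_indices] mset_eq_setD[OF mset_indices]
    by (simp_all only: distinct_upt set_upt atLeast0LessThan)
  then have "bij_betw ((!) indices) {..<sum_list ns} {..<sum_list ns}"
    using length_indices by (intro bij_betw_nth) simp_all
  then show "bij_betw (flat_perm \<sigma> \<tau>s ns) {..<sum_list ns} {..<sum_list ns}"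
    by (rule bij_betw_cong[THEN iffD1, rotated]) (simp add: flat_perm_nth)
qed (simp add: flat_perm_def)

text \<open>The characteristic property of \<open>flat_perm\<close>: each value in
  \<open>indices\<close> is an offset plus a position in its block, and looking it up in
  \<open>concat xss\<close> reaches that position of that block. Later arguments use this property
  and no index formula.\<close>

lemma permute_list_flat_perm:
  assumes "map length xss = ns"
  shows "permute_list (flat_perm \<sigma> \<tau>s ns) (concat xss) = concat (permute_list \<sigma> (map2 permute_list \<tau>s xss))"
proof -
  have lc: "length (concat xss) = sum_list ns" using assms by (simp add: length_concat)
  have lx: "length xss = length ns" "\<And>i. i < length ns \<Longrightarrow> length (xss ! i) = ns ! i"
    using assms by auto
  have "permute_list (flat_perm \<sigma> \<tau>s ns) (concat xss) = map ((!) (concat xss)) indices"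
    using length_indices lc by (intro nth_equalityI) (simp_all add: permute_list_def flat_perm_nth)
  also have "\<dots> = concat (permute_list \<sigma> (map (map ((!) (concat xss)))
        (map (\<lambda>i. map (\<lambda>r. sum_list (take i ns) + (\<tau>s ! i) r) [0..<ns ! i]) [0..<length ns])))"
    using sigma by (simp add: indices_def map_concat permute_list_map)
  also have "map (map ((!) (concat xss)))
        (map (\<lambda>i. map (\<lambda>r. sum_list (take i ns) + (\<tau>s ! i) r) [0..<ns ! i]) [0..<length ns])
      = map2 permute_list \<tau>s xss"
  proof (rule nth_equalityI)
    fix i assume "i < length (map (map ((!) (concat xss)))
        (map (\<lambda>i. map (\<lambda>r. sum_list (take i ns) + (\<tau>s ! i) r) [0..<ns ! i]) [0..<length ns]))"
    then have i: "i < length ns" by simp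
    have "concat xss ! (sum_list (take i ns) + (\<tau>s ! i) r) = xss ! i ! (\<tau>s ! i) r" if "r < ns ! i" for r
      using concat_nth_offset(2)[of i xss "(\<tau>s ! i) r"] i lx assms permutes_nth_less(1)[OF tau[OF i] that] by simp
    then show "map (map ((!) (concat xss)))
        (map (\<lambda>i. map (\<lambda>r. sum_list (take i ns) + (\<tau>s ! i) r) [0..<ns ! i]) [0..<length ns]) ! i
        = map2 permute_list \<tau>s xss ! i"
      using i lx len by (auto simp: permute_list_def)
  qed (use lx len in simp)
  finally show ?thesis .
qed

end

lemma permutes_eqI:
  assumes "p permutes {..<n}" "q permutes {..<n}" "permute_list p [0..<n] = permute_list q [0..<n]"
  shows "p = q"
proof
  fix i
  show "p i = q i"
  proof (cases "i < n")
    case True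
    then show ?thesis
      using arg_cong[OF assms(3), of "\<lambda>xs. xs ! i"] assms(1,2)
        permutes_nth_less(1)[OF assms(1) True] permutes_nth_less(1)[OF assms(2) True]
      by (simp add: permute_list_nth)
  next
    case False
    then show ?thesis using assms(1,2) by (simp add: permutes_not_in)
  qed
qed

lemma map2_concat:
  assumes "map length xss = map length yss"
  shows "map2 f (concat xss) (concat yss) = concat (map2 (map2 f) xss yss)"
proof -
  from assms have "length xss = length yss" by (metis length_map)
  then show ?thesis using assms by (induction xss yss rule: list_induct2) simp_all
qed

lemma set_Sr_arr: "(\<sigma>, fs) \<in> arr (Sr A) \<Longrightarrow> set fs \<subseteq> arr A"
  by simp

lemma flat_of_Sr_arr:
  assumes "(\<sigma>, ps) \<in> arr (Sr (Sr A))"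
  shows "flat \<sigma> (map fst ps) (map (length \<circ> snd) ps)"
proof
  fix i assume i: "i < length (map (length \<circ> snd) ps)"
  then have "ps ! i \<in> arr (Sr A)" 
    using subsetD[OF set_Sr_arr[OF assms] nth_mem, of i] by (simp only: length_map)
  with i show "(map fst ps ! i) permutes {..<map (length \<circ> snd) ps ! i}"
    by (cases "ps ! i") simp
qed (use assms in auto)

text \<open>The content is the compatibility with composition. It splits into an identity of
  permutations, checked on the list of indices, and an identity of component lists, where the
  components of the second arrow have to be brought back into the order of the first.\<close>

lemma gfunctor_Sr_mult:
  assumes "groupoid A"
  shows "gfunctor Sr_mult (Sr (Sr A)) (Sr A)"
proof
  fix x assume "x \<in> obj (Sr (Sr A))"
  then show "ob Sr_mult x \<in> obj (Sr A)" by (cases x) (auto simp: Sr_mult_def)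
next
  fix a assume a: "a \<in> arr (Sr (Sr A))"
  obtain \<sigma> ps where [simp]: "a = (\<sigma>, ps)" by fastforce
  interpret flat \<sigma> "map fst ps" "map (length \<circ> snd) ps" 
    by (rule flat_of_Sr_arr[of _ _ A]) (use a in simp)
  have "map2 permute_list (map fst ps) (map (map (cd A)) (map snd ps)) = map (cd (Sr A)) ps"
    by (rule nth_equalityI) (auto simp: Sr_def split: prod.splits)
  then have "permute_list (flat_perm \<sigma> (map fst ps) (map (length \<circ> snd) ps)) (map (cd A) (concat (map snd ps)))
      = concat (permute_list \<sigma> (map (cd (Sr A)) ps))"
    using permute_list_flat_perm[of "map (map (cd A)) (map snd ps)"] by (simp add: map_concat o_def)
  then show "cd (Sr A) (ar Sr_mult a) = ob Sr_mult (cd (Sr (Sr A)) a)"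
    by (simp add: Sr_mult_def)
  show "dm (Sr A) (ar Sr_mult a) = ob Sr_mult (dm (Sr (Sr A)) a)"
    by (auto simp: Sr_mult_def Sr_def map_concat intro!: arg_cong[of _ _ concat])
  have "concat (map snd ps) \<noteq> []" using a by (cases ps) auto
  moreover have "set (concat (map snd ps)) \<subseteq> arr A" using a by fastforce
  ultimately show "ar Sr_mult a \<in> arr (Sr A)"
    using flat_perm_permutes by (simp add: Sr_mult_def length_concat o_def)
next
  fix a b assume ab: "a \<in> arr (Sr (Sr A))" "b \<in> arr (Sr (Sr A))" "cd (Sr (Sr A)) a = dm (Sr (Sr A)) b"
  obtain \<sigma> ps \<tau> qs where [simp]: "a = (\<sigma>, ps)" "b = (\<tau>, qs)" by fastforce
  let ?n = "length ps"
  from ab have \<sigma>: "\<sigma> permutes {..<?n}" and \<tau>: "\<tau> permutes {..<length qs}"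
    and e: "permute_list \<sigma> (map (cd (Sr A)) ps) = map (dm (Sr A)) qs" by auto
  from arg_cong[OF e, of length] have len: "length qs = ?n" by simp
  have \<tau>': "\<tau> permutes {..<?n}" using \<tau> len by simp
  note pl = permutes_nth_less[OF \<sigma>] permutes_nth_less[OF \<tau>']
  have ar_nth: "ps ! i \<in> arr (Sr A)" "qs ! i \<in> arr (Sr A)" if "i < ?n" for i
    using set_Sr_arr[of \<sigma> ps "Sr A"] set_Sr_arr[of \<tau> qs "Sr A"] ab len that
    by (auto simp del: Sr_simps(2))
  have eq: "cd (Sr A) (ps ! \<sigma> i) = dm (Sr A) (qs ! i)" if "i < ?n" for i
    using arg_cong[OF e, of "\<lambda>xs. xs ! i"] that len \<sigma> by (simp add: permute_list_nth pl)
  have eq': "cd (Sr A) (ps ! i) = dm (Sr A) (qs ! inv \<sigma> i)" if "i < ?n" for i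
    using eq[of "inv \<sigma> i"] that \<sigma> by (simp add: pl permutes_inverses)
  have perm: "fst (ps ! i) permutes {..<length (snd (ps ! i))}" if "i < ?n" for i
    using ar_nth(1)[OF that] by (cases "ps ! i") auto
  have lens: "length (snd (qs ! i)) = length (snd (ps ! \<sigma> i))" if "i < ?n" for i
    using arg_cong[OF eq[OF that], of length] by (auto simp: Sr_def split: prod.splits)
  have lens': "length (snd (qs ! inv \<sigma> i)) = length (snd (ps ! i))" if "i < ?n" for i
    using lens[of "inv \<sigma> i"] that \<sigma> by (simp add: pl permutes_inverses)
  define rs where "rs = map (\<lambda>i. cmp (Sr A) (qs ! inv \<sigma> i) (ps ! i)) [0..<?n]"
  have cba: "cmp (Sr (Sr A)) b a = (\<sigma> \<circ> \<tau>, rs)" using len \<sigma> by (simp add: Sr_cmp rs_def)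
  have rs_nth: "rs ! i = (fst (ps ! i) \<circ> fst (qs ! inv \<sigma> i),
      map (\<lambda>j. cmp A (snd (qs ! inv \<sigma> i) ! inv (fst (ps ! i)) j) (snd (ps ! i) ! j)) [0..<length (snd (ps ! i))])"
    if "i < ?n" for i
    using Sr_cmp[OF lens'[OF that] perm[OF that], of A "fst (qs ! inv \<sigma> i)"] that by (simp add: rs_def)
  interpret SA: groupoid "Sr (Sr A)" using assms by (intro groupoid_Sr)
  have "(\<sigma> \<circ> \<tau>, rs) \<in> arr (Sr (Sr A))" using SA.cmp_simps(1)[OF ab] by (simp only: cba)
  then interpret r: flat "\<sigma> \<circ> \<tau>" "map fst rs" "map (length \<circ> snd) rs" by (rule flat_of_Sr_arr)
  interpret p: flat \<sigma> "map fst ps" "map (length \<circ> snd) ps" 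
    by (rule flat_of_Sr_arr[of _ _ A]) (use ab in simp)
  interpret q: flat \<tau> "map fst qs" "map (length \<circ> snd) qs" 
    by (rule flat_of_Sr_arr[of _ _ A]) (use ab in simp)
  have lrs: "length rs = ?n" by (simp add: rs_def)
  have nsr: "map (length \<circ> snd) rs = map (length \<circ> snd) ps"
    by (rule nth_equalityI) (auto simp: lrs rs_nth)
  have nsq: "map (length \<circ> snd) qs = permute_list \<sigma> (map (length \<circ> snd) ps)"
    by (rule nth_equalityI) (use len \<sigma> lens in \<open>auto simp: permute_list_nth pl\<close>)
  define N where "N = sum_list (map (length \<circ> snd) ps)"
  have Nq: "sum_list (map (length \<circ> snd) qs) = N"
    unfolding N_def nsq using \<sigma> by (metis length_map mset_permute_list sum_mset_sum_list)
  let ?P = "flat_perm \<sigma> (map fst ps) (map (length \<circ> snd) ps)"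
  let ?Q = "flat_perm \<tau> (map fst qs) (map (length \<circ> snd) qs)"
  let ?R = "flat_perm (\<sigma> \<circ> \<tau>) (map fst rs) (map (length \<circ> snd) rs)"
  have PQR: "?P permutes {..<N}" "?Q permutes {..<N}" "?R permutes {..<N}"
    using p.flat_perm_permutes q.flat_perm_permutes r.flat_perm_permutes
    by (simp_all only: Nq nsr flip: N_def)
  have lcq: "length (concat (map snd qs)) = N" using Nq by (simp add: length_concat o_def)
  have lcp: "length (concat (map snd ps)) = N" by (simp add: length_concat o_def N_def)
  \<comment> \<open>Both permutations are applied to the index list cut into the blocks of
    \<open>ps\<close>. Two uses of the characteristic property turn the right side into a nested
    permutation of blocks, in which block permutations and inner permutations compose
    separately.\<close>
  have "?R = ?P \<circ> ?Q"
  proof (rule permutes_eqI[OF PQR(3) permutes_compose[OF PQR(2,1)]])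
    define xss where "xss = map (\<lambda>i. map (\<lambda>r. sum_list (take i (map (length \<circ> snd) ps)) + r)
        [0..<(map (length \<circ> snd) ps) ! i]) [0..<length (map (length \<circ> snd) ps)]"
    have c: "concat xss = [0..<N]" unfolding xss_def N_def by (rule concat_offsets)
    have lx: "map length xss = map (length \<circ> snd) ps" by (rule nth_equalityI) (auto simp: xss_def)
    have lx': "length xss = ?n" "i < ?n \<Longrightarrow> length (xss ! i) = length (snd (ps ! i))" for i
      by (auto simp: xss_def)
    define yss where "yss = permute_list \<sigma> (map2 permute_list (map fst ps) xss)"
    have yss_nth: "yss ! i = permute_list (fst (ps ! \<sigma> i)) (xss ! \<sigma> i)" if "i < ?n" for i
      using that \<sigma> lx' by (simp add: yss_def permute_list_nth pl)
    have ly: "length yss = ?n" using lx' by (simp add: yss_def)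
    have "map length yss = map (length \<circ> snd) qs"
      by (rule nth_equalityI) (use len ly lx' yss_nth lens pl in auto)
    then have "permute_list (?P \<circ> ?Q) [0..<N] = concat (permute_list \<tau> (map2 permute_list (map fst qs) yss))"
      using PQR permute_list_compose[of ?Q "[0..<N]" ?P] p.permute_list_flat_perm[OF lx]
        q.permute_list_flat_perm[of yss] by (simp add: c yss_def)
    also have "permute_list \<tau> (map2 permute_list (map fst qs) yss)
        = permute_list (\<sigma> \<circ> \<tau>) (map2 permute_list (map fst rs) xss)"
    proof (rule nth_equalityI)
      fix i assume "i < length (permute_list \<tau> (map2 permute_list (map fst qs) yss))"
      then have i: "i < ?n" using len ly by simp
      have st: "(\<sigma> \<circ> \<tau>) permutes {..<?n}" using permutes_compose[OF \<tau>' \<sigma>] .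
      have "permute_list \<tau> (map2 permute_list (map fst qs) yss) ! i
          = permute_list (fst (qs ! \<tau> i)) (permute_list (fst (ps ! \<sigma> (\<tau> i))) (xss ! \<sigma> (\<tau> i)))"
        using i len ly \<tau>' by (simp add: permute_list_nth pl yss_nth)
      also have "\<dots> = permute_list (fst (ps ! \<sigma> (\<tau> i)) \<circ> fst (qs ! \<tau> i)) (xss ! \<sigma> (\<tau> i))"
      proof (rule permute_list_compose[symmetric])
        have "\<tau> i < ?n" using i pl by simp
        then show "fst (qs ! \<tau> i) permutes {..<length (xss ! \<sigma> (\<tau> i))}"
          using q.tau[of "\<tau> i"] len lens[of "\<tau> i"] lx'(2)[of "\<sigma> (\<tau> i)"] pl by simp
      qed
      also have "\<dots> = permute_list (\<sigma> \<circ> \<tau>) (map2 permute_list (map fst rs) xss) ! i"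
        using i lrs lx' st \<sigma> by (simp add: permute_list_nth pl rs_nth permutes_inverses)
      finally show "permute_list \<tau> (map2 permute_list (map fst qs) yss) ! i
        = permute_list (\<sigma> \<circ> \<tau>) (map2 permute_list (map fst rs) xss) ! i" .
    qed (use len ly lrs lx' in simp)
    also have "concat \<dots> = permute_list ?R [0..<N]"
      using r.permute_list_flat_perm[of xss] lx nsr by (simp add: c)
    finally show "permute_list ?R [0..<N] = permute_list (?P \<circ> ?Q) [0..<N]" by (rule sym)
  qed
  \<comment> \<open>Here \<open>xss\<close> lists the components of \<open>qs\<close> block by block
    in the order of \<open>ps\<close>, both the blocks and their entries being moved back. Its
    concatenation is that of \<open>qs\<close> permuted by \<open>inv ?P\<close>, so it can be
    composed with \<open>ps\<close> entry by entry.\<close>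
  moreover have "concat (map snd rs)
      = map (\<lambda>i. cmp A (concat (map snd qs) ! inv ?P i) (concat (map snd ps) ! i)) [0..<N]"
  proof -
    define xss where "xss = map (\<lambda>i. permute_list (inv (fst (ps ! i))) (snd (qs ! inv \<sigma> i))) [0..<?n]"
    have lx: "map length xss = map (length \<circ> snd) ps"
      by (rule nth_equalityI) (auto simp: xss_def lens')
    have "map2 permute_list (map fst ps) xss = map (\<lambda>i. snd (qs ! inv \<sigma> i)) [0..<?n]"
    proof (rule nth_equalityI)
      fix i assume "i < length (map2 permute_list (map fst ps) xss)"
      then have i: "i < ?n" by simp
      have "permute_list (fst (ps ! i)) (permute_list (inv (fst (ps ! i))) (snd (qs ! inv \<sigma> i))) = snd (qs ! inv \<sigma> i)"
        using permute_list_compose[of "fst (ps ! i)" "snd (qs ! inv \<sigma> i)" "inv (fst (ps ! i))"] perm[OF i] lens'[OF i]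
        by (simp add: permutes_inv_o)
      then show "map2 permute_list (map fst ps) xss ! i = map (\<lambda>i. snd (qs ! inv \<sigma> i)) [0..<?n] ! i"
        using i by (simp add: xss_def)
    qed (simp add: xss_def)
    moreover have "permute_list \<sigma> (map (\<lambda>i. snd (qs ! inv \<sigma> i)) [0..<?n]) = map snd qs"
      by (rule nth_equalityI) (use len \<sigma> in \<open>auto simp: permute_list_nth pl permutes_inverses\<close>)
    ultimately have "permute_list ?P (concat xss) = concat (map snd qs)"
      using p.permute_list_flat_perm[OF lx] by simp
    moreover have lcx: "length (concat xss) = N" using lx by (simp add: length_concat N_def)
    ultimately have cx: "concat xss = permute_list (inv ?P) (concat (map snd qs))"
      using permute_list_compose[of "inv ?P" "concat xss" ?P] PQR by (simp add: permutes_inv permutes_inv_o)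
    have "map (\<lambda>i. cmp A (concat (map snd qs) ! inv ?P i) (concat (map snd ps) ! i)) [0..<N]
      = map2 (cmp A) (concat xss) (concat (map snd ps))"
      unfolding cx using lcq lcp permutes_inv[OF PQR(1)]
      by (intro nth_equalityI) (simp_all add: permute_list_nth)
    also have "\<dots> = concat (map2 (map2 (cmp A)) xss (map snd ps))"
      using lx by (intro map2_concat) simp
    also have "map2 (map2 (cmp A)) xss (map snd ps) = map snd rs"
    proof (rule nth_equalityI)
      fix i assume "i < length (map2 (map2 (cmp A)) xss (map snd ps))"
      then have i: "i < ?n" by simp
      have inv: "inv (fst (ps ! i)) permutes {..<length (snd (ps ! i))}"
        using perm[OF i] by (rule permutes_inv)
      show "map2 (map2 (cmp A)) xss (map snd ps) ! i = map snd rs ! i"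
        using i lrs inv lens'[OF i]
        by (auto simp: xss_def rs_nth permute_list_nth intro!: nth_equalityI)
    qed (simp add: xss_def lrs)
    finally show ?thesis by (rule sym)
  qed
  ultimately have "ar Sr_mult (\<sigma> \<circ> \<tau>, rs) = cmp (Sr A) (ar Sr_mult b) (ar Sr_mult a)"
  proof -
    assume 1: "?R = ?P \<circ> ?Q" and 2: "concat (map snd rs)
      = map (\<lambda>i. cmp A (concat (map snd qs) ! inv ?P i) (concat (map snd ps) ! i)) [0..<N]"
    have "cmp (Sr A) (?Q, concat (map snd qs)) (?P, concat (map snd ps)) = (?R, concat (map snd rs))"
      using Sr_cmp[of "concat (map snd qs)" "concat (map snd ps)" ?P A ?Q] PQR(1)
      unfolding lcq lcp 1 2 by simp
    then show ?thesis by (simp add: Sr_mult_def)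
  qed
  then show "ar Sr_mult (cmp (Sr (Sr A)) b a) = cmp (Sr A) (ar Sr_mult b) (ar Sr_mult a)"
    by (simp only: cba)
qed

section \<open>Counting stars and hom-sets of tuples\<close>

definition lists_in :: "'a set list \<Rightarrow> 'a list set" where
  "lists_in As = {xs. list_all2 (\<in>) xs As}"

lemma lists_in_Nil [simp]: "lists_in [] = {[]}"
  by (auto simp: lists_in_def)

lemma lists_in_Cons: "lists_in (A # As) = (\<lambda>(x, xs). x # xs) ` (A \<times> lists_in As)"
  by (auto simp: lists_in_def list_all2_Cons2)

lemma inj_Cons_pair: "inj_on (\<lambda>(x, xs). x # xs) S"
  by (auto simp: inj_on_def)

lemma sum_lists_in_Cons:
  "(\<Sum>xs\<in>lists_in (A # As). h xs) = (\<Sum>x\<in>A. \<Sum>xs\<in>lists_in As. h (x # xs))"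
  unfolding lists_in_Cons sum.reindex[OF inj_Cons_pair] by (simp add: sum.cartesian_product case_prod_unfold)

lemma card_lists_in: "card (lists_in As) = prod_list (map card As)"
  by (induction As) (simp_all add: lists_in_Cons card_image[OF inj_Cons_pair] card_cartesian_product)

lemma finite_lists_in: "(\<And>A. A \<in> set As \<Longrightarrow> finite A) \<Longrightarrow> finite (lists_in As)"
  by (induction As) (simp_all add: lists_in_Cons)

lemma card_permutations_less: "card {\<sigma>. \<sigma> permutes {..<n :: nat}} = fact n"
  by (rule card_permutations) auto

lemma star_Sr:
  assumes "xs \<noteq> []"
  shows "star (Sr A) xs = {\<sigma>. \<sigma> permutes {..<length xs}} \<times> lists_in (map (star A) xs)"
proof -
  have *: "map (dm A) fs = xs \<and> set fs \<subseteq> arr A \<longleftrightarrow> fs \<in> lists_in (map (star A) xs)" for fs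
    by (auto simp: lists_in_def star_def list_all2_conv_all_nth list_eq_iff_nth_eq subset_code(1) all_set_conv_all_nth)
  have "(\<sigma>, fs) \<in> star (Sr A) xs \<longleftrightarrow> \<sigma> permutes {..<length xs} \<and> fs \<in> lists_in (map (star A) xs)" for \<sigma> fs
    unfolding *[symmetric] using assms by (auto simp: star_def)
  then show ?thesis by auto
qed

lemma card_star_Sr:
  assumes "xs \<noteq> []"
  shows "card (star (Sr A) xs) = fact (length xs) * (\<Prod>x\<leftarrow>xs. card (star A x))"
  by (simp add: star_Sr[OF assms] card_cartesian_product card_permutations_less card_lists_in o_def)

text \<open>For a fixed permutation the component at \<open>xs ! i\<close> must end at
  \<open>ys ! inv \<sigma> i\<close>, and the components can be chosen independently of each
  other.\<close>

lemma hom_Sr: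
  assumes "xs \<noteq> []" "length xs = length ys"
  shows "hom (Sr A) xs ys
    = (SIGMA \<sigma>:{\<sigma>. \<sigma> permutes {..<length xs}}. lists_in (map2 (hom A) xs (permute_list (inv \<sigma>) ys)))"
proof -
  have "(\<sigma>, fs) \<in> hom (Sr A) xs ys \<longleftrightarrow>
      fs \<in> lists_in (map2 (hom A) xs (permute_list (inv \<sigma>) ys))" if \<sigma>: "\<sigma> permutes {..<length xs}" for \<sigma> fs
  proof (cases "length fs = length xs")
    case True
    note \<sigma>' = permutes_inv[OF \<sigma>]
    have "permute_list \<sigma> (map (cd A) fs) = ys \<longleftrightarrow> map (cd A) fs = permute_list (inv \<sigma>) ys"
      using \<sigma> \<sigma>' permute_list_compose[of "inv \<sigma>" "map (cd A) fs" \<sigma>] permute_list_compose[of \<sigma> ys "inv \<sigma>"] True assms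
      by (auto simp: permutes_inv_o)
    then have "(\<sigma>, fs) \<in> hom (Sr A) xs ys \<longleftrightarrow>
        (\<forall>f\<in>set fs. f \<in> arr A) \<and> map (dm A) fs = xs \<and> map (cd A) fs = permute_list (inv \<sigma>) ys"
      using \<sigma> True assms by (auto simp: hom_def)
    also have "\<dots> \<longleftrightarrow> (\<forall>i<length xs. fs ! i \<in> hom A (xs ! i) (permute_list (inv \<sigma>) ys ! i))"
    proof -
      have "(\<forall>f\<in>set fs. f \<in> arr A) \<longleftrightarrow> (\<forall>i<length xs. fs ! i \<in> arr A)"
        by (simp add: all_set_conv_all_nth True)
      moreover have "map (dm A) fs = xs \<longleftrightarrow> (\<forall>i<length xs. dm A (fs ! i) = xs ! i)"
        by (simp add: list_eq_iff_nth_eq True)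
      moreover have "map (cd A) fs = permute_list (inv \<sigma>) ys \<longleftrightarrow>
          (\<forall>i<length xs. cd A (fs ! i) = permute_list (inv \<sigma>) ys ! i)"
        by (simp add: list_eq_iff_nth_eq True assms)
      ultimately show ?thesis unfolding hom_def by blast
    qed
    also have "\<dots> \<longleftrightarrow> fs \<in> lists_in (map2 (hom A) xs (permute_list (inv \<sigma>) ys))"
      using True assms by (simp add: lists_in_def list_all2_conv_all_nth)
    finally show ?thesis .
  next
    case False
    then show ?thesis using assms by (auto simp: hom_def lists_in_def list_all2_conv_all_nth)
  qed
  moreover have "\<sigma> permutes {..<length xs}" if "(\<sigma>, fs) \<in> hom (Sr A) xs ys" for \<sigma> fs
    using that by (auto simp: hom_def)
  ultimately have "p \<in> hom (Sr A) xs ys \<longleftrightarrow>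
      p \<in> (SIGMA \<sigma>:{\<sigma>. \<sigma> permutes {..<length xs}}. lists_in (map2 (hom A) xs (permute_list (inv \<sigma>) ys)))" for p
    by (cases p) (simp only: mem_Sigma_iff mem_Collect_eq, blast)
  then show ?thesis by (rule set_eqI)
qed

lemma hom_Sr_length: "hom (Sr A) xs ys \<noteq> {} \<Longrightarrow> length xs = length ys"
  by (auto simp: hom_def)

lemma card_hom_Sr:
  assumes "xs \<noteq> []" "length xs = length ys" "\<And>x y. finite (hom A x y)"
  shows "card (hom (Sr A) xs ys)
    = (\<Sum>\<sigma> | \<sigma> permutes {..<length xs}. prod_list (map2 (\<lambda>x y. card (hom A x y)) xs (permute_list (inv \<sigma>) ys)))"
proof -
  have "finite (lists_in (map2 (hom A) xs (permute_list (inv \<sigma>) ys)))" for \<sigma>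
    using assms(3) by (intro finite_lists_in) auto
  then show ?thesis
    by (simp add: hom_Sr[OF assms(1,2)] card_SigmaI finite_permutations card_lists_in o_def case_prod_unfold)
qed

lemma prod_list_permute:
  fixes xs :: "'a::comm_monoid_mult list"
  assumes "\<sigma> permutes {..<length xs}"
  shows "prod_list (permute_list \<sigma> xs) = prod_list xs"
  using assms by (simp flip: prod_mset_prod_list)

lemma prod_list_map2_divide:
  fixes c :: "'a \<Rightarrow> 'b \<Rightarrow> 'c::field"
  assumes "length xs = length ys"
  shows "prod_list (map2 c xs ys) / prod_list (map d xs) = prod_list (map2 (\<lambda>x y. c x y / d x) xs ys)"
  using assms by (induction xs ys rule: list_induct2) (simp_all flip: times_divide_times_eq)

lemma of_nat_prod_list: "of_nat (prod_list xs) = (prod_list (map of_nat xs) :: 'a::comm_semiring_1)"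
  by (induction xs) simp_all

lemma map2_permute_list:
  assumes "length xs = length ys" "\<sigma> permutes {..<length ys}"
  shows "map2 f (permute_list \<sigma> xs) (permute_list \<sigma> ys) = permute_list \<sigma> (map2 f xs ys)"
  using assms permutes_nth_less[OF assms(2)]
  by (intro nth_equalityI) (simp_all add: permute_list_nth)

text \<open>The permutation of an arrow into \<open>fs\<close> matches every entry of
  \<open>xs\<close> with an entry of \<open>fs\<close> over which it lies. This bounds the entries
  and fixes the length, so that finite fibres of \<open>D\<close> give finite fibres for
  tuples.\<close>

lemma Sr_fibre_subset:
  assumes ne: "fs \<noteq> []"
  shows "{xs \<in> obj (Sr L). hom (Sr B) (map D xs) fs \<noteq> {}}
    \<subseteq> {xs. set xs \<subseteq> (\<Union>f\<in>set fs. {x \<in> obj L. hom B (D x) f \<noteq> {}}) \<and> length xs = length fs}"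
    (is "?T \<subseteq> ?U")
proof
  fix xs assume xs: "xs \<in> ?T"
  then have len: "length xs = length fs" using hom_Sr_length[of B "map D xs" fs] by simp
  then have ne': "xs \<noteq> []" using ne by auto
  from xs len ne' obtain \<sigma> as where \<sigma>: "\<sigma> permutes {..<length fs}"
    and as: "as \<in> lists_in (map2 (hom B) (map D xs) (permute_list (inv \<sigma>) fs))"
    using hom_Sr[of "map D xs" fs B] by auto
  have "xs ! i \<in> (\<Union>f\<in>set fs. {x \<in> obj L. hom B (D x) f \<noteq> {}})" if i: "i < length fs" for i
  proof -
    have inv: "inv \<sigma> permutes {..<length fs}" "inv \<sigma> i < length fs"
      using permutes_inv[OF \<sigma>] permutes_nth_less(2)[OF \<sigma> i] by auto
    have "as ! i \<in> hom B (D (xs ! i)) (fs ! inv \<sigma> i)"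
    proof -
      have "length as = length fs" using as len by (simp add: lists_in_def list_all2_conv_all_nth)
      then have "as ! i \<in> map2 (hom B) (map D xs) (permute_list (inv \<sigma>) fs) ! i"
        using as i by (simp only: lists_in_def mem_Collect_eq list_all2_conv_all_nth)
      then show ?thesis using i len inv by (simp add: permute_list_nth)
    qed
    moreover have "xs ! i \<in> obj L" using xs i len nth_mem[of i xs] by (simp add: subset_code(1))
    moreover have "fs ! inv \<sigma> i \<in> set fs" using inv by simp
    ultimately show ?thesis by blast
  qed
  then have "set xs \<subseteq> (\<Union>f\<in>set fs. {x \<in> obj L. hom B (D x) f \<noteq> {}})"
    unfolding set_conv_nth[of xs] len by blast
  then show "xs \<in> ?U" using len by simp
qed

lemma finite_Sr_fibre:
  assumes "fs \<noteq> []" "\<And>f. f \<in> set fs \<Longrightarrow> finite {x \<in> obj L. hom B (D x) f \<noteq> {}}"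
  shows "finite {xs \<in> obj (Sr L). hom (Sr B) (map D xs) fs \<noteq> {}}"
  using assms by (intro finite_subset[OF Sr_fibre_subset] finite_lists_length_eq) auto

text \<open>
  Arrows of tuples into \<open>fs\<close> come with a permutation, and the number of permutations is a factor
  of the size of the star of a tuple: averaging over permutations matches the components of
  \<open>xs\<close> with those of \<open>fs\<close> one by one.
\<close>

lemma sum_Sr_hom:
  fixes h :: "'x list \<Rightarrow> rat" and w :: "'x \<Rightarrow> 'o \<Rightarrow> rat"
  assumes ne: "fs \<noteq> []"
    and fin: "\<And>f. f \<in> set fs \<Longrightarrow> finite {x \<in> obj L. hom B (D x) f \<noteq> {}}"
    and finh: "\<And>x y. finite (hom B x y)"
    and h: "\<And>\<sigma> xs. \<sigma> permutes {..<length xs} \<Longrightarrow> h (permute_list \<sigma> xs) = h xs"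
    and w: "\<And>x f. w x f = of_nat (card (hom B (D x) f)) / of_nat (card (star L x))"
  shows "(\<Sum>xs | xs \<in> obj (Sr L) \<and> hom (Sr B) (map D xs) fs \<noteq> {}.
      h xs * (of_nat (card (hom (Sr B) (map D xs) fs)) / of_nat (card (star (Sr L) xs))))
    = (\<Sum>xs\<in>lists_in (map (\<lambda>f. {x \<in> obj L. hom B (D x) f \<noteq> {}}) fs). h xs * prod_list (map2 w xs fs))"
proof -
  define n where "n = length fs"
  define S where "S f = {x \<in> obj L. hom B (D x) f \<noteq> {}}" for f
  \<comment> \<open>A summation domain closed under permutations, which the entrywise domain of the
    conclusion is not. The additional tuples contribute 0 because their hom-set is empty.\<close>
  define U where "U = {xs. set xs \<subseteq> (\<Union>f\<in>set fs. S f) \<and> length xs = n}"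
  let ?T = "{xs. xs \<in> obj (Sr L) \<and> hom (Sr B) (map D xs) fs \<noteq> {}}"
  let ?perms = "{\<sigma>. \<sigma> permutes {..<n}}"
  have finU: "finite U" unfolding U_def using fin by (intro finite_lists_length_eq) (auto simp: S_def)
  have U: "xs \<noteq> []" "length xs = n" "xs \<in> obj (Sr L)" if "xs \<in> U" for xs
    using that ne by (auto simp: U_def S_def n_def)
  have "?T \<subseteq> U" using Sr_fibre_subset[OF ne, of L B D] by (simp add: U_def S_def n_def)
  then have "(\<Sum>xs | xs \<in> obj (Sr L) \<and> hom (Sr B) (map D xs) fs \<noteq> {}.
      h xs * (of_nat (card (hom (Sr B) (map D xs) fs)) / of_nat (card (star (Sr L) xs))))
    = (\<Sum>xs\<in>U. h xs * (of_nat (card (hom (Sr B) (map D xs) fs)) / of_nat (card (star (Sr L) xs))))"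
    using U(3) by (intro sum.mono_neutral_left finU) auto
  also have "\<dots> = (\<Sum>xs\<in>U. \<Sum>\<sigma>\<in>?perms.
      h xs * prod_list (map2 w xs (permute_list (inv \<sigma>) fs)) / fact n)"
  proof (rule sum.cong[OF refl])
    fix xs assume xs: "xs \<in> U"
    have "of_nat (card (hom (Sr B) (map D xs) fs)) / of_nat (card (star (Sr L) xs))
      = (\<Sum>\<sigma>\<in>?perms. of_nat (prod_list (map2 (\<lambda>x y. card (hom B x y)) (map D xs) (permute_list (inv \<sigma>) fs)))
           / of_nat (\<Prod>x\<leftarrow>xs. card (star L x)) / fact n :: rat)"
      using U[OF xs] by (simp add: card_star_Sr card_hom_Sr finh n_def sum_divide_distrib[symmetric] mult.commute)
    also have "\<dots> = (\<Sum>\<sigma>\<in>?perms. prod_list (map2 w xs (permute_list (inv \<sigma>) fs)) / fact n)"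
    proof (rule sum.cong[OF refl])
      fix \<sigma> assume "\<sigma> \<in> ?perms"
      have "length xs = length (permute_list (inv \<sigma>) fs)" using U(2)[OF xs] by (simp add: n_def)
      from prod_list_map2_divide[OF this, of "\<lambda>x f. of_nat (card (hom B (D x) f))" "\<lambda>x. of_nat (card (star L x)) :: rat"]
      show "of_nat (prod_list (map2 (\<lambda>x y. card (hom B x y)) (map D xs) (permute_list (inv \<sigma>) fs)))
           / of_nat (\<Prod>x\<leftarrow>xs. card (star L x)) / fact n = prod_list (map2 w xs (permute_list (inv \<sigma>) fs)) / fact n"
        by (simp add: of_nat_prod_list o_def case_prod_unfold w zip_map1)
    qed
    finally show "h xs * (of_nat (card (hom (Sr B) (map D xs) fs)) / of_nat (card (star (Sr L) xs)))
      = (\<Sum>\<sigma>\<in>?perms. h xs * prod_list (map2 w xs (permute_list (inv \<sigma>) fs)) / fact n)"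
      by (simp add: sum_distrib_left)
  qed
  also have "\<dots> = (\<Sum>\<sigma>\<in>?perms. \<Sum>xs\<in>U. h xs * prod_list (map2 w xs (permute_list (inv \<sigma>) fs)) / fact n)"
    by (rule sum.swap)
  \<comment> \<open>Reindexing the tuples by \<open>\<sigma>\<close> moves the permutation from
    \<open>fs\<close> to \<open>xs\<close>, where the invariance of \<open>h\<close> and of the
    product absorbs it. All \<open>n!\<close> summands become equal and cancel the
    denominator.\<close>
  also have "\<dots> = (\<Sum>\<sigma>\<in>?perms. \<Sum>xs\<in>U. h xs * prod_list (map2 w xs fs) / fact n)"
  proof (rule sum.cong[OF refl])
    fix \<sigma> assume "\<sigma> \<in> ?perms"
    then have \<sigma>: "\<sigma> permutes {..<n}" "inv \<sigma> permutes {..<n}" by (auto simp: permutes_inv)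
    have inv: "permute_list (inv \<sigma>) (permute_list \<sigma> xs) = xs" "permute_list \<sigma> (permute_list (inv \<sigma>) xs) = xs"
      if "length xs = n" for xs :: "'x list"
      using that \<sigma> permute_list_compose[of "inv \<sigma>" xs \<sigma>] permute_list_compose[of \<sigma> xs "inv \<sigma>"]
      by (simp_all add: permutes_inv_o)
    have mem: "permute_list \<sigma> xs \<in> U" "permute_list (inv \<sigma>) xs \<in> U" if "xs \<in> U" for xs
      using that \<sigma> by (auto simp: U_def)
    have "h xs * prod_list (map2 w xs fs)
      = h (permute_list (inv \<sigma>) xs) * prod_list (map2 w (permute_list (inv \<sigma>) xs) (permute_list (inv \<sigma>) fs))"
      if "xs \<in> U" for xs
      using U(2)[OF that] \<sigma> by (simp add: h map2_permute_list n_def prod_list_permute)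
    then show "(\<Sum>xs\<in>U. h xs * prod_list (map2 w xs (permute_list (inv \<sigma>) fs)) / fact n)
        = (\<Sum>xs\<in>U. h xs * prod_list (map2 w xs fs) / fact n)"
      by (intro sum.reindex_bij_witness[of _ "permute_list (inv \<sigma>)" "permute_list \<sigma>"])
        (simp_all add: inv U(2) mem)
  qed
  also have "\<dots> = (\<Sum>xs\<in>U. h xs * prod_list (map2 w xs fs))"
    by (simp add: card_permutations_less sum_divide_distrib[symmetric])
  \<comment> \<open>A tuple of \<open>U\<close> outside the entrywise domain has some entry with no
    arrow to the corresponding entry of \<open>fs\<close>, hence a factor 0.\<close>
  also have "\<dots> = (\<Sum>xs\<in>lists_in (map S fs). h xs * prod_list (map2 w xs fs))"
  proof (rule sum.mono_neutral_right[OF finU])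
    show "lists_in (map S fs) \<subseteq> U"
      by (auto simp: lists_in_def list_all2_conv_all_nth U_def n_def in_set_conv_nth) (meson nth_mem)
    show "\<forall>xs\<in>U - lists_in (map S fs). h xs * prod_list (map2 w xs fs) = 0"
    proof
      fix xs assume xs: "xs \<in> U - lists_in (map S fs)"
      then obtain i where i: "i < n" "xs ! i \<notin> S (fs ! i)"
        using U(2) by (auto simp: lists_in_def list_all2_conv_all_nth n_def)
      moreover have "xs ! i \<in> obj L" using xs i U(2,3)[of xs] nth_mem by fastforce
      ultimately have "map2 w xs fs ! i = 0" using xs U(2) by (simp add: S_def w n_def)
      then have "0 \<in> set (map2 w xs fs)" using i U(2)[of xs] xs by (metis DiffD1 length_map length_zip min.idem n_def nth_mem)
      then show "h xs * prod_list (map2 w xs fs) = 0" by (simp add: prod_list_zero_iff)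
    qed
  qed
  finally show ?thesis by (simp only: S_def[abs_def])
qed

section \<open>Incidence coefficients of a simplicial groupoid\<close>

lemma aut_hofib_subset: "aut (hofib G B F b) (x, u) \<subseteq> (\<lambda>a. (u, a, u)) ` aut G x"
proof
  fix p assume p: "p \<in> aut (hofib G B F b) (x, u)"
  obtain v a v' where pe: "p = (v, a, v')" by (rule prod_cases3)
  from p have "v = u" "v' = u" "a \<in> aut G x" unfolding pe by (simp_all add: aut_def hom_def)
  then show "p \<in> (\<lambda>a. (u, a, u)) ` aut G x" by (simp add: pe)
qed

lemma obj_Phi:
  "obj (Phi X f a b) = {((x, u), vw). x \<in> obj (simplices X 2) \<and> u \<in> hom (simplices X 1) (ob (face X 2 1) x) f \<and>
      vw \<in> hom (simplices X 1) (ob (face X 2 2) x) a \<times> hom (simplices X 1) (ob (face X 2 0) x) b}"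
proof (rule set_eqI)
  fix p :: "('a \<times> 'b) \<times> 'b \<times> 'b"
  obtain x u v w where p: "p = ((x, u), v, w)" by (cases p) auto
  show "p \<in> obj (Phi X f a b) \<longleftrightarrow> p \<in> {((x, u), vw). x \<in> obj (simplices X 2) \<and>
      u \<in> hom (simplices X 1) (ob (face X 2 1) x) f \<and>
      vw \<in> hom (simplices X 1) (ob (face X 2 2) x) a \<times> hom (simplices X 1) (ob (face X 2 0) x) b}"
    unfolding p by (simp add: Phi_def gcomp_def gpair_def hofib_proj_def hom_gprod)
qed

text \<open>Collects what makes every cardinality below a finite sum over objects. For the bar
  construction, \<open>finite_fibre\<close> is the condition that rests on local finiteness.\<close>

locale incidence =
  fixes X :: "('o, 'a) sgpd"
  assumes X0: "groupoid (simplices X 0)" and X1: "groupoid (simplices X 1)" and X2: "groupoid (simplices X 2)"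
    and face_functor: "i \<le> 2 \<Longrightarrow> gfunctor (face X 2 i) (simplices X 2) (simplices X 1)"
    and degen_functor: "gfunctor (degen X 0 0) (simplices X 0) (simplices X 1)"
    and finite_hom: "finite (hom (simplices X 1) x y)"
    and finite_aut0: "finite (aut (simplices X 0) z)"
    and finite_aut2: "finite (aut (simplices X 2) t)"
    and finite_fibre: "f \<in> obj (simplices X 1) \<Longrightarrow>
      finite {x \<in> obj (simplices X 2). hom (simplices X 1) (ob (face X 2 1) x) f \<noteq> {}}"
    and finite_fibre0: "f \<in> obj (simplices X 1) \<Longrightarrow>
      finite {x \<in> obj (simplices X 0). hom (simplices X 1) (ob (degen X 0 0) x) f \<noteq> {}}"
begin

lemma finite_obj_Phi:
  assumes "f \<in> obj (simplices X 1)"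
  shows "finite (obj (Phi X f a b))"
proof (rule finite_subset)
  let ?T = "{x \<in> obj (simplices X 2). hom (simplices X 1) (ob (face X 2 1) x) f \<noteq> {}}"
  show "obj (Phi X f a b) \<subseteq> (SIGMA p:(SIGMA x:?T. hom (simplices X 1) (ob (face X 2 1) x) f).
      hom (simplices X 1) (ob (face X 2 2) (fst p)) a \<times> hom (simplices X 1) (ob (face X 2 0) (fst p)) b)"
    unfolding obj_Phi by auto
  show "finite \<dots>" using finite_fibre[OF assms] finite_hom by (intro finite_SigmaI finite_cartesian_product) auto
qed

lemma Phi_groupoids:
  "groupoid (hofib (simplices X 2) (simplices X 1) (face X 2 1) f)"
  "groupoid (gprod (simplices X 1) (simplices X 1))"
  "gfunctor (gpair (face X 2 2) (face X 2 0) \<odot> hofib_proj)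
     (hofib (simplices X 2) (simplices X 1) (face X 2 1) f) (gprod (simplices X 1) (simplices X 1))"
  "groupoid (Phi X f a b)"
proof -
  show 1: "groupoid (hofib (simplices X 2) (simplices X 1) (face X 2 1) f)"
    using X1 X2 face_functor by (intro groupoid_hofib) auto
  show 2: "groupoid (gprod (simplices X 1) (simplices X 1))" using X1 by (intro groupoid_gprod)
  show 3: "gfunctor (gpair (face X 2 2) (face X 2 0) \<odot> hofib_proj)
     (hofib (simplices X 2) (simplices X 1) (face X 2 1) f) (gprod (simplices X 1) (simplices X 1))"
    using face_functor by (intro gfunctor_gcomp[OF gfunctor_hofib_proj] gfunctor_gpair) auto
  show "groupoid (Phi X f a b)" unfolding Phi_def by (intro groupoid_hofib 1 2 3)
qed

lemma finite_aut_Phi: "finite (aut (Phi X f a b) p)"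
proof -
  obtain x u v where p: "p = ((x, u), v)" by (cases p) auto
  show ?thesis unfolding p Phi_def
    by (rule finite_subset[OF aut_hofib_subset] finite_imageI finite_aut2)+
qed

lemma homotopy_finite_Phi:
  "f \<in> obj (simplices X 1) \<Longrightarrow> homotopy_finite (Phi X f a b)"
  unfolding homotopy_finite_def
  by (intro conjI ballI groupoid.finite_pi0[OF Phi_groupoids(4)] finite_obj_Phi finite_aut_Phi)

lemma homotopy_finite_counit:
  assumes "f \<in> obj (simplices X 1)"
  shows "homotopy_finite (hofib (simplices X 0) (simplices X 1) (degen X 0 0) f)"
    "finite (obj (hofib (simplices X 0) (simplices X 1) (degen X 0 0) f))"
    "finite (aut (hofib (simplices X 0) (simplices X 1) (degen X 0 0) f) p)"
proof -
  let ?H = "hofib (simplices X 0) (simplices X 1) (degen X 0 0) f"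
  have "obj ?H \<subseteq> (SIGMA x:{x \<in> obj (simplices X 0). hom (simplices X 1) (ob (degen X 0 0) x) f \<noteq> {}}.
      hom (simplices X 1) (ob (degen X 0 0) x) f)" by auto
  then show fin: "finite (obj ?H)"
    by (rule finite_subset) (intro finite_SigmaI finite_fibre0 assms finite_hom)
  show aut: "finite (aut ?H p)" for p
    by (cases p) (auto intro: finite_subset[OF aut_hofib_subset] finite_aut0)
  show "homotopy_finite ?H"
    unfolding homotopy_finite_def
    using groupoid.finite_pi0[OF groupoid_hofib[OF X0 X1 degen_functor] fin] aut by blast
qed

text \<open>An object of \<open>Phi\<close> over \<open>x\<close> consists of arrows from
  \<open>d\<^sub>1 x\<close>, \<open>d\<^sub>2 x\<close> and \<open>d\<^sub>0 x\<close> to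
  \<open>f\<close>, \<open>a\<close> and \<open>b\<close>, and its star is as large as that of
  \<open>x\<close>. The arrows to \<open>a\<close> and \<open>b\<close> number |Aut(a)| |Aut(b)| or
  0, so the normalisation of the coefficient cancels and leaves an indicator.\<close>

lemma section_coeff_eq_sum:
  assumes f: "f \<in> obj (simplices X 1)" and a: "a \<in> obj (simplices X 1)" and b: "b \<in> obj (simplices X 1)"
  shows "section_coeff X f a b =
    (\<Sum>x | x \<in> obj (simplices X 2) \<and> hom (simplices X 1) (ob (face X 2 1) x) f \<noteq> {}.
       (if hom (simplices X 1) (ob (face X 2 2) x) a \<noteq> {} \<and> hom (simplices X 1) (ob (face X 2 0) x) b \<noteq> {}
        then 1 else 0) *
       (of_nat (card (hom (simplices X 1) (ob (face X 2 1) x) f)) / of_nat (card (star (simplices X 2) x))))"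
    (is "_ = sum ?t ?T")
proof -
  let ?h = "\<lambda>i x c. hom (simplices X 1) (ob (face X 2 i) x) c"
  interpret P: groupoid "Phi X f a b" by (rule Phi_groupoids)
  interpret G1: groupoid "simplices X 1" by (rule X1)
  let ?O = "SIGMA p:(SIGMA x:?T. ?h 1 x f). ?h 2 (fst p) a \<times> ?h 0 (fst p) b"
  have O: "obj (Phi X f a b) = ?O" unfolding obj_Phi by auto
  have "hcard (Phi X f a b) = (\<Sum>p\<in>obj (Phi X f a b). 1 / of_nat (card (star (Phi X f a b) p)))"
    by (rule P.hcard_eq_sum_star[OF finite_obj_Phi[OF f] finite_aut_Phi])
  also have "\<dots> = (\<Sum>p\<in>obj (Phi X f a b). 1 / of_nat (card (star (simplices X 2) (fst (fst p)))))"
  proof (rule sum.cong[OF refl])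
    fix p assume p: "p \<in> obj (Phi X f a b)"
    obtain x u v where pe: "p = ((x, u), v)" by (cases p) auto
    have xu: "(x, u) \<in> obj (hofib (simplices X 2) (simplices X 1) (face X 2 1) f)"
      using p unfolding pe obj_Phi by simp
    have "card (star (Phi X f a b) p) = card (star (hofib (simplices X 2) (simplices X 1) (face X 2 1) f) (x, u))"
      using p unfolding pe Phi_def by (intro card_star_hofib Phi_groupoids)
    also have "\<dots> = card (star (simplices X 2) x)"
      using X1 X2 face_functor xu by (intro card_star_hofib) auto
    finally show "1 / of_nat (card (star (Phi X f a b) p)) = (1 / of_nat (card (star (simplices X 2) (fst (fst p)))) :: rat)"
      by (simp add: pe)
  qed
  also have "\<dots> = (\<Sum>p\<in>(SIGMA x:?T. ?h 1 x f). \<Sum>v\<in>?h 2 (fst p) a \<times> ?h 0 (fst p) b.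
      1 / of_nat (card (star (simplices X 2) (fst p))))"
    unfolding O
    by (subst sum.Sigma) (use finite_fibre[OF f] finite_hom in \<open>auto simp: case_prod_unfold intro!: finite_SigmaI\<close>)
  also have "\<dots> = (\<Sum>x\<in>?T. \<Sum>u\<in>?h 1 x f. \<Sum>v\<in>?h 2 x a \<times> ?h 0 x b. 1 / of_nat (card (star (simplices X 2) x)))"
    by (subst sum.Sigma) (use finite_fibre[OF f] finite_hom in \<open>auto simp: case_prod_unfold\<close>)
  also have "\<dots> = (\<Sum>x\<in>?T. of_nat (card (?h 1 x f)) * (of_nat (card (?h 2 x a)) * of_nat (card (?h 0 x b)))
      / of_nat (card (star (simplices X 2) x)))"
    by (simp add: card_cartesian_product)
  also have "\<dots> = (\<Sum>x\<in>?T. ?t x * (of_nat (card (aut (simplices X 1) a)) * of_nat (card (aut (simplices X 1) b))))"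
  proof (rule sum.cong[OF refl])
    fix x assume x: "x \<in> ?T"
    have c: "card (?h i x c) = (if ?h i x c \<noteq> {} then card (aut (simplices X 1) c) else 0)"
      if "i \<le> 2" "c \<in> obj (simplices X 1)" for i c
      using G1.hom_card_aut(2)[of "ob (face X 2 i) x" c] that x gfunctor.ob_obj[OF face_functor[OF that(1)], of x]
      by (auto simp: iso_rel_def)
    show "of_nat (card (?h 1 x f)) * (of_nat (card (?h 2 x a)) * of_nat (card (?h 0 x b)))
      / of_nat (card (star (simplices X 2) x))
      = ?t x * (of_nat (card (aut (simplices X 1) a)) * of_nat (card (aut (simplices X 1) b)))"
      using c[of 2 a] c[of 0 b] a b by simp
  qed
  finally have h: "hcard (Phi X f a b)
    = sum ?t ?T * (of_nat (card (aut (simplices X 1) a)) * of_nat (card (aut (simplices X 1) b)))"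
    by (simp add: sum_distrib_right)
  have "card (aut (simplices X 1) c) \<noteq> 0" if "c \<in> obj (simplices X 1)" for c
    using G1.idt_hom[OF that] finite_hom[of c c] by (auto simp: aut_def)
  then show ?thesis unfolding section_coeff_def h using a b by simp
qed

text \<open>A nonzero coefficient needs a simplex \<open>x\<close> in the finite fibre over
  \<open>f\<close>, and \<open>A\<close> and \<open>B\<close> are then the classes of its two outer
  faces.\<close>

lemma finite_section_support:
  assumes f: "f \<in> obj (simplices X 1)"
  shows "finite {(A, B). A \<in> pi0 (simplices X 1) \<and> B \<in> pi0 (simplices X 1) \<and>
                        section_coeff X f (rep A) (rep B) \<noteq> 0}"
proof (rule finite_subset)
  interpret G1: groupoid "simplices X 1" by (rule X1)
  let ?T = "{x \<in> obj (simplices X 2). hom (simplices X 1) (ob (face X 2 1) x) f \<noteq> {}}"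
  let ?c = "\<lambda>i x. iso_rel (simplices X 1) `` {ob (face X 2 i) x}"
  show "finite ((\<lambda>x. (?c 2 x, ?c 0 x)) ` ?T)" using finite_fibre[OF f] by simp
  show "{(A, B). A \<in> pi0 (simplices X 1) \<and> B \<in> pi0 (simplices X 1) \<and>
                        section_coeff X f (rep A) (rep B) \<noteq> 0} \<subseteq> (\<lambda>x. (?c 2 x, ?c 0 x)) ` ?T"
  proof clarify
    fix A B assume A: "A \<in> pi0 (simplices X 1)" and B: "B \<in> pi0 (simplices X 1)"
      and nz: "section_coeff X f (rep A) (rep B) \<noteq> 0"
    have "\<exists>x\<in>?T. hom (simplices X 1) (ob (face X 2 2) x) (rep A) \<noteq> {} \<and> hom (simplices X 1) (ob (face X 2 0) x) (rep B) \<noteq> {}"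
    proof (rule ccontr)
      assume "\<not> ?thesis"
      then have "section_coeff X f (rep A) (rep B) = 0"
        unfolding section_coeff_eq_sum[OF f G1.pi0_class(3)[OF A] G1.pi0_class(3)[OF B]]
        by (intro sum.neutral) auto
      with nz show False by contradiction
    qed
    then obtain x where x: "x \<in> ?T" and h: "hom (simplices X 1) (ob (face X 2 2) x) (rep A) \<noteq> {}"
      "hom (simplices X 1) (ob (face X 2 0) x) (rep B) \<noteq> {}" by blast
    have cls: "C = ?c i x" if C: "C \<in> pi0 (simplices X 1)" and "i \<le> 2"
      and "hom (simplices X 1) (ob (face X 2 i) x) (rep C) \<noteq> {}" for C i
    proof -
      have r: "(ob (face X 2 i) x, rep C) \<in> iso_rel (simplices X 1)"
        using that x gfunctor.ob_obj[OF face_functor] G1.pi0_class(3)[OF C] by (auto simp: iso_rel_def)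
      show ?thesis
        using equiv_class_eq[OF G1.equiv_iso_rel r] G1.pi0_class(4)[OF C G1.pi0_class(2)[OF C]] by simp
    qed
    show "(A, B) \<in> (\<lambda>x. (?c 2 x, ?c 0 x)) ` ?T"
      by (rule image_eqI[OF _ x]) (use cls[OF A _ h(1)] cls[OF B _ h(2)] in simp)
  qed
qed

lemma incidence_finite: "incidence_finite X"
  unfolding incidence_finite_def aut_def
  by (intro conjI ballI finite_hom homotopy_finite_counit(1) homotopy_finite_Phi finite_section_support)

end

lemma gfunctor_gpair_pullback:
  assumes "gfunctor F A B" "gfunctor F' A C"
    and "\<And>x. x \<in> obj A \<Longrightarrow> ob K (ob F x) = ob K' (ob F' x)"
    and "\<And>a. a \<in> arr A \<Longrightarrow> ar K (ar F a) = ar K' (ar F' a)"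
  shows "gfunctor (gpair F F') A (pullback B C K K')"
proof -
  interpret F: gfunctor F A B by fact
  interpret F': gfunctor F' A C by fact
  show ?thesis
    by unfold_locales
      (auto simp: gpair_def F.ob_obj F.ar_arr F.dm_ar F.cd_ar F.ar_cmp F'.ob_obj F'.ar_arr F'.dm_ar
        F'.cd_ar F'.ar_cmp assms(3,4))
qed

section \<open>Existence and finiteness of arrows between tuples\<close>

text \<open>Here \<open>m\<close> is a complete isomorphism invariant of the entries. Arrows exist
  for some permutation exactly if the lists of invariants are rearrangements of each other, which is
  equality of their multisets.\<close>

lemma hom_Sr_nonempty_iff:
  assumes "xs \<noteq> []"
    and m: "\<And>x y. x \<in> set xs \<Longrightarrow> y \<in> set ys \<Longrightarrow> hom A x y \<noteq> {} \<longleftrightarrow> m x = m y"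
  shows "hom (Sr A) xs ys \<noteq> {} \<longleftrightarrow> mset (map m xs) = mset (map m ys)"
proof (cases "length xs = length ys")
  case True
  let ?n = "length xs"
  have ne: "lists_in (map2 (hom A) xs (permute_list (inv \<sigma>) ys)) \<noteq> {} \<longleftrightarrow>
      map m xs = permute_list (inv \<sigma>) (map m ys)" if "\<sigma> permutes {..<?n}" for \<sigma>
  proof -
    have \<sigma>: "inv \<sigma> permutes {..<length ys}" using that True by (simp add: permutes_inv)
    have "fs \<in> lists_in (map2 (hom A) xs (permute_list (inv \<sigma>) ys)) \<longleftrightarrow>
        length fs = ?n \<and> (\<forall>i<?n. fs ! i \<in> hom A (xs ! i) (ys ! inv \<sigma> i))" for fs
      using True \<sigma> by (cases "length fs = ?n") (simp_all add: lists_in_def list_all2_conv_all_nth permute_list_nth)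
    then have "lists_in (map2 (hom A) xs (permute_list (inv \<sigma>) ys)) \<noteq> {} \<longleftrightarrow>
        (\<exists>fs. length fs = ?n \<and> (\<forall>i<?n. fs ! i \<in> hom A (xs ! i) (ys ! inv \<sigma> i)))"
      by blast
    also have "\<dots> \<longleftrightarrow> (\<forall>i<?n. hom A (xs ! i) (ys ! inv \<sigma> i) \<noteq> {})"
      by (simp only: Skolem_list_nth ex_in_conv[symmetric])
    also have "\<dots> \<longleftrightarrow> (\<forall>i<?n. m (xs ! i) = m (ys ! inv \<sigma> i))"
      using m True permutes_nth_less(1)[OF \<sigma>] by simp
    also have "\<dots> \<longleftrightarrow> map m xs = permute_list (inv \<sigma>) (map m ys)"
      using True \<sigma> permutes_nth_less(1)[OF \<sigma>] by (simp add: list_eq_iff_nth_eq permute_list_nth)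
    finally show ?thesis .
  qed
  have "hom (Sr A) xs ys \<noteq> {} \<longleftrightarrow>
      (\<exists>\<sigma>. \<sigma> permutes {..<?n} \<and> lists_in (map2 (hom A) xs (permute_list (inv \<sigma>) ys)) \<noteq> {})"
    unfolding hom_Sr[OF assms(1) True] by blast
  also have "\<dots> \<longleftrightarrow> (\<exists>\<sigma>. \<sigma> permutes {..<?n} \<and> map m xs = permute_list (inv \<sigma>) (map m ys))"
    by (intro arg_cong[of _ _ Ex] ext conj_cong refl ne)
  also have "\<dots> \<longleftrightarrow> mset (map m xs) = mset (map m ys)"
  proof
    assume "\<exists>\<sigma>. \<sigma> permutes {..<?n} \<and> map m xs = permute_list (inv \<sigma>) (map m ys)"
    then obtain \<sigma> where \<sigma>: "\<sigma> permutes {..<?n}" "map m xs = permute_list (inv \<sigma>) (map m ys)" by blast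
    have "inv \<sigma> permutes {..<length (map m ys)}" using permutes_inv[OF \<sigma>(1)] True by simp
    then show "mset (map m xs) = mset (map m ys)" unfolding \<sigma>(2) by (rule mset_permute_list)
  next
    assume "mset (map m xs) = mset (map m ys)"
    then obtain \<rho> where "\<rho> permutes {..<length (map m ys)}" "permute_list \<rho> (map m ys) = map m xs"
      by (rule mset_eq_permutation)
    then show "\<exists>\<sigma>. \<sigma> permutes {..<?n} \<and> map m xs = permute_list (inv \<sigma>) (map m ys)"
      using True by (intro exI[of _ "inv \<rho>"]) (simp add: permutes_inv permutes_inv_inv)
  qed
  finally show ?thesis .
next
  case False
  then have "size (mset (map m xs)) \<noteq> size (mset (map m ys))" by simp
  then have "mset (map m xs) \<noteq> mset (map m ys)" by metis
  then show ?thesis using hom_Sr_length[of A xs ys] False by blast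
qed

lemma finite_hom_Sr:
  assumes "\<And>x y. finite (hom A x y)"
  shows "finite (hom (Sr A) xs ys)"
proof (cases "xs \<noteq> [] \<and> length xs = length ys")
  case True
  then show ?thesis
    using assms by (auto simp: hom_Sr finite_permutations intro!: finite_SigmaI finite_lists_in)
next
  case False
  then have "hom (Sr A) xs ys = {}" using hom_Sr_length[of A xs ys] by (auto simp: hom_def)
  then show ?thesis by simp
qed

lemma finite_hom_relabel:
  assumes "inj (ob R)" "inj (ar R)" "\<And>x y. finite (hom G x y)"
  shows "finite (hom (relabel R G) x y)"
proof (cases "hom (relabel R G) x y = {}")
  case False
  then obtain x' y' where "x = ob R x'" "y = ob R y'"
    using assms by (auto simp: hom_def)
  then show ?thesis using assms by (simp add: hom_relabel)
qed simp

lemma finite_hom_pullback: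
  assumes "\<And>x x'. finite (hom A x x')" "\<And>y y'. finite (hom B y y')"
  shows "finite (hom (pullback A B F K) p q)"
proof (rule finite_subset)
  show "hom (pullback A B F K) p q \<subseteq> hom A (fst p) (fst q) \<times> hom B (snd p) (snd q)"
    by (auto simp: hom_def)
qed (intro finite_cartesian_product assms)

section \<open>The bar construction of a monoid\<close>

abbreviation Yop :: "(unit, unit, 'y::monoid_mult list, 'y srarr) operad" where
  "Yop \<equiv> T_Sr monoid_cat"

abbreviation Ydisc :: "('y, 'y) gpd" where
  "Ydisc \<equiv> discrete UNIV"

text \<open>Composition before concatenation: each root entry is multiplied into its block. On
  arrows the permutation of the root is dropped, since in the pullback it equals the permutation of
  the blocks.\<close>

definition act ::
  "('y::monoid_mult list list \<times> 'y list, 'y srarr srarr \<times> 'y srarr, 'y list list, 'y srarr srarr) gfun" where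
  "act = \<lparr>ob = (\<lambda>(gss, fs). map2 (\<lambda>f gs. map (\<lambda>g. f * g) gs) fs gss),
     ar = (\<lambda>((\<sigma>, gss), (\<sigma>', fs)). (\<sigma>, map2 (\<lambda>f (\<tau>, gs). (\<tau>, map (\<lambda>g. f * g) gs)) fs gss))\<rparr>"

lemma full_sub_UNIV: "full_sub G UNIV = (G :: ('o, 'a) gpd)"
  by (cases G) (simp add: full_sub_def)

lemma Yop_simps:
  "colours Yop = discrete UNIV"
  "opers Yop = Sr Ydisc"
  "src Yop = Sr_map \<lparr>ob = (\<lambda>_. ()), ar = (\<lambda>_. ())\<rparr>"
  "tgt Yop = \<lparr>ob = (\<lambda>_. ()), ar = (\<lambda>_. ())\<rparr>"
  "mul Yop = Sr_mult \<odot> act"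
  "unt Yop = \<lparr>ob = (\<lambda>_. [1]), ar = (\<lambda>_. (id, [1]))\<rparr>"
  by (simp_all add: T_Sr_def monoid_cat_def act_def Sr_unit_def gcomp_def o_def case_prod_unfold
      discrete_def full_sub_UNIV)

lemma inv_Col [simp]: "inv Col (Col x) = x" and inv_Op [simp]: "inv Op (Op q) = q"
  and inv_Graft [simp]: "inv Graft (Graft p) = p"
  by (simp_all add: inv_f_f inj_def)

lemma inv_ColA [simp]: "inv ColA (ColA x) = x" and inv_OpA [simp]: "inv OpA (OpA q) = q"
  and inv_GraftA [simp]: "inv GraftA (GraftA p) = p"
  by (simp_all add: inv_f_f inj_def)

lemma inj_tags [simp]:
  "inj (ob gCol)" "inj (ar gCol)" "inj (ob gOp)" "inj (ar gOp)" "inj (ob gGraft)" "inj (ar gGraft)"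
  by (simp_all add: gCol_def gOp_def gGraft_def inj_def)

abbreviation lev1 :: "((unit, 'y::monoid_mult list) lev, (unit, 'y srarr) levarr) gpd" where
  "lev1 \<equiv> relabel gOp (Sr Ydisc)"

abbreviation grafts_gpd ::
  "((unit, 'y::monoid_mult list) lev list \<times> 'y list, (unit, 'y srarr) levarr srarr \<times> 'y srarr) gpd" where
  "grafts_gpd \<equiv> pullback (Sr lev1) (Sr Ydisc) (Sr_map (outp Yop (Suc 0))) (src Yop)"

abbreviation lev2 :: "((unit, 'y::monoid_mult list) lev, (unit, 'y srarr) levarr) gpd" where
  "lev2 \<equiv> relabel gGraft grafts_gpd"

abbreviation compose_levels ::
  "((unit, 'y::monoid_mult list) lev, (unit, 'y srarr) levarr, (unit, 'y list) lev, (unit, 'y srarr) levarr) gfun" where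
  "compose_levels \<equiv> gOp \<odot> mul Yop \<odot> gpair (Sr_map (ginv gOp) \<odot> gfst) gsnd \<odot> ginv gGraft"

lemma bar_simps:
  "simplices (bar Yop) 0 = Sr (relabel gCol (discrete UNIV))"
  "simplices (bar Yop) 1 = Sr lev1"
  "simplices (bar Yop) 2 = Sr lev2"
  "face (bar Yop) 2 0 = Sr_map (gOp \<odot> gsnd \<odot> ginv gGraft)"
  "face (bar Yop) 2 1 = Sr_map compose_levels"
  "face (bar Yop) 2 2 = Sr_mult \<odot> Sr_map (gfst \<odot> ginv gGraft)"
  "degen (bar Yop) 0 0 = Sr_map (gOp \<odot> unt Yop \<odot> ginv gCol)"
  by (simp_all add: bar_def numeral_2_eq_2 Yop_simps(1,2) Let_def)

lemma groupoid_Sr_Ydisc: "groupoid (Sr Ydisc)"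
  by (intro groupoid_Sr groupoid_discrete)

lemma groupoid_lev1: "groupoid lev1"
  by (intro groupoid_relabel groupoid_Sr_Ydisc) simp_all

lemma gfunctor_const: "gfunctor \<lparr>ob = (\<lambda>_. ()), ar = (\<lambda>_. ())\<rparr> G (discrete UNIV)"
  by unfold_locales (simp_all add: discrete_def)

lemma outp_one: "outp Yop (Suc 0) = \<lparr>ob = (\<lambda>_. ()), ar = (\<lambda>_. ())\<rparr>"
  by (simp add: Yop_simps gcomp_def o_def)

lemma gfunctor_src_Yop: "gfunctor (src Yop) (Sr Ydisc) (Sr (discrete UNIV))"
  unfolding Yop_simps by (intro gfunctor_Sr_map gfunctor_const)

lemma gfunctor_outp_Yop: "gfunctor (Sr_map (outp Yop (Suc 0))) (Sr lev1) (Sr (discrete UNIV))"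
  unfolding outp_one by (intro gfunctor_Sr_map gfunctor_const)

lemma groupoid_grafts: "groupoid grafts_gpd"
  by (rule groupoid_pullback[OF groupoid_Sr[OF groupoid_lev1] groupoid_Sr_Ydisc groupoid_Sr[OF groupoid_discrete]
        gfunctor_outp_Yop gfunctor_src_Yop])

lemma groupoid_lev2: "groupoid lev2"
  by (intro groupoid_relabel groupoid_grafts) simp_all

lemma cmp_Ydisc: "cmp Ydisc b a = a"
  by (simp add: discrete_def)

lemma cmp_Sr_Ydisc:
  assumes "length gs = length fs" "\<sigma> permutes {..<length fs}"
  shows "cmp (Sr Ydisc) (\<tau>, gs) (\<sigma>, fs) = (\<sigma> \<circ> \<tau>, fs)"
  using Sr_cmp[OF assms, of Ydisc \<tau>] by (simp add: cmp_Ydisc map_nth)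

abbreviation grafts_raw ::
  "('y::monoid_mult list list \<times> 'y list, 'y srarr srarr \<times> 'y srarr) gpd" where
  "grafts_raw \<equiv> pullback (Sr (Sr Ydisc)) (Sr Ydisc) (Sr_map (tgt Yop)) (src Yop)"

text \<open>With a single colour, an arrow of tuples of colours is just a permutation of a given
  length; so matching inputs with outputs amounts to equal lengths and equal permutations.\<close>

lemma arr_grafts_raw:
  "((\<sigma>, ps), (\<sigma>', fs)) \<in> arr grafts_raw \<longleftrightarrow>
    \<sigma>' = \<sigma> \<and> length fs = length ps \<and> ps \<noteq> [] \<and> \<sigma> permutes {..<length ps} \<and>
    (\<forall>(\<tau>, gs)\<in>set ps. gs \<noteq> [] \<and> \<tau> permutes {..<length gs})"
  by (auto simp: Yop_simps Sr_map_def map_replicate_const discrete_def)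

text \<open>Left multiplication by \<open>fs ! i\<close> commutes with permutations inside block
  \<open>i\<close>, and a permutation of the blocks carries the entries of the root along, because
  both levels have the same \<open>\<sigma>\<close>.\<close>

lemma gfunctor_act: "gfunctor act grafts_raw (Sr (Sr Ydisc))"
proof
  fix x assume "x \<in> obj grafts_raw"
  then obtain gss fs where x: "x = (gss, fs)" and "gss \<noteq> []" "length gss = length fs" "\<forall>gs\<in>set gss. gs \<noteq> []"
    by (auto simp: Yop_simps Sr_map_def map_replicate_const discrete_def)
  then show "ob act x \<in> obj (Sr (Sr Ydisc))"
    by (auto simp: act_def discrete_def set_zip)
next
  fix a assume a: "a \<in> arr grafts_raw"
  obtain \<sigma> ps \<sigma>' fs where [simp]: "a = ((\<sigma>, ps), (\<sigma>', fs))" by (cases a) auto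
  have a': "\<sigma>' = \<sigma>" "length fs = length ps" "ps \<noteq> []" "\<sigma> permutes {..<length ps}"
    "\<And>i. i < length ps \<Longrightarrow> snd (ps ! i) \<noteq> []"
    "\<And>i. i < length ps \<Longrightarrow> fst (ps ! i) permutes {..<length (snd (ps ! i))}"
    using a unfolding \<open>a = _\<close> arr_grafts_raw by (auto simp: case_prod_unfold)
  show "ar act a \<in> arr (Sr (Sr Ydisc))"
    using a' by (auto simp: act_def discrete_def set_zip case_prod_unfold)
  show "dm (Sr (Sr Ydisc)) (ar act a) = ob act (dm grafts_raw a)"
    using a' by (auto simp: act_def discrete_def case_prod_unfold Sr_def intro!: nth_equalityI)
  show "cd (Sr (Sr Ydisc)) (ar act a) = ob act (cd grafts_raw a)"
  proof (rule nth_equalityI)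
    fix i assume "i < length (cd (Sr (Sr Ydisc)) (ar act a))"
    then have i: "i < length ps" using a' by (simp add: act_def)
    then have si: "\<sigma> i < length ps" using permutes_nth_less(1)[OF a'(4)] by simp
    show "cd (Sr (Sr Ydisc)) (ar act a) ! i = ob act (cd grafts_raw a) ! i"
      using a' i si a'(6)[OF si]
      by (cases "ps ! \<sigma> i") (simp add: act_def discrete_def permute_list_nth case_prod_unfold permute_list_map)
  qed (use a' in \<open>simp add: act_def discrete_def\<close>)
next
  fix a b assume ab: "a \<in> arr grafts_raw" "b \<in> arr grafts_raw" "cd grafts_raw a = dm grafts_raw b"
  obtain \<sigma> ps \<sigma>' fs where [simp]: "a = ((\<sigma>, ps), (\<sigma>', fs))" by (cases a) auto
  obtain \<tau> qs \<tau>' gs where [simp]: "b = ((\<tau>, qs), (\<tau>', gs))" by (cases b) auto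
  have a': "\<sigma>' = \<sigma>" "length fs = length ps" "\<sigma> permutes {..<length ps}"
    "\<And>i. i < length ps \<Longrightarrow> fst (ps ! i) permutes {..<length (snd (ps ! i))}"
    using ab(1) unfolding \<open>a = _\<close> arr_grafts_raw by (auto simp: case_prod_unfold)
  have b': "\<tau>' = \<tau>" "length gs = length qs"
    using ab(2) unfolding \<open>b = _\<close> arr_grafts_raw by auto
  have e: "permute_list \<sigma> (map (cd (Sr Ydisc)) ps) = map (dm (Sr Ydisc)) qs"
    using ab(3) by simp
  from arg_cong[OF e, of length] have len: "length qs = length ps" by simp
  note inv = permutes_nth_less(2)[OF a'(3)]
  have lens: "length (snd (qs ! inv \<sigma> i)) = length (snd (ps ! i))" if i: "i < length ps" for i
  proof -
    have "dm (Sr Ydisc) (qs ! inv \<sigma> i) = cd (Sr Ydisc) (ps ! i)"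
      using arg_cong[OF e, of "\<lambda>xs. xs ! inv \<sigma> i"] i inv[OF i] len a'
      by (simp add: permute_list_nth permutes_inverses)
    from arg_cong[OF this, of length] show ?thesis
      by (cases "qs ! inv \<sigma> i"; cases "ps ! i") (simp add: discrete_def)
  qed
  have c: "cmp (Sr (Sr Ydisc)) (\<tau>, qs) (\<sigma>, ps)
    = (\<sigma> \<circ> \<tau>, map (\<lambda>i. (fst (ps ! i) \<circ> fst (qs ! inv \<sigma> i), snd (ps ! i))) [0..<length ps])"
  proof -
    have "cmp (Sr Ydisc) (qs ! inv \<sigma> i) (ps ! i) = (fst (ps ! i) \<circ> fst (qs ! inv \<sigma> i), snd (ps ! i))"
      if "i < length ps" for i
      using cmp_Sr_Ydisc[OF lens[OF that] a'(4)[OF that], of "fst (qs ! inv \<sigma> i)"] by simp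
    then show ?thesis using Sr_cmp[OF len a'(3), of "Sr Ydisc" \<tau>] by simp
  qed
  have "cmp (Sr (Sr Ydisc)) (ar act b) (ar act a)
    = (\<sigma> \<circ> \<tau>, map (\<lambda>i. (fst (ps ! i) \<circ> fst (qs ! inv \<sigma> i), map ((*) (fs ! i)) (snd (ps ! i)))) [0..<length ps])"
  proof -
    define ps' where "ps' = map2 (\<lambda>f (\<tau>, gs). (\<tau>, map ((*) f) gs)) fs ps"
    define qs' where "qs' = map2 (\<lambda>f (\<tau>, gs). (\<tau>, map ((*) f) gs)) gs qs"
    have l: "length ps' = length ps" "length qs' = length ps'"
      using a' b' len by (simp_all add: ps'_def qs'_def)
    have n: "ps' ! i = (fst (ps ! i), map ((*) (fs ! i)) (snd (ps ! i)))"
      "qs' ! i = (fst (qs ! i), map ((*) (gs ! i)) (snd (qs ! i)))" if "i < length ps" for i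
      using that a' b' len by (simp_all add: ps'_def qs'_def case_prod_unfold)
    have "cmp (Sr Ydisc) (qs' ! inv \<sigma> i) (ps' ! i) = (fst (ps ! i) \<circ> fst (qs ! inv \<sigma> i), map ((*) (fs ! i)) (snd (ps ! i)))"
      if i: "i < length ps" for i
      unfolding n[OF i] n[OF inv[OF i]] using lens[OF i] a'(4)[OF i] by (simp add: cmp_Sr_Ydisc)
    then show ?thesis using Sr_cmp[OF l(2), of \<sigma> "Sr Ydisc" \<tau>] a'(3) l
      by (simp add: act_def flip: ps'_def qs'_def)
  qed
  moreover have "cmp (Sr Ydisc) (\<tau>', gs) (\<sigma>', fs) = (\<sigma> \<circ> \<tau>, fs)"
    using a' b' len by (simp add: cmp_Sr_Ydisc)
  ultimately show "ar act (cmp grafts_raw b a) = cmp (Sr (Sr Ydisc)) (ar act b) (ar act a)"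
    using a' c by (auto simp: act_def intro!: nth_equalityI)
qed

lemma gfunctor_children: "gfunctor (gfst \<odot> ginv gGraft) lev2 (Sr lev1)"
  by (intro gfunctor_gcomp[OF gfunctor_ginv_relabel gfunctor_pullback_fst]) simp_all

lemma gfunctor_root: "gfunctor (gOp \<odot> gsnd \<odot> ginv gGraft) lev2 lev1"
  by (intro gfunctor_gcomp[OF gfunctor_gcomp[OF gfunctor_ginv_relabel gfunctor_pullback_snd] gfunctor_relabel]) simp_all

lemma gfunctor_unlabel:
  "gfunctor (gpair (Sr_map (ginv gOp) \<odot> gfst) gsnd) grafts_gpd grafts_raw"
proof (rule gfunctor_gpair_pullback)
  show "gfunctor (Sr_map (ginv gOp) \<odot> gfst) grafts_gpd (Sr (Sr Ydisc))"
    by (intro gfunctor_gcomp[OF gfunctor_pullback_fst] gfunctor_Sr_map gfunctor_ginv_relabel) simp_all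
  show "gfunctor gsnd grafts_gpd (Sr Ydisc)" by (rule gfunctor_pullback_snd)
qed (auto simp: gcomp_def gfst_def gsnd_def Sr_map_def Yop_simps o_def map_replicate_const)

lemma gfunctor_mul: "gfunctor (mul Yop) grafts_raw (Sr Ydisc)"
  unfolding Yop_simps(5)
  by (intro gfunctor_gcomp[OF gfunctor_act] gfunctor_Sr_mult groupoid_discrete)

lemma gfunctor_compose_levels: "gfunctor compose_levels lev2 lev1"
  by (intro gfunctor_gcomp[OF gfunctor_gcomp[OF gfunctor_gcomp[OF gfunctor_ginv_relabel gfunctor_unlabel]
      gfunctor_mul] gfunctor_relabel]) simp_all

lemma gfunctor_faces:
  assumes "i \<le> 2"
  shows "gfunctor (face (bar Yop) 2 i) (simplices (bar Yop) 2) (simplices (bar Yop) 1)"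
proof -
  from assms consider "i = 0" | "i = 1" | "i = 2" by linarith
  then show ?thesis
  proof cases
    case 1
    then show ?thesis by (simp only: bar_simps gfunctor_Sr_map gfunctor_root)
  next
    case 2
    then show ?thesis by (simp only: bar_simps gfunctor_Sr_map gfunctor_compose_levels)
  next
    case 3
    show ?thesis unfolding 3 bar_simps
      by (intro gfunctor_gcomp[OF gfunctor_Sr_map[OF gfunctor_children] gfunctor_Sr_mult] groupoid_lev1)
  qed
qed

lemma gfunctor_degen:
  "gfunctor (degen (bar Yop) 0 0) (simplices (bar Yop) 0) (simplices (bar Yop) 1)"
proof -
  have "gfunctor (unt Yop) (discrete UNIV) (Sr Ydisc)"
    unfolding Yop_simps
    by unfold_locales (simp_all add: discrete_def permutes_id Sr_cmp permute_list_def del: permute_list_id)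
  then show ?thesis unfolding bar_simps
    by (intro gfunctor_Sr_map gfunctor_gcomp[OF gfunctor_gcomp[OF gfunctor_ginv_relabel] gfunctor_relabel]) simp_all
qed

section \<open>Counting arrows\<close>

lemma discrete_simps [simp]:
  "obj (discrete S) = S" "arr (discrete S) = S" "dm (discrete S) = (\<lambda>x. x)" "cd (discrete S) = (\<lambda>x. x)"
  "cmp (discrete S) = (\<lambda>y x. x)"
  by (simp_all add: discrete_def)

lemma inj_constructors [simp]: "inj Col" "inj Op" "inj Graft" "inj ColA" "inj OpA" "inj GraftA"
  by (simp_all add: inj_def)

lemma ob_tags [simp]: "ob gCol = Col" "ob gOp = Op" "ob gGraft = Graft"
  by (simp_all add: gCol_def gOp_def gGraft_def)

lemma ar_tags [simp]: "ar gCol = ColA" "ar gOp = OpA" "ar gGraft = GraftA"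
  by (simp_all add: gCol_def gOp_def gGraft_def)

text \<open>The operadic composite of the root \<open>fs\<close> with the operations
  \<open>gss\<close>, one for each input.\<close>

definition mult_list :: "'y::monoid_mult list list \<Rightarrow> 'y list \<Rightarrow> 'y list" where
  "mult_list gss fs = concat (map2 (\<lambda>f gs. map ((*) f) gs) fs gss)"

text \<open>A complete isomorphism invariant of tuples of operations. Its values are monomials of
  the polynomial algebra, and this is the source of the isomorphism.\<close>

definition type_of_tuple :: "(unit, 'y list) lev list \<Rightarrow> 'y monom" where
  "type_of_tuple xs = mset (map (\<lambda>x. mset (inv Op x)) xs)"

lemma obj_lev1: "x \<in> obj lev1 \<longleftrightarrow> (\<exists>l. l \<noteq> [] \<and> x = Op l)"
  by auto

lemma obj_lev1_D: "x \<in> obj lev1 \<Longrightarrow> inv Op x \<noteq> []" "x \<in> obj lev1 \<Longrightarrow> Op (inv Op x) = x"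
  by (auto simp: obj_lev1)

lemma obj_lev2:
  "x \<in> obj lev2 \<longleftrightarrow> (\<exists>gss fs. x = Graft (map Op gss, fs) \<and> fs \<noteq> [] \<and> length gss = length fs \<and> [] \<notin> set gss)"
proof
  assume "x \<in> obj lev2"
  then obtain Gs fs where x: "x = Graft (Gs, fs)" and "fs \<noteq> []" and l: "length Gs = length fs"
    and s: "set Gs \<subseteq> Op ` {l. l \<noteq> []}"
    by (auto simp: Yop_simps Sr_map_def map_replicate_const gcomp_def o_def)
  from s have s': "Op (inv Op G) = G" "[] \<noteq> inv Op G" if "G \<in> set Gs" for G using that by auto
  then have "map Op (map (inv Op) Gs) = Gs" "[] \<notin> set (map (inv Op) Gs)"
    by (auto intro!: map_idI)
  with x l \<open>fs \<noteq> []\<close> show "\<exists>gss fs. x = Graft (map Op gss, fs) \<and> fs \<noteq> [] \<and> length gss = length fs \<and> [] \<notin> set gss"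
    by (intro exI[of _ "map (inv Op) Gs"] exI[of _ fs]) simp
next
  assume "\<exists>gss fs. x = Graft (map Op gss, fs) \<and> fs \<noteq> [] \<and> length gss = length fs \<and> [] \<notin> set gss"
  then show "x \<in> obj lev2"
    by (auto simp: Yop_simps Sr_map_def map_replicate_const gcomp_def o_def inj_image_mem_iff)
qed

lemma ob_compose_levels: "ob compose_levels (Graft (map Op gss, fs)) = Op (mult_list gss fs)"
  by (simp add: gcomp_def gpair_def gfst_def gsnd_def ginv_def Yop_simps Sr_mult_def Sr_map_def act_def mult_list_def o_def)

lemma hom_lev1: "hom lev1 (Op l) (Op k) = OpA ` hom (Sr Ydisc) l k"
  using hom_relabel[of gOp "Sr Ydisc" l k] by simp

lemma hom_Ydisc: "hom Ydisc x y \<noteq> {} \<longleftrightarrow> x = y" "finite (hom Ydisc x y)"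
  by (auto simp: hom_def)

lemma hom_Sr_Ydisc_nonempty:
  assumes "l \<noteq> []"
  shows "hom (Sr Ydisc) l k \<noteq> {} \<longleftrightarrow> mset l = mset k"
  using hom_Sr_nonempty_iff[OF assms hom_Ydisc(1), of k] unfolding list.map_ident .

lemma hom_lev1_nonempty: "l \<noteq> [] \<Longrightarrow> hom lev1 (Op l) (Op k) \<noteq> {} \<longleftrightarrow> mset l = mset k"
  unfolding hom_lev1 image_is_empty by (rule hom_Sr_Ydisc_nonempty)

lemma finite_hom_lev1: "finite (hom lev1 x y)"
  by (intro finite_hom_relabel finite_hom_Sr hom_Ydisc) simp_all

lemma finite_hom_lev2: "finite (hom lev2 x y)"
  by (intro finite_hom_relabel finite_hom_pullback finite_hom_Sr finite_hom_lev1 hom_Ydisc) simp_all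

lemma hom_Sr_lev1_nonempty:
  assumes "xs \<in> obj (Sr lev1)" "ys \<in> obj (Sr lev1)"
  shows "hom (Sr lev1) xs ys \<noteq> {} \<longleftrightarrow> type_of_tuple xs = type_of_tuple ys"
  unfolding type_of_tuple_def
proof (rule hom_Sr_nonempty_iff)
  show "xs \<noteq> []" using assms by simp
  fix x y assume "x \<in> set xs" "y \<in> set ys"
  then have "x \<in> obj lev1" "y \<in> obj lev1" using assms by (auto simp only: Sr_simps mem_Collect_eq)
  then obtain l k where xy: "x = Op l" "y = Op k" and l: "l \<noteq> []" by (auto simp only: obj_lev1)
  show "hom lev1 x y \<noteq> {} \<longleftrightarrow> mset (inv Op x) = mset (inv Op y)"
    unfolding xy inv_Op by (rule hom_lev1_nonempty[OF l])
qed

lemma card_star_Sr_Ydisc: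
  assumes "l \<noteq> []"
  shows "card (star (Sr Ydisc) l) = fact (length l)"
proof -
  have "star Ydisc x = {x}" for x :: 'a by (auto simp: star_def)
  then show ?thesis by (simp add: card_star_Sr[OF assms] map_replicate_const)
qed

text \<open>Orbit and stabiliser: the class of \<open>k\<close> is the set of orderings of
  \<open>mset k\<close>, and the star of \<open>k\<close> has \<open>(length k)!\<close> elements.
  The quotient is the product of the factorials of the multiplicities, so the normalisation of the
  coordinates appears as an automorphism count.\<close>

lemma card_hom_Sr_Ydisc:
  assumes l: "l \<noteq> []" and lk: "mset l = mset k"
  shows "card (hom (Sr Ydisc) l k) = mset_fact (mset k)"
proof -
  interpret groupoid "Sr Ydisc" by (rule groupoid_Sr_Ydisc)
  let ?C = "iso_rel (Sr Ydisc) `` {k}"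
  have k: "k \<noteq> []" using l lk by auto
  then have kO: "k \<in> obj (Sr Ydisc)" by simp
  have C: "?C = permutations_of_multiset (mset k)"
    using k by (auto simp: iso_rel_def hom_Sr_Ydisc_nonempty permutations_of_multiset_def)
  have CP: "?C \<in> pi0 (Sr Ydisc)" unfolding pi0_def using kO by (rule quotientI)
  have kC: "k \<in> ?C" unfolding C by (simp add: permutations_of_multiset_def)
  have fin: "finite (aut (Sr Ydisc) x)" for x
    unfolding aut_def by (intro finite_hom_Sr hom_Ydisc)
  have "fact (length k) = card ?C * card (aut (Sr Ydisc) (rep ?C))"
    using card_star[OF CP kC _ fin] card_star_Sr_Ydisc[OF k] by (simp add: C)
  also have "card (aut (Sr Ydisc) (rep ?C)) = card (aut (Sr Ydisc) k)"
    using hom_card_aut(1,2)[OF pi0_class(5)[OF CP kC pi0_class(2)[OF CP]]] by simp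
  finally have "card ?C * mset_fact (mset k) = card ?C * card (aut (Sr Ydisc) k)"
    using card_permutations_of_multiset_aux[of "mset k"] by (simp add: C mset_fact_def)
  moreover have "card ?C \<noteq> 0" using kC unfolding C by auto
  moreover have "card (hom (Sr Ydisc) l k) = card (aut (Sr Ydisc) k)"
    using l k lk by (intro hom_card_aut(2)) (simp add: iso_rel_def hom_Sr_Ydisc_nonempty)
  ultimately show ?thesis by simp
qed

lemma card_hom_lev1:
  assumes "l \<noteq> []" "mset l = mset k"
  shows "card (hom lev1 (Op l) (Op k)) = mset_fact (mset k)"
  unfolding hom_lev1 by (subst card_image) (simp_all add: inj_on_def card_hom_Sr_Ydisc[OF assms])

lemma card_star_lev1:
  assumes "l \<noteq> []"
  shows "card (star lev1 (Op l)) = fact (length l)"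
proof -
  have "star lev1 (Op l) = OpA ` star (Sr Ydisc) l"
    using star_relabel[of gOp "Sr Ydisc" l] by simp
  then show ?thesis by (simp add: card_image inj_on_def card_star_Sr_Ydisc[OF assms])
qed

text \<open>An arrow out of a two-level tree is determined by its leafward part: the root arrow must
  have the same permutation, and its components are identities because the monoid is
  discrete.\<close>

lemma card_star_lev2:
  assumes "fs \<noteq> []" "length gss = length fs" "[] \<notin> set gss"
  shows "card (star lev2 (Graft (map Op gss, fs))) = fact (length fs) * (\<Prod>gs\<leftarrow>gss. fact (length gs))"
proof -
  let ?Gs = "map Op gss"
  have "star lev2 (Graft (?Gs, fs)) = GraftA ` star grafts_gpd (?Gs, fs)"
    using star_relabel[of gGraft grafts_gpd "(?Gs, fs)"] by simp
  then have "card (star lev2 (Graft (?Gs, fs))) = card (star grafts_gpd (?Gs, fs))"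
    by (simp add: card_image inj_on_def)
  also have "\<dots> = card (star (Sr lev1) ?Gs)"
  proof (rule bij_betw_same_card)
    show "bij_betw fst (star grafts_gpd (?Gs, fs)) (star (Sr lev1) ?Gs)"
    proof (rule bij_betw_byWitness[where f' = "\<lambda>(\<sigma>, as). ((\<sigma>, as), (\<sigma>, fs))"])
      show "\<forall>a\<in>star grafts_gpd (?Gs, fs). (case fst a of (\<sigma>, as) \<Rightarrow> ((\<sigma>, as), \<sigma>, fs)) = a"
        by (auto simp: star_def Sr_map_def Yop_simps)
      show "fst ` star grafts_gpd (?Gs, fs) \<subseteq> star (Sr lev1) ?Gs"
        by (auto simp: star_def simp del: relabel_simps Sr_simps)
      show "(\<lambda>(\<sigma>, as). ((\<sigma>, as), \<sigma>, fs)) ` star (Sr lev1) ?Gs \<subseteq> star grafts_gpd (?Gs, fs)"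
      proof clarify
        fix \<sigma> as assume a: "(\<sigma>, as) \<in> star (Sr lev1) ?Gs"
        then have as: "(\<sigma>, as) \<in> arr (Sr lev1)" "map (dm lev1) as = ?Gs"
          by (simp_all add: star_def del: relabel_simps)
        from arg_cong[OF as(2), of length] have len: "length as = length fs" using assms by simp
        with as(1) have "\<sigma> permutes {..<length fs}" by simp
        then have "(\<sigma>, fs) \<in> arr (Sr Ydisc)" using assms by simp
        moreover have "ar (Sr_map (outp Yop (Suc 0))) (\<sigma>, as) = ar (src Yop) (\<sigma>, fs)"
          using len unfolding outp_one by (simp add: Sr_map_def Yop_simps map_replicate_const)
        ultimately show "((\<sigma>, as), \<sigma>, fs) \<in> star grafts_gpd (?Gs, fs)"
          using as unfolding star_def by (simp del: relabel_simps outp.simps Sr_simps(2))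
      qed
    qed (auto simp: star_def)
  qed
  also have "\<dots> = fact (length fs) * (\<Prod>gs\<leftarrow>gss. card (star lev1 (Op gs)))"
    using assms by (subst card_star_Sr) (auto simp: o_def)
  also have "(\<Prod>gs\<leftarrow>gss. card (star lev1 (Op gs))) = (\<Prod>gs\<leftarrow>gss. fact (length gs))"
    using assms by (intro arg_cong[of _ _ prod_list] map_cong refl card_star_lev1) auto
  finally show ?thesis .
qed

section \<open>Two-level trees with prescribed composite\<close>

definition grafts :: "'y::monoid_mult multiset \<Rightarrow> ('y list list \<times> 'y list) set" where
  "grafts \<kappa> = {(gss, fs). fs \<noteq> [] \<and> length gss = length fs \<and> [] \<notin> set gss \<and> mset (mult_list gss fs) = \<kappa>}"

lemma mult_list_nonempty:
  assumes "fs \<noteq> []" "length gss = length fs" "[] \<notin> set gss"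
  shows "mult_list gss fs \<noteq> []"
  using assms by (cases fs; cases gss) (auto simp: mult_list_def)

lemma fibre_lev2:
  fixes l :: "'y::monoid_mult list"
  shows "{x \<in> obj lev2. hom lev1 (ob compose_levels x) (Op l) \<noteq> {}}
    = (\<lambda>(gss, fs). Graft (map Op gss, fs)) ` grafts (mset l)"
proof (intro set_eqI iffI)
  fix x :: "(unit, 'y list) lev"
  assume x: "x \<in> {x \<in> obj lev2. hom lev1 (ob compose_levels x) (Op l) \<noteq> {}}"
  then have "x \<in> obj lev2" and h: "hom lev1 (ob compose_levels x) (Op l) \<noteq> {}" by blast+
  then obtain gss fs where xe: "x = Graft (map Op gss, fs)"
    and g: "fs \<noteq> []" "length gss = length fs" "[] \<notin> set gss" by (auto simp only: obj_lev2)
  from h have "mset (mult_list gss fs) = mset l"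
    unfolding xe ob_compose_levels hom_lev1_nonempty[OF mult_list_nonempty[OF g]] .
  then have "(gss, fs) \<in> grafts (mset l)" using g by (simp add: grafts_def)
  then show "x \<in> (\<lambda>(gss, fs). Graft (map Op gss, fs)) ` grafts (mset l)" by (rule image_eqI[rotated]) (simp add: xe)
next
  fix x :: "(unit, 'y list) lev"
  assume "x \<in> (\<lambda>(gss, fs). Graft (map Op gss, fs)) ` grafts (mset l)"
  then obtain gss fs where xe: "x = Graft (map Op gss, fs)"
    and g: "fs \<noteq> []" "length gss = length fs" "[] \<notin> set gss" and m: "mset (mult_list gss fs) = mset l"
    by (auto simp: grafts_def)
  have "x \<in> obj lev2" unfolding obj_lev2 using xe g by blast
  moreover have "hom lev1 (ob compose_levels x) (Op l) \<noteq> {}"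
    unfolding xe ob_compose_levels hom_lev1_nonempty[OF mult_list_nonempty[OF g]] by (rule m)
  ultimately show "x \<in> {x \<in> obj lev2. hom lev1 (ob compose_levels x) (Op l) \<noteq> {}}" by blast
qed

lemma length_mult_list:
  assumes "length gss = length fs"
  shows "length (mult_list gss fs) = (\<Sum>gs\<leftarrow>gss. length gs)"
  using assms by (induction gss fs rule: list_induct2) (simp_all add: mult_list_def)

lemma set_mult_list:
  assumes "length gss = length fs" "i < length fs" "g \<in> set (gss ! i)"
  shows "fs ! i * g \<in> set (mult_list gss fs)"
proof -
  have "(fs ! i, gss ! i) \<in> set (zip fs gss)" using assms by (auto simp: set_zip)
  then show ?thesis using assms(3) by (force simp: mult_list_def)
qed

text \<open>For the tree \<open>x\<close> given by \<open>(gss, fs)\<close>: the number of arrows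
  from its composite to an operation of type \<open>\<kappa>\<close>, divided by the size of the
  star of \<open>x\<close>.\<close>

definition graft_weight :: "'y multiset \<Rightarrow> 'y list list \<times> 'y list \<Rightarrow> rat" where
  "graft_weight \<kappa> = (\<lambda>(gss, fs). of_nat (mset_fact \<kappa>) / (fact (length fs) * (\<Prod>gs\<leftarrow>gss. fact (length gs))))"

text \<open>The types of the outer faces \<open>d\<^sub>2\<close> and \<open>d\<^sub>0\<close> of
  the one-element tuple formed by the tree: a tuple of operations on the leafward side, a single
  operation at the root.\<close>

definition graft_type :: "'y list list \<times> 'y list \<Rightarrow> 'y monom \<times> 'y monom" where
  "graft_type = (\<lambda>(gss, fs). (mset (map mset gss), {#mset fs#}))"

text \<open>The explicit form of the comultiplication of a coordinate. It is reached from both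
  sides: from incidence coefficients and from the coefficients of a plethysm.\<close>

definition graft_poly :: "'y::monoid_mult multiset \<Rightarrow> ('y monom \<times> 'y monom \<Rightarrow>\<^sub>0 rat)" where
  "graft_poly \<kappa> = (\<Sum>p\<in>grafts \<kappa>. Poly_Mapping.single (graft_type p) (graft_weight \<kappa> p))"

text \<open>Expanding the product chooses one term from each factor and adds the exponents. Thus a
  coefficient of the product is a sum over tuples with prescribed total type.\<close>

lemma prod_list_sum_single:
  fixes w :: "'x \<Rightarrow> 'f \<Rightarrow> rat" and e :: "'x \<Rightarrow> 'm::comm_monoid_add"
  shows "(\<Prod>f\<leftarrow>fs. \<Sum>x\<in>S f. Poly_Mapping.single (e x) (w x f))
    = (\<Sum>xs\<in>lists_in (map S fs). Poly_Mapping.single (\<Sum>x\<leftarrow>xs. e x) (prod_list (map2 w xs fs)))"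
proof (induction fs)
  case (Cons f fs)
  then show ?case
    by (simp add: sum_lists_in_Cons sum_distrib_left sum_distrib_right mult_single)
      (rule sum.swap)
qed simp

context
  assumes locally_finite: "\<And>m :: 'y::monoid_mult. finite {(n, k). m = n * k}"
begin

text \<open>Each product of a root entry with an entry of its block lies in \<open>\<kappa>\<close>,
  so all entries come from the finite set \<open>E\<close> of left and right factors. As no block is
  empty, \<open>size \<kappa>\<close> bounds the number of blocks as well as their lengths.\<close>

lemma finite_grafts: "finite (grafts (\<kappa> :: 'y multiset))"
proof -
  define P where "P = (\<Union>m\<in>set_mset \<kappa>. {(n, k). m = n * k})"
  define E where "E = fst ` P \<union> snd ` P"
  have "finite P" unfolding P_def using locally_finite by (intro finite_UN_I) auto
  then have finE: "finite E" by (simp add: E_def)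
  define G where "G = {gs. set gs \<subseteq> E \<and> length gs \<le> size \<kappa>}"
  have finG: "finite G" unfolding G_def by (rule finite_lists_length_le[OF finE])
  have "grafts \<kappa> \<subseteq> {gss. set gss \<subseteq> G \<and> length gss \<le> size \<kappa>} \<times> G"
  proof
    fix p :: "'y list list \<times> 'y list"
    assume "p \<in> grafts \<kappa>"
    then obtain gss fs where p: "p = (gss, fs)" and g: "fs \<noteq> []" "length gss = length fs" "[] \<notin> set gss" "mset (mult_list gss fs) = \<kappa>"
      by (auto simp: grafts_def)
    have size: "size \<kappa> = (\<Sum>gs\<leftarrow>gss. length gs)" using g length_mult_list by force
    have PE: "fs ! i \<in> E \<and> h \<in> E" if "i < length fs" "h \<in> set (gss ! i)" for i h
    proof -
      have "fs ! i * h \<in># \<kappa>" using set_mult_list[OF g(2) that] g(4) by force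
      then have "(fs ! i, h) \<in> P" by (auto simp: P_def)
      then show ?thesis unfolding E_def by force
    qed
    have "length gss = (\<Sum>gs\<leftarrow>gss. 1)" by (simp add: sum_list_triv)
    also have "\<dots> \<le> size \<kappa>" unfolding size
      using g(3) by (intro sum_list_mono) (metis Suc_leI length_greater_0_conv One_nat_def)
    finally have len: "length gss \<le> size \<kappa>" .
    have "gs \<in> G" if "gs \<in> set gss" for gs
      using that PE g(2) member_le_sum_list[of "length gs" "map length gss"] size
      by (auto simp: G_def in_set_conv_nth)
    moreover have "fs \<in> G"
    proof -
      \<comment> \<open>A root entry is recognised as a left factor through some element of its
        block, so the block must be nonempty.\<close>
      have "fs ! i \<in> E" if "i < length fs" for i
      proof -
        have "gss ! i \<noteq> []" using g(2,3) that by (metis nth_mem)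
        then show ?thesis using PE[OF that] by (meson list.set_sel(1))
      qed
      then show ?thesis using len g(2) by (auto simp: G_def in_set_conv_nth)
    qed
    ultimately show "p \<in> {gss. set gss \<subseteq> G \<and> length gss \<le> size \<kappa>} \<times> G"
      using len unfolding p by auto
  qed
  then show ?thesis by (rule finite_subset) (intro finite_cartesian_product finite_lists_length_le finG)
qed

lemma finite_fibre_lev2:
  "finite {x \<in> obj (lev2 :: ((unit, 'y list) lev, (unit, 'y srarr) levarr) gpd). hom lev1 (ob compose_levels x) (Op l) \<noteq> {}}"
  unfolding fibre_lev2 by (intro finite_imageI finite_grafts)

lemma incidence_bar: "incidence (bar (Yop :: (unit, unit, 'y list, 'y srarr) operad))"
proof (rule incidence.intro)
  show "groupoid (simplices (bar (Yop :: (unit, unit, 'y list, 'y srarr) operad)) 0)"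
    unfolding bar_simps by (intro groupoid_Sr groupoid_relabel groupoid_discrete) simp_all
  show "groupoid (simplices (bar (Yop :: (unit, unit, 'y list, 'y srarr) operad)) 1)"
    unfolding bar_simps by (intro groupoid_Sr groupoid_lev1)
  show "groupoid (simplices (bar (Yop :: (unit, unit, 'y list, 'y srarr) operad)) 2)"
    unfolding bar_simps by (intro groupoid_Sr groupoid_lev2)
  fix x y show "finite (hom (simplices (bar (Yop :: (unit, unit, 'y list, 'y srarr) operad)) 1) x y)"
    unfolding bar_simps by (intro finite_hom_Sr finite_hom_lev1)
next
  have "finite (hom (discrete UNIV :: (unit, unit) gpd) x y)" for x y by simp
  then show "finite (aut (simplices (bar (Yop :: (unit, unit, 'y list, 'y srarr) operad)) 0) z)" for z
    unfolding bar_simps aut_def by (intro finite_hom_Sr finite_hom_relabel) simp_all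
next
  fix t show "finite (aut (simplices (bar (Yop :: (unit, unit, 'y list, 'y srarr) operad)) 2) t)"
    unfolding bar_simps aut_def by (intro finite_hom_Sr finite_hom_lev2)
next
  fix f assume "f \<in> obj (simplices (bar (Yop :: (unit, unit, 'y list, 'y srarr) operad)) 1)"
  then have ne: "f \<noteq> []" and f: "set f \<subseteq> obj lev1" 
    unfolding bar_simps by (auto simp only: Sr_simps mem_Collect_eq)
  have "finite {x \<in> obj (Sr lev2). hom (Sr lev1) (map (ob compose_levels) x) f \<noteq> {}}"
    using ne
  proof (rule finite_Sr_fibre)
    fix c assume "c \<in> set f"
    then have "c \<in> obj lev1" using f by blast
    then obtain l where "c = Op l" by (auto simp only: obj_lev1)
    then show "finite {x \<in> obj lev2. hom lev1 (ob compose_levels x) c \<noteq> {}}"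
      by (simp only: finite_fibre_lev2)
  qed
  then show "finite {x \<in> obj (simplices (bar Yop) 2). hom (simplices (bar Yop) 1) (ob (face (bar Yop) 2 1) x) f \<noteq> {}}"
    unfolding bar_simps by (simp only: Sr_map_def gfun.simps)
  have "finite {x \<in> obj (Sr (relabel gCol (discrete UNIV))). hom (Sr lev1) (map (ob (gOp \<odot> unt Yop \<odot> ginv gCol)) x) f \<noteq> {}}"
    using ne by (rule finite_Sr_fibre) simp
  then show "finite {x \<in> obj (simplices (bar Yop) 0). hom (simplices (bar Yop) 1) (ob (degen (bar Yop) 0 0) x) f \<noteq> {}}"
    unfolding bar_simps by (simp only: Sr_map_def gfun.simps)
qed (rule gfunctor_faces gfunctor_degen, assumption?)+

end

lemma prod_list_sum:
  fixes w :: "'x \<Rightarrow> 'f \<Rightarrow> 'r::comm_semiring_1"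
  shows "(\<Prod>f\<leftarrow>fs. \<Sum>x\<in>S f. w x f) = (\<Sum>xs\<in>lists_in (map S fs). prod_list (map2 w xs fs))"
proof (induction fs)
  case (Cons f fs)
  then show ?case
    by (simp add: sum_lists_in_Cons sum_distrib_left sum_distrib_right) (rule sum.swap)
qed simp

section \<open>Isomorphism classes of 1-simplices\<close>

lemma obj_Sr_lev1: "xs \<in> obj (Sr lev1) \<longleftrightarrow> (\<exists>ls. ls \<noteq> [] \<and> [] \<notin> set ls \<and> xs = map Op ls)"
proof
  assume xs: "xs \<in> obj (Sr lev1)"
  then have s: "Op (inv Op x) = x" "[] \<noteq> inv Op x" if "x \<in> set xs" for x
    using that obj_lev1_D[of x] by auto
  then have "map Op (map (inv Op) xs) = xs" "[] \<notin> set (map (inv Op) xs)"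
    by (auto intro!: map_idI)
  then show "\<exists>ls. ls \<noteq> [] \<and> [] \<notin> set ls \<and> xs = map Op ls"
    using xs by (intro exI[of _ "map (inv Op) xs"]) auto
next
  assume "\<exists>ls. ls \<noteq> [] \<and> [] \<notin> set ls \<and> xs = map Op ls"
  then show "xs \<in> obj (Sr lev1)" by auto
qed

lemma type_of_tuple_map_Op [simp]: "type_of_tuple (map Op ls) = mset (map mset ls)"
  by (simp add: type_of_tuple_def o_def)

lemma type_of_tuple_append: "type_of_tuple (xs @ ys) = type_of_tuple xs + type_of_tuple ys"
  by (simp add: type_of_tuple_def)

lemma type_of_tuple_Cons: "type_of_tuple (x # xs) = {#mset (inv Op x)#} + type_of_tuple xs"
  by (simp add: type_of_tuple_def)

lemma type_of_tuple_Nil: "type_of_tuple [] = {#}"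
  by (simp add: type_of_tuple_def)

lemma type_in_monomials:
  assumes "xs \<in> obj (Sr lev1)"
  shows "type_of_tuple xs \<in> monomials" "type_of_tuple xs \<noteq> {#}"
  using assms unfolding obj_Sr_lev1 by (auto simp: monomials_def Lambda_def)

lemma ex_tuple_of_type:
  assumes "M \<in> monomials" "M \<noteq> {#}"
  obtains xs where "xs \<in> obj (Sr lev1)" "type_of_tuple xs = M"
proof -
  obtain ms where ms: "mset ms = M" using ex_mset by blast
  have "\<forall>\<mu>. \<exists>l. mset l = \<mu>" using ex_mset by blast
  then obtain g where g: "\<And>\<mu>. mset (g \<mu>) = (\<mu> :: 'a multiset)" by metis
  have "map Op (map g ms) \<in> obj (Sr lev1)"
    unfolding obj_Sr_lev1
  proof (intro exI conjI)
    show "map g ms \<noteq> []" using ms assms by auto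
    show "[] \<notin> set (map g ms)"
    proof
      assume "[] \<in> set (map g ms)"
      then obtain \<mu> where "\<mu> \<in># M" "g \<mu> = []" using ms by auto
      then show False using g[of \<mu>] assms(1) by (auto simp: monomials_def Lambda_def)
    qed
  qed simp
  moreover have "type_of_tuple (map Op (map g ms)) = M"
    unfolding type_of_tuple_map_Op using ms g by (simp add: o_def)
  ultimately show ?thesis using that by blast
qed

definition tuple_class :: "'y::monoid_mult monom \<Rightarrow> (unit, 'y list) lev list set" where
  "tuple_class M = {xs \<in> obj (Sr lev1). type_of_tuple xs = M}"

lemma iso_class_bar:
  assumes "xs \<in> obj (Sr lev1)"
  shows "iso_rel (simplices (bar Yop) 1) `` {xs} = tuple_class (type_of_tuple xs)"
proof (rule set_eqI)
  fix ys
  show "ys \<in> iso_rel (simplices (bar Yop) 1) `` {xs} \<longleftrightarrow> ys \<in> tuple_class (type_of_tuple xs)"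
  proof (cases "ys \<in> obj (Sr lev1)")
    case True
    from hom_Sr_lev1_nonempty[OF assms True] show ?thesis
      using assms True unfolding bar_simps iso_rel_def tuple_class_def
      by (simp only: Image_singleton_iff mem_Collect_eq prod.case) metis
  next
    case False
    then show ?thesis unfolding bar_simps iso_rel_def tuple_class_def by blast
  qed
qed

text \<open>Tuples are nonempty, so the monomial \<open>{#}\<close> is the type of none of them. Its
  place is taken by the adjoined unit of the incidence bialgebra.\<close>

lemma pi0_bar: "pi0 (simplices (bar Yop) 1) = tuple_class ` (monomials - {{#}})"
proof (intro set_eqI iffI)
  fix C :: "(unit, 'a list) lev list set"
  assume "C \<in> pi0 (simplices (bar Yop) 1)"
  then obtain xs where xs: "xs \<in> obj (Sr lev1)" "C = iso_rel (simplices (bar Yop) 1) `` {xs}"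
    unfolding pi0_def by (auto elim!: quotientE simp only: bar_simps)
  then show "C \<in> tuple_class ` (monomials - {{#}})"
    using iso_class_bar[OF xs(1)] type_in_monomials[OF xs(1)] by blast
next
  fix C :: "(unit, 'a list) lev list set"
  assume "C \<in> tuple_class ` (monomials - {{#}})"
  then obtain M where M: "M \<in> monomials" "M \<noteq> {#}" "C = tuple_class M" by blast
  then obtain xs where xs: "xs \<in> obj (Sr lev1)" "type_of_tuple xs = M" using ex_tuple_of_type by blast
  then have "C = iso_rel (simplices (bar Yop) 1) `` {xs}" using iso_class_bar[OF xs(1)] M by simp
  then show "C \<in> pi0 (simplices (bar Yop) 1)"
    unfolding pi0_def using xs(1) by (auto intro!: quotientI simp only: bar_simps)
qed

text \<open>The representative is an arbitrary choice, but its type is known, and the coefficients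
  computed below depend on the type alone.\<close>

lemma rep_tuple_class:
  assumes "M \<in> monomials" "M \<noteq> {#}"
  shows "rep (tuple_class M) \<in> obj (Sr lev1)" "type_of_tuple (rep (tuple_class M)) = M"
proof -
  have "tuple_class M \<noteq> {}" using ex_tuple_of_type[OF assms] by (auto simp only: tuple_class_def)
  then have "rep (tuple_class M) \<in> tuple_class M" unfolding rep_def by (simp add: some_in_eq)
  then show "rep (tuple_class M) \<in> obj (Sr lev1)" "type_of_tuple (rep (tuple_class M)) = M"
    unfolding tuple_class_def by blast+
qed

lemma inj_on_tuple_class: "inj_on tuple_class (monomials - {{#}})"
  by (rule inj_on_inverseI[of _ "type_of_tuple \<circ> rep"]) (simp add: rep_tuple_class)

section \<open>Coefficients of the comultiplication and the counit for the bar construction\<close>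

definition lev2_type :: "(unit, 'y list) lev \<Rightarrow> 'y monom \<times> 'y monom" where
  "lev2_type x = (type_of_tuple (fst (inv Graft x)), {#mset (snd (inv Graft x))#})"

definition lev2_weight :: "(unit, 'y::monoid_mult list) lev \<Rightarrow> (unit, 'y list) lev \<Rightarrow> rat" where
  "lev2_weight x f = of_nat (card (hom lev1 (ob compose_levels x) f)) / of_nat (card (star lev2 x))"

lemma graft_poly_lev2:
  "graft_poly (mset l) = (\<Sum>x\<in>{x \<in> obj lev2. hom lev1 (ob compose_levels x) (Op l) \<noteq> {}}.
     Poly_Mapping.single (lev2_type x) (lev2_weight x (Op l)))"
proof -
  have inj: "inj_on (\<lambda>(gss, fs). Graft (map Op gss, fs)) S" for S :: "('a list list \<times> 'a list) set"
    by (auto simp: inj_on_def)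
  show ?thesis
    unfolding fibre_lev2 sum.reindex[OF inj] graft_poly_def
  proof (rule sum.cong[OF refl])
    fix p assume p: "p \<in> grafts (mset l)"
    obtain gss fs where pe: "p = (gss, fs)" by (rule prod.exhaust)
    from p have g: "fs \<noteq> []" "length gss = length fs" "[] \<notin> set gss" and m: "mset (mult_list gss fs) = mset l"
      by (auto simp: grafts_def pe)
    have t: "lev2_type (Graft (map Op gss, fs)) = graft_type p"
      by (simp add: lev2_type_def graft_type_def pe)
    have "lev2_weight (Graft (map Op gss, fs)) (Op l) = graft_weight (mset l) p"
      unfolding lev2_weight_def graft_weight_def pe ob_compose_levels
        card_hom_lev1[OF mult_list_nonempty[OF g] m] card_star_lev2[OF g]
      by (simp add: of_nat_prod_list o_def)
    with t show "Poly_Mapping.single (graft_type p) (graft_weight (mset l) p)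
      = ((\<lambda>x. Poly_Mapping.single (lev2_type x) (lev2_weight x (Op l))) \<circ> (\<lambda>(gss, fs). Graft (map Op gss, fs))) p"
      by (simp add: pe)
  qed
qed

text \<open>The right side holds the types of \<open>d\<^sub>2 xs\<close> and
  \<open>d\<^sub>0 xs\<close>. Written as a sum over the entries, the condition on the outer faces
  becomes a condition on exponents in a product.\<close>

lemma sum_list_lev2_type:
  "(\<Sum>x\<leftarrow>xs. lev2_type x) = (type_of_tuple (concat (map (\<lambda>x. fst (inv Graft x)) xs)),
     type_of_tuple (map (\<lambda>x. Op (snd (inv Graft x))) xs))"
  by (induction xs) (simp_all add: type_of_tuple_Nil type_of_tuple_Cons type_of_tuple_append lev2_type_def zero_prod_def)

context
  assumes locally_finite: "\<And>m :: 'y::monoid_mult. finite {(n, k). m = n * k}"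
begin

text \<open>By \<open>sum_Sr_hom\<close> the sum over 2-simplices runs over one tree for each entry
  of \<open>ls\<close>, weighted by the product of the single weights and restricted to a total
  type; by \<open>prod_list_sum_single\<close> this is a coefficient of a product.\<close>

lemma section_coeff_bar:
  fixes ls :: "'y list list"
  assumes ls: "ls \<noteq> []" "[] \<notin> set ls" and a: "a \<in> obj (Sr lev1)" and b: "b \<in> obj (Sr lev1)"
  shows "section_coeff (bar Yop) (map Op ls) a b
    = Poly_Mapping.lookup (\<Prod>l\<leftarrow>ls. graft_poly (mset l)) (type_of_tuple a, type_of_tuple b)"
proof -
  interpret incidence "bar (Yop :: (unit, unit, 'y list, 'y srarr) operad)"
    using locally_finite by (rule incidence_bar)
  let ?ch = "\<lambda>x :: (unit, 'y list) lev. fst (inv Graft x)" and ?rt = "\<lambda>x. Op (snd (inv Graft x))"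
  \<comment> \<open>The indicator that the outer faces are isomorphic to \<open>a\<close> and
    \<open>b\<close>. As a condition on the sum of the entry types it is invariant under
    permutations, as \<open>sum_Sr_hom\<close> demands.\<close>
  define h :: "(unit, 'y list) lev list \<Rightarrow> rat" where
    "h xs = (if (\<Sum>x\<leftarrow>xs. lev2_type x) = (type_of_tuple a, type_of_tuple b) then 1 else 0)" for xs
  have f: "map Op ls \<in> obj (simplices (bar Yop) 1)" unfolding bar_simps obj_Sr_lev1 using ls by blast
  have "section_coeff (bar Yop) (map Op ls) a b
    = (\<Sum>x | x \<in> obj (Sr lev2) \<and> hom (Sr lev1) (map (ob compose_levels) x) (map Op ls) \<noteq> {}.
       h x * (of_nat (card (hom (Sr lev1) (map (ob compose_levels) x) (map Op ls))) / of_nat (card (star (Sr lev2) x))))"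
  proof -
    have "(if hom (Sr lev1) (ob (face (bar Yop) 2 2) x) a \<noteq> {} \<and> hom (Sr lev1) (ob (face (bar Yop) 2 0) x) b \<noteq> {}
        then 1 else 0) = h x" if x: "x \<in> obj (Sr lev2)" for x
    proof -
      have o: "ob (face (bar Yop) 2 i) x \<in> obj (Sr lev1)" if "i \<le> 2" for i
        using gfunctor.ob_obj[OF face_functor[OF that], of x] x by (simp only: bar_simps)
      have "ob (face (bar Yop) 2 2) x = concat (map ?ch x)" "ob (face (bar Yop) 2 0) x = map ?rt x"
        unfolding bar_simps by (simp_all add: Sr_map_def Sr_mult_def gcomp_def gfst_def gsnd_def ginv_def o_def)
      then show ?thesis
        using hom_Sr_lev1_nonempty[OF o a, of 2] hom_Sr_lev1_nonempty[OF o b, of 0]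
        by (simp only: h_def sum_list_lev2_type prod.inject le_refl zero_le simp_thms)
    qed
    then show ?thesis
      unfolding section_coeff_eq_sum[OF f a[folded bar_simps] b[folded bar_simps]] bar_simps(2,3,5)
      by (intro sum.cong) (simp_all only: Sr_map_def gfun.simps mem_Collect_eq)
  qed
  also have "\<dots> = (\<Sum>xs\<in>lists_in (map (\<lambda>f. {x \<in> obj lev2. hom lev1 (ob compose_levels x) f \<noteq> {}}) (map Op ls)).
      h xs * prod_list (map2 lev2_weight xs (map Op ls)))"
  proof (rule sum_Sr_hom)
    show "map Op ls \<noteq> []" using ls by simp
    show "finite (hom lev1 x y)" for x y :: "(unit, 'y list) lev" by (rule finite_hom_lev1)
    show "lev2_weight x f = of_nat (card (hom lev1 (ob compose_levels x) f)) / of_nat (card (star lev2 x))" for x f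
      by (rule lev2_weight_def)
    show "finite {x \<in> obj lev2. hom lev1 (ob compose_levels x) f \<noteq> {}}" if "f \<in> set (map Op ls)" for f
      using that finite_fibre_lev2[OF locally_finite] by (auto simp only: set_map)
    show "h (permute_list \<sigma> xs) = h xs" if "\<sigma> permutes {..<length xs}" for \<sigma> xs
    proof -
      have "(\<Sum>x\<leftarrow>permute_list \<sigma> xs. lev2_type x) = (\<Sum>x\<leftarrow>xs. lev2_type x)"
        using that by (simp flip: sum_mset_sum_list)
      then show ?thesis by (simp only: h_def)
    qed
  qed
  also have "\<dots> = Poly_Mapping.lookup (\<Prod>f\<leftarrow>map Op ls. \<Sum>x\<in>{x \<in> obj lev2. hom lev1 (ob compose_levels x) f \<noteq> {}}.
      Poly_Mapping.single (lev2_type x) (lev2_weight x f)) (type_of_tuple a, type_of_tuple b)"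
    unfolding prod_list_sum_single lookup_sum
    by (intro sum.cong refl) (simp add: h_def lookup_single when_def)
  also have "\<dots> = Poly_Mapping.lookup (\<Prod>l\<leftarrow>ls. graft_poly (mset l)) (type_of_tuple a, type_of_tuple b)"
    by (simp only: map_map o_def graft_poly_lev2)
  finally show ?thesis .
qed

text \<open>The averaging over permutations is applied with the constant function 1. The unit
  operation is the one-element list of the neutral element, so an entry contributes only if its
  multiset is \<open>{#1#}\<close>, and then exactly 1.\<close>

lemma hcard_degen_bar:
  fixes ls :: "'y list list"
  assumes ls: "ls \<noteq> []" "[] \<notin> set ls"
  shows "hcard (hofib (simplices (bar Yop) 0) (simplices (bar Yop) 1) (degen (bar Yop) 0 0) (map Op ls))
    = (\<Prod>l\<leftarrow>ls. if mset l = {#1#} then 1 else 0)"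
proof -
  interpret incidence "bar (Yop :: (unit, unit, 'y list, 'y srarr) operad)"
    using locally_finite by (rule incidence_bar)
  let ?L = "relabel gCol (discrete UNIV) :: ((unit, 'y list) lev, (unit, 'y srarr) levarr) gpd"
  let ?D = "ob (gOp \<odot> unt Yop \<odot> ginv gCol ::
      ((unit, 'y list) lev, (unit, 'y srarr) levarr, (unit, 'y list) lev, (unit, 'y srarr) levarr) gfun)"
  let ?H = "hofib (simplices (bar Yop) 0) (simplices (bar Yop) 1) (degen (bar Yop) 0 0) (map Op ls)"
  let ?T = "{x. x \<in> obj (Sr ?L) \<and> hom (Sr lev1) (map ?D x) (map Op ls) \<noteq> {}}"
  define w :: "(unit, 'y list) lev \<Rightarrow> (unit, 'y list) lev \<Rightarrow> rat" where
    "w x f = of_nat (card (hom lev1 (?D x) f)) / of_nat (card (star ?L x))" for x f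
  have f: "map Op ls \<in> obj (simplices (bar Yop) 1)" unfolding bar_simps obj_Sr_lev1 using ls by blast
  have D: "?D = (\<lambda>_. Op [1])" by (simp add: gcomp_def Yop_simps o_def)
  have one: "hom lev1 (Op [1]) (Op l) \<noteq> {} \<longleftrightarrow> mset l = {#1#}" for l :: "'y list"
    by (subst hom_lev1_nonempty) auto
  have S: "{x \<in> obj ?L. hom lev1 (?D x) (Op l) \<noteq> {}} = (if mset l = {#1#} then {Col ()} else {})" for l
    unfolding D one by auto
  have wS: "(\<Sum>x\<in>{x \<in> obj ?L. hom lev1 (?D x) (Op l) \<noteq> {}}. w x (Op l)) = (if mset l = {#1#} then 1 else 0)" for l
  proof -
    have "star ?L (Col ()) = ColA ` star (discrete UNIV) ()"
      using star_relabel[of "gCol :: (unit, unit, (unit, 'y list) lev, (unit, 'y srarr) levarr) gfun"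
          "discrete UNIV" "()"] by simp
    also have "star (discrete UNIV) () = {()}" by (auto simp: star_def)
    finally have "card (star ?L (Col ())) = 1" by simp
    moreover have "card (hom lev1 (Op [1]) (Op l)) = 1" if "mset l = {#1#}"
      using that card_hom_lev1[of "[1]" l] by (simp add: mset_fact_def)
    ultimately show ?thesis unfolding S by (simp add: w_def D)
  qed
  have "hcard ?H = (\<Sum>p\<in>obj ?H. 1 / of_nat (card (star ?H p)))"
    by (intro groupoid.hcard_eq_sum_star groupoid_hofib X0 X1 degen_functor homotopy_finite_counit f)
  also have "\<dots> = (\<Sum>p\<in>obj ?H. 1 / of_nat (card (star (Sr ?L) (fst p))))"
  proof (rule sum.cong[OF refl])
    fix p assume p: "p \<in> obj ?H"
    obtain x u where pe: "p = (x, u)" by (rule prod.exhaust)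
    have "card (star ?H p) = card (star (simplices (bar Yop) 0) x)"
      using p unfolding pe by (intro card_star_hofib X0 X1 degen_functor)
    then show "1 / of_nat (card (star ?H p)) = (1 / of_nat (card (star (Sr ?L) (fst p))) :: rat)"
      unfolding pe bar_simps by simp
  qed
  also have "obj ?H = (SIGMA x:?T. hom (Sr lev1) (map ?D x) (map Op ls))"
    unfolding hofib_simps bar_simps Sr_map_def gfun.simps by blast
  also have "(\<Sum>p\<in>(SIGMA x:?T. hom (Sr lev1) (map ?D x) (map Op ls)). 1 / of_nat (card (star (Sr ?L) (fst p))))
    = (\<Sum>x\<in>?T. \<Sum>u\<in>hom (Sr lev1) (map ?D x) (map Op ls). 1 / of_nat (card (star (Sr ?L) x)) :: rat)"
  proof (subst sum.Sigma)
    show "finite ?T" using finite_fibre0[OF f] unfolding bar_simps Sr_map_def gfun.simps .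
    show "\<forall>x\<in>?T. finite (hom (Sr lev1) (map ?D x) (map Op ls))"
      by (intro ballI finite_hom_Sr finite_hom_lev1)
  qed (simp add: case_prod_unfold)
  also have "\<dots> = (\<Sum>x\<in>?T. 1 * (of_nat (card (hom (Sr lev1) (map ?D x) (map Op ls))) / of_nat (card (star (Sr ?L) x))))"
    by (simp only: sum_constant times_divide_eq_right mult_1_right mult_1_left)
  also have "\<dots> = (\<Sum>xs\<in>lists_in (map (\<lambda>f. {x \<in> obj ?L. hom lev1 (?D x) f \<noteq> {}}) (map Op ls)).
      1 * prod_list (map2 w xs (map Op ls)))"
  proof (rule sum_Sr_hom)
    show "map Op ls \<noteq> []" using ls by simp
    show "finite (hom lev1 x y)" for x y :: "(unit, 'y list) lev" by (rule finite_hom_lev1)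
    show "finite {x \<in> obj ?L. hom lev1 (?D x) f \<noteq> {}}" if "f \<in> set (map Op ls)" for f
      using that S by auto
  qed (simp_all only: w_def)
  also have "\<dots> = (\<Prod>f\<leftarrow>map Op ls. \<Sum>x\<in>{x \<in> obj ?L. hom lev1 (?D x) f \<noteq> {}}. w x f)"
    by (simp only: mult_1_left prod_list_sum)
  also have "\<dots> = (\<Prod>l\<leftarrow>ls. if mset l = {#1#} then 1 else 0)"
    by (simp only: map_map o_def wS)
  finally show ?thesis .
qed

end

section \<open>Plethysm as a sum over grafts\<close>

definition lin_fun :: "('b \<Rightarrow> rat) \<Rightarrow> ('b \<Rightarrow>\<^sub>0 rat) \<Rightarrow> rat" where
  "lin_fun \<phi> p = (\<Sum>k\<in>Poly_Mapping.keys p. Poly_Mapping.lookup p k * \<phi> k)"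

lemma lin_fun_superset:
  assumes "finite S" "Poly_Mapping.keys p \<subseteq> S"
  shows "lin_fun \<phi> p = (\<Sum>k\<in>S. Poly_Mapping.lookup p k * \<phi> k)"
  unfolding lin_fun_def using assms by (intro sum.mono_neutral_left) (auto simp: in_keys_iff)

lemma lin_fun_add: "lin_fun \<phi> (p + q) = lin_fun \<phi> p + lin_fun \<phi> q"
proof -
  let ?S = "Poly_Mapping.keys p \<union> Poly_Mapping.keys q"
  have "lin_fun \<phi> (p + q) = (\<Sum>k\<in>?S. Poly_Mapping.lookup (p + q) k * \<phi> k)"
    by (rule lin_fun_superset) (simp_all add: keys_add)
  also have "\<dots> = lin_fun \<phi> p + lin_fun \<phi> q"
    by (simp add: lin_fun_superset[of ?S] lookup_add distrib_right sum.distrib)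
  finally show ?thesis .
qed

lemma lin_fun_single [simp]: "lin_fun \<phi> (Poly_Mapping.single k c) = c * \<phi> k"
  by (simp add: lin_fun_def)

lemma lin_fun_zero [simp]: "lin_fun \<phi> 0 = 0"
  by (simp add: lin_fun_def)

lemma lin_fun_sum: "lin_fun \<phi> (\<Sum>x\<in>S. f x) = (\<Sum>x\<in>S. lin_fun \<phi> (f x))"
  by (induction S rule: infinite_finite_induct) (simp_all add: lin_fun_add)

lemma eval_tensor_lin_fun:
  "eval_tensor D F G = lin_fun (\<lambda>(M, N). eval_monom M F * eval_monom N G) D"
  by (simp add: eval_tensor_def lin_fun_def case_prod_unfold mult.assoc)

lemma mset_fact_nonzero [simp]: "mset_fact \<mu> \<noteq> 0"
  by (simp add: mset_fact_def)

lemma sum_mset_of_list: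
  fixes \<phi> :: "'v multiset \<Rightarrow> rat"
  assumes "finite S"
  shows "(\<Sum>\<mu>\<in>S. \<phi> \<mu>)
    = (\<Sum>l | mset l \<in> S. of_nat (mset_fact (mset l)) / fact (length l) * \<phi> (mset l))"
proof -
  have "(\<Sum>l | mset l \<in> S. of_nat (mset_fact (mset l)) / fact (length l) * \<phi> (mset l))
    = (\<Sum>\<mu>\<in>S. \<Sum>l\<in>permutations_of_multiset \<mu>. of_nat (mset_fact (mset l)) / fact (length l) * \<phi> (mset l))"
  proof -
    have "{l. mset l \<in> S} = (\<Union>\<mu>\<in>S. permutations_of_multiset \<mu>)"
      by (auto simp: permutations_of_multiset_def)
    show ?thesis unfolding \<open>{l. mset l \<in> S} = _\<close>
    \<comment> \<open>A list determines its multiset, so the orderings of different multisets are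
      disjoint.\<close>
    proof (rule sum.UNION_disjoint[OF assms])
      show "\<forall>\<mu>\<in>S. \<forall>\<nu>\<in>S. \<mu> \<noteq> \<nu> \<longrightarrow> permutations_of_multiset \<mu> \<inter> permutations_of_multiset \<nu> = {}"
        by (auto simp: permutations_of_multiset_def)
    qed simp
  qed
  also have "\<dots> = (\<Sum>\<mu>\<in>S. \<phi> \<mu>)"
  proof (rule sum.cong[OF refl])
    fix \<mu> :: "'v multiset"
    have c: "of_nat (card (permutations_of_multiset \<mu>)) * of_nat (mset_fact \<mu>) = (fact (size \<mu>) :: rat)"
      using card_permutations_of_multiset_aux[of \<mu>] unfolding mset_fact_def by (metis of_nat_fact of_nat_mult)
    have "(\<Sum>l\<in>permutations_of_multiset \<mu>. of_nat (mset_fact (mset l)) / fact (length l) * \<phi> (mset l))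
      = (\<Sum>l\<in>permutations_of_multiset \<mu>. of_nat (mset_fact \<mu>) / fact (size \<mu>) * \<phi> \<mu>)"
      by (intro sum.cong refl) (auto simp: permutations_of_multiset_def)
    also have "\<dots> = of_nat (card (permutations_of_multiset \<mu>)) * of_nat (mset_fact \<mu>) / fact (size \<mu>) * \<phi> \<mu>"
      by simp
    finally show "(\<Sum>l\<in>permutations_of_multiset \<mu>. of_nat (mset_fact (mset l)) / fact (length l) * \<phi> (mset l)) = \<phi> \<mu>"
      unfolding c by simp
  qed
  finally show ?thesis by simp
qed

lemma mcoeff_Abs_mps [simp]: "mcoeff (Abs_mps f) = f"
  by (simp add: Abs_mps_inverse)

lemma mcoeff_Var_times:
  "mcoeff (Var v * H) \<kappa> = (if v \<in># \<kappa> then mcoeff H (\<kappa> - {#v#}) else 0)"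
proof -
  have "mcoeff (Var v * H) \<kappa> = (\<Sum>\<mu> | \<mu> \<subseteq># \<kappa>. if \<mu> = {#v#} then mcoeff H (\<kappa> - {#v#}) else 0)"
    unfolding times_mps.rep_eq Var_def by (intro sum.cong) auto
  also have "\<dots> = (if v \<in># \<kappa> then mcoeff H (\<kappa> - {#v#}) else 0)"
    by (simp add: finite_submultisets)
  finally show ?thesis .
qed

lemma mcoeff_prod_Var:
  "mcoeff (\<Prod>n\<in>#\<mu>. Var (h n)) \<kappa> = (if image_mset h \<mu> = \<kappa> then 1 else 0 :: rat)"
proof (induction \<mu> arbitrary: \<kappa>)
  case empty
  then show ?case by (simp add: one_mps.rep_eq)
next
  case (add n \<mu>)
  have "image_mset h \<mu> = \<kappa> - {#h n#} \<and> h n \<in># \<kappa> \<longleftrightarrow> add_mset (h n) (image_mset h \<mu>) = \<kappa>"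
    by (auto simp: insert_DiffM)
  then show ?case by (auto simp: mcoeff_Var_times add)
qed

lemma prod_mset_mset: "(\<Prod>m\<in>#mset fs. h m) = prod_list (map h fs)"
  by (simp flip: prod_mset_prod_list)

lemma coord_empty: "F \<in> no_const \<Longrightarrow> coord {#} F = 0"
  by (simp add: no_const_def coord_def)

definition factor_lists :: "'y::monoid_mult list \<Rightarrow> 'y multiset \<Rightarrow> 'y list list set" where
  "factor_lists fs \<kappa> = {gss. length gss = length fs \<and> [] \<notin> set gss \<and> mset (mult_list gss fs) = \<kappa>}"

lemma eval_monom_graft:
  "eval_monom (mset (map mset gss)) F = (\<Prod>gs\<leftarrow>gss. coord (mset gs) F)"
  "eval_monom {#mset fs#} G = coord (mset fs) G"
  by (simp_all add: eval_monom_def prod_mset_mset o_def del: mset_map)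

lemma keys_graft_poly:
  "Poly_Mapping.keys (graft_poly \<kappa>) \<subseteq> (monomials - {{#}}) \<times> (monomials - {{#}})"
proof -
  have "Poly_Mapping.keys (graft_poly \<kappa>) \<subseteq> graft_type ` grafts \<kappa>"
    unfolding graft_poly_def
    by (rule order_trans[OF keys_sum]) (auto split: if_splits)
  also have "\<dots> \<subseteq> (monomials - {{#}}) \<times> (monomials - {{#}})"
    by (auto simp: graft_type_def grafts_def monomials_def Lambda_def)
  finally show ?thesis .
qed

context
  assumes locally_finite: "\<And>m :: 'y::monoid_mult. finite {(n, k). m = n * k}"
begin

lemma finite_left_quotients:
  "finite {gs :: 'y list. mset (map ((*) m) gs) = \<kappa>}"
proof (rule finite_subset)
  let ?A = "snd ` (\<Union>x\<in>set_mset \<kappa>. {(n, k). x = n * k})"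
  have "finite ?A" using locally_finite by (intro finite_imageI finite_UN_I) auto
  then show "finite {gs. set gs \<subseteq> ?A \<and> length gs = size \<kappa>}" by (rule finite_lists_length_eq)
  show "{gs. mset (map ((*) m) gs) = \<kappa>} \<subseteq> {gs. set gs \<subseteq> ?A \<and> length gs = size \<kappa>}"
  proof
    fix gs :: "'y list"
    assume "gs \<in> {gs. mset (map ((*) m) gs) = \<kappa>}"
    then have \<kappa>: "\<kappa> = mset (map ((*) m) gs)" by simp
    have "g \<in> ?A" if "g \<in> set gs" for g
      by (rule image_eqI[of _ _ "(m, g)"]) (use that \<kappa> in auto)
    moreover have "length gs = size \<kappa>" by (simp add: \<kappa>)
    ultimately show "gs \<in> {gs. set gs \<subseteq> ?A \<and> length gs = size \<kappa>}" by blast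
  qed
qed

text \<open>Left multiplication by \<open>m\<close> need not be injective, so several exponents of
  \<open>F\<close> may contribute to \<open>\<kappa>\<close>; local finiteness leaves finitely many.
  Passing from exponents to lists turns coefficients into coordinates divided by a
  factorial.\<close>

lemma mcoeff_shift:
  fixes F :: "('y, rat) mps"
  assumes "F \<in> no_const"
  shows "mcoeff (shift m F) \<kappa>
    = (\<Sum>gs | gs \<noteq> [] \<and> mset (map ((*) m) gs) = \<kappa>. coord (mset gs) F / fact (length gs))"
proof -
  let ?S = "{\<mu>. image_mset ((*) m) \<mu> = \<kappa>}"
  have "?S = mset ` {gs. mset (map ((*) m) gs) = \<kappa>}"
    by (auto simp: image_iff) (metis ex_mset)
  then have fin: "finite ?S" using finite_left_quotients by simp
  have "mcoeff (shift m F) \<kappa> = Sum_any (\<lambda>\<mu>. mcoeff F \<mu> * (if image_mset ((*) m) \<mu> = \<kappa> then 1 else 0))"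
    by (simp add: shift_def mps_subst_def mcoeff_prod_Var)
  also have "\<dots> = (\<Sum>\<mu>\<in>?S. mcoeff F \<mu> * (if image_mset ((*) m) \<mu> = \<kappa> then 1 else 0))"
    by (rule Sum_any.expand_superset[OF fin]) auto
  also have "\<dots> = (\<Sum>\<mu>\<in>?S. mcoeff F \<mu>)"
    by (intro sum.cong) auto
  also have "\<dots> = (\<Sum>l | mset l \<in> ?S. of_nat (mset_fact (mset l)) / fact (length l) * mcoeff F (mset l))"
    by (rule sum_mset_of_list[OF fin])
  also have "\<dots> = (\<Sum>gs | mset (map ((*) m) gs) = \<kappa>. coord (mset gs) F / fact (length gs))"
    by (simp add: coord_def)
  \<comment> \<open>The empty list contributes the constant coefficient of \<open>F\<close>, which
    is 0. This matches the requirement that operations be nonempty tuples.\<close>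
  also have "\<dots> = (\<Sum>gs | gs \<noteq> [] \<and> mset (map ((*) m) gs) = \<kappa>. coord (mset gs) F / fact (length gs))"
    by (rule sum.mono_neutral_right[OF finite_left_quotients]) (auto simp: coord_empty[OF assms])
  finally show ?thesis .
qed

lemma finite_factor_lists: "finite (factor_lists fs (\<kappa> :: 'y multiset))"
proof (cases "fs = []")
  case True
  then have "factor_lists fs \<kappa> \<subseteq> {[]}" by (auto simp: factor_lists_def)
  then show ?thesis by (rule finite_subset) simp
next
  case False
  then have "factor_lists fs \<kappa> \<subseteq> fst ` grafts \<kappa>"
    by (force simp: factor_lists_def grafts_def image_iff)
  then show ?thesis by (rule finite_subset) (intro finite_imageI finite_grafts[OF locally_finite])
qed

text \<open>Induction on the root: the coefficient of a product splits \<open>\<kappa>\<close> into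
  the part produced by the first block and the rest.\<close>

lemma mcoeff_prod_shift:
  fixes F :: "('y, rat) mps"
  assumes F: "F \<in> no_const"
  shows "mcoeff (\<Prod>f\<leftarrow>fs. shift f F) \<kappa>
    = (\<Sum>gss\<in>factor_lists fs \<kappa>. \<Prod>gs\<leftarrow>gss. coord (mset gs) F / fact (length gs))"
proof (induction fs arbitrary: \<kappa>)
  case Nil
  have "factor_lists [] \<kappa> = (if \<kappa> = {#} then {[]} else {})"
    by (auto simp: factor_lists_def mult_list_def)
  then show ?case by (simp add: one_mps.rep_eq)
next
  case (Cons f fs)
  let ?c = "\<lambda>gs. coord (mset gs) F / fact (length gs)"
  let ?G = "\<lambda>\<mu>. {gs. gs \<noteq> [] \<and> mset (map ((*) f) gs) = \<mu>}"
  have finG: "finite (?G \<mu>)" for \<mu>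
    by (rule finite_subset[OF _ finite_left_quotients[of f \<mu>]]) auto
  have "mcoeff (\<Prod>f\<leftarrow>f # fs. shift f F) \<kappa>
    = (\<Sum>\<mu> | \<mu> \<subseteq># \<kappa>. (\<Sum>gs\<in>?G \<mu>. ?c gs) * (\<Sum>gss\<in>factor_lists fs (\<kappa> - \<mu>). \<Prod>gs\<leftarrow>gss. ?c gs))"
    by (simp add: times_mps.rep_eq mcoeff_shift[OF F] Cons)
  also have "\<dots> = (\<Sum>\<mu> | \<mu> \<subseteq># \<kappa>. \<Sum>(gs, gss)\<in>?G \<mu> \<times> factor_lists fs (\<kappa> - \<mu>). ?c gs * (\<Prod>gs\<leftarrow>gss. ?c gs))"
    by (simp add: sum_product sum.cartesian_product)
  also have "\<dots> = (\<Sum>(\<mu>, gs, gss)\<in>(SIGMA \<mu>:{\<mu>. \<mu> \<subseteq># \<kappa>}. ?G \<mu> \<times> factor_lists fs (\<kappa> - \<mu>)). ?c gs * (\<Prod>gs\<leftarrow>gss. ?c gs))"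
    by (rule sum.Sigma) (simp_all add: finite_submultisets finite_factor_lists finG del: mset_map)
  also have "\<dots> = (\<Sum>gss\<in>factor_lists (f # fs) \<kappa>. \<Prod>gs\<leftarrow>gss. ?c gs)"
  \<comment> \<open>The part \<open>\<mu>\<close> is determined by the first block
    \<open>gs\<close>, being the multiset of the products of \<open>f\<close> with its entries; so
    it disappears from the index set.\<close>
  proof (rule sum.reindex_bij_witness[of _ "\<lambda>gss. (mset (map ((*) f) (hd gss)), hd gss, tl gss)" "\<lambda>(\<mu>, gs, gss). gs # gss"],
      goal_cases)
    case (1 a)
    then show ?case by auto
  next
    case (2 a)
    then show ?case by (auto simp: factor_lists_def mult_list_def)
  next
    case (3 b)
    then show ?case by (cases b) (auto simp: factor_lists_def)
  next
    case (4 b)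
    then show ?case by (cases b) (auto simp: factor_lists_def mult_list_def)
  next
    case (5 a)
    then show ?case by auto
  qed
  finally show ?case .
qed

text \<open>Expanding \<open>G\<close> over root lists gives the factorial of the length of
  \<open>fs\<close>, the shifted copies of \<open>F\<close> give those of the blocks, and
  \<open>mset_fact \<kappa>\<close> is the normalisation of the coordinate on the left. As
  \<open>\<kappa>\<close> is nonempty, the empty root cannot occur.\<close>

lemma coord_plethysm:
  fixes F G :: "('y, rat) mps"
  assumes F: "F \<in> no_const" and \<kappa>: "\<kappa> \<noteq> {#}"
  shows "coord \<kappa> (G \<circledast> F) = (\<Sum>(gss, fs)\<in>grafts \<kappa>.
    graft_weight \<kappa> (gss, fs) * (\<Prod>gs\<leftarrow>gss. coord (mset gs) F) * coord (mset fs) G)"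
proof -
  let ?c = "\<lambda>gs. coord (mset gs) F / fact (length gs)"
  \<comment> \<open>The finitely many exponents of \<open>G\<close> that can contribute at
    \<open>\<kappa>\<close>; outside this set no choice of blocks has composite
    \<open>\<kappa>\<close>.\<close>
  let ?S = "(\<lambda>(gss, fs). mset fs) ` grafts \<kappa>"
  let ?T = "{fs. mset fs \<in> ?S}"
  have finS: "finite ?S" using finite_grafts[OF locally_finite] by simp
  have finT: "finite ?T"
  proof -
    have "?T = (\<Union>\<mu>\<in>?S. permutations_of_multiset \<mu>)" by (auto simp: permutations_of_multiset_def)
    then show ?thesis by (simp only:) (intro finite_UN_I finS finite_permutations_of_multiset)
  qed
  have ne: "fs \<noteq> []" if "fs \<in> ?T" for fs using that by (auto simp: grafts_def)
  have fl: "factor_lists fs \<kappa> = {}" if "mset fs \<notin> ?S" for fs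
  proof -
    have "fs = [] \<Longrightarrow> factor_lists fs \<kappa> = {}" using \<kappa> by (auto simp: factor_lists_def mult_list_def)
    moreover have "gss \<in> factor_lists fs \<kappa> \<Longrightarrow> fs \<noteq> [] \<Longrightarrow> (gss, fs) \<in> grafts \<kappa>" for gss
      by (simp add: factor_lists_def grafts_def)
    ultimately show ?thesis using that by (cases "fs = []") (force simp: image_iff)+
  qed
  have P: "mcoeff (\<Prod>m\<in>#mset fs. shift m F) \<kappa> = (\<Sum>gss\<in>factor_lists fs \<kappa>. \<Prod>gs\<leftarrow>gss. ?c gs)" for fs
    by (simp add: prod_mset_mset mcoeff_prod_shift[OF F])
  have "mcoeff (G \<circledast> F) \<kappa> = Sum_any (\<lambda>\<mu>. mcoeff G \<mu> * mcoeff (\<Prod>m\<in>#\<mu>. shift m F) \<kappa>)"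
    by (simp add: plethysm_def mps_subst_def)
  also have "\<dots> = (\<Sum>\<mu>\<in>?S. mcoeff G \<mu> * mcoeff (\<Prod>m\<in>#\<mu>. shift m F) \<kappa>)"
  proof (rule Sum_any.expand_superset[OF finS], rule subsetI)
    fix \<mu> assume \<mu>: "\<mu> \<in> {\<mu>. mcoeff G \<mu> * mcoeff (\<Prod>m\<in>#\<mu>. shift m F) \<kappa> \<noteq> 0}"
    obtain fs where fs: "mset fs = \<mu>" using ex_mset by blast
    show "\<mu> \<in> ?S"
    proof (rule ccontr)
      assume "\<mu> \<notin> ?S"
      then have "mcoeff (\<Prod>m\<in>#\<mu>. shift m F) \<kappa> = 0" using P[of fs] fl[of fs] by (simp add: fs)
      with \<mu> show False by simp
    qed
  qed
  also have "\<dots> = (\<Sum>fs\<in>?T. of_nat (mset_fact (mset fs)) / fact (length fs)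
      * (mcoeff G (mset fs) * mcoeff (\<Prod>m\<in>#mset fs. shift m F) \<kappa>))"
    by (rule sum_mset_of_list[OF finS])
  also have "\<dots> = (\<Sum>fs\<in>?T. \<Sum>gss\<in>factor_lists fs \<kappa>. coord (mset fs) G / fact (length fs) * (\<Prod>gs\<leftarrow>gss. ?c gs))"
    unfolding P by (simp add: coord_def sum_distrib_left mult_ac)
  also have "\<dots> = (\<Sum>(fs, gss)\<in>(SIGMA fs:?T. factor_lists fs \<kappa>). coord (mset fs) G / fact (length fs) * (\<Prod>gs\<leftarrow>gss. ?c gs))"
    by (rule sum.Sigma) (auto simp: finT finite_factor_lists)
  also have "\<dots> = (\<Sum>(gss, fs)\<in>grafts \<kappa>. coord (mset fs) G / fact (length fs) * (\<Prod>gs\<leftarrow>gss. ?c gs))"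
  proof -
    have "(gss, fs) \<in> grafts \<kappa> \<longleftrightarrow> fs \<in> ?T \<and> gss \<in> factor_lists fs \<kappa>" for gss fs
    proof
      assume g: "(gss, fs) \<in> grafts \<kappa>"
      then have "mset fs \<in> ?S" by (rule image_eqI[rotated]) simp
      with g show "fs \<in> ?T \<and> gss \<in> factor_lists fs \<kappa>" by (simp add: factor_lists_def grafts_def)
    next
      assume "fs \<in> ?T \<and> gss \<in> factor_lists fs \<kappa>"
      with ne[of fs] show "(gss, fs) \<in> grafts \<kappa>" by (simp add: factor_lists_def grafts_def)
    qed
    then have eq: "grafts \<kappa> = prod.swap ` (SIGMA fs:?T. factor_lists fs \<kappa>)"
      by (intro set_eqI) (metis (no_types, lifting) image_iff mem_Sigma_iff prod.exhaust_sel swap_simp pair_in_swap_image)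
    show ?thesis
      by (rule sum.reindex_cong[OF _ eq, symmetric]) (simp_all add: case_prod_unfold)
  qed
  finally have m: "mcoeff (G \<circledast> F) \<kappa> = (\<Sum>(gss, fs)\<in>grafts \<kappa>. coord (mset fs) G / fact (length fs) * (\<Prod>gs\<leftarrow>gss. ?c gs))" .
  have c: "(\<Prod>gs\<leftarrow>gss. ?c gs) = (\<Prod>gs\<leftarrow>gss. coord (mset gs) F) / (\<Prod>gs\<leftarrow>gss. fact (length gs))" for gss
    by (induction gss) simp_all
  show ?thesis unfolding coord_def[of \<kappa>] m sum_distrib_left
    by (intro sum.cong refl) (auto simp: graft_weight_def c)
qed

lemma is_coord_comult_graft_poly:
  assumes "\<kappa> \<in> (Lambda :: 'y multiset set)"
  shows "is_coord_comult \<kappa> (graft_poly \<kappa>)"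
  unfolding is_coord_comult_def
proof (intro conjI ballI)
  show "Poly_Mapping.keys (graft_poly \<kappa>) \<subseteq> monomials \<times> monomials"
    using keys_graft_poly by blast
  fix F G :: "('y, rat) mps" assume F: "F \<in> no_const"
  have \<kappa>: "\<kappa> \<noteq> {#}" using assms by (simp add: Lambda_def)
  show "eval_tensor (graft_poly \<kappa>) F G = coord \<kappa> (G \<circledast> F)"
    unfolding coord_plethysm[OF F \<kappa>] eval_tensor_lin_fun graft_poly_def lin_fun_sum
    by (intro sum.cong refl) (auto simp: graft_type_def eval_monom_graft simp del: mset_map)
qed

end

section \<open>Polynomials are determined by their values\<close>

text \<open>The classical argument for linear independence of distinct characters: a relation is
  shortened until a single character is left, whose coefficient is then read off at
  \<open>e\<close>.\<close>

lemma characters_independent: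
  fixes \<chi> :: "'i \<Rightarrow> 't \<Rightarrow> 'r::idom"
  assumes "finite S"
    and "\<And>i s t. i \<in> S \<Longrightarrow> \<chi> i (m s t) = \<chi> i s * \<chi> i t"
    and "\<And>i. i \<in> S \<Longrightarrow> \<chi> i e = 1"
    and "\<And>i j. i \<in> S \<Longrightarrow> j \<in> S \<Longrightarrow> i \<noteq> j \<Longrightarrow> \<exists>t. \<chi> i t \<noteq> \<chi> j t"
    and "\<And>t. (\<Sum>i\<in>S. c i * \<chi> i t) = 0"
    and "i \<in> S"
  shows "c i = 0"
  using assms
proof (induction S arbitrary: c i rule: finite_induct)
  case (insert j S)
  have S: "c k = 0" if k: "k \<in> S" for k
  proof -
    obtain s where s: "\<chi> k s \<noteq> \<chi> j s" using insert.prems(3)[of k j] k insert.hyps(2) by auto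
    have "(\<Sum>i\<in>S. c i * (\<chi> i s - \<chi> j s) * \<chi> i t) = 0" for t
    proof -
      \<comment> \<open>The relation at \<open>m s t\<close> minus \<open>\<chi> j s\<close> times
        the relation at \<open>t\<close>: the character \<open>j\<close> drops out, and the
        coefficient of \<open>k\<close> is multiplied by a difference that is nonzero by the choice
        of \<open>s\<close>.\<close>
      have "(\<Sum>i\<in>insert j S. c i * \<chi> i (m s t)) - \<chi> j s * (\<Sum>i\<in>insert j S. c i * \<chi> i t) = 0"
        by (simp only: insert.prems(4)) simp
      moreover have "(\<Sum>i\<in>S. c i * \<chi> i (m s t)) = (\<Sum>i\<in>S. c i * (\<chi> i s * \<chi> i t))"
        using insert.prems(1) by (intro sum.cong) auto
      ultimately show ?thesis
        using insert.hyps insert.prems(1)[of j]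
        by (simp add: algebra_simps sum_subtractf sum_distrib_left)
    qed
    with insert.IH[of "\<lambda>i. c i * (\<chi> i s - \<chi> j s)" k] insert.prems k
    have "c k * (\<chi> k s - \<chi> j s) = 0" by blast
    with s show ?thesis by simp
  qed
  moreover have "c j = 0"
  proof -
    have "(\<Sum>i\<in>S. c i * \<chi> i e) = 0" using S by (intro sum.neutral) auto
    then show ?thesis using insert.prems(4)[of e] insert.hyps insert.prems(2)[of j] by simp
  qed
  ultimately show ?case using insert.prems(5) by blast
qed simp

lemma ex_series_with_coords:
  obtains F :: "('v, rat) mps" where "F \<in> no_const" "\<And>\<mu>. \<mu> \<noteq> {#} \<Longrightarrow> coord \<mu> F = t \<mu>"
proof
  let ?F = "Abs_mps (\<lambda>\<mu>. if \<mu> = {#} then 0 else t \<mu> / of_nat (mset_fact \<mu>))"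
  show "?F \<in> no_const" by (simp add: no_const_def)
  show "coord \<mu> ?F = t \<mu>" if "\<mu> \<noteq> {#}" for \<mu> using that by (simp add: coord_def)
qed

text \<open>Setting one variable to 2 and all others to 1 recovers its exponent, since the powers of
  2 are distinct.\<close>

lemma monomials_separated:
  fixes M N :: "'a multiset"
  assumes "M \<noteq> N"
  obtains t :: "'a \<Rightarrow> rat" where "(\<Prod>\<mu>\<in>#M. t \<mu>) \<noteq> (\<Prod>\<mu>\<in>#N. t \<mu>)"
proof -
  obtain x where x: "count M x \<noteq> count N x" using assms by (meson multiset_eqI)
  have p: "(\<Prod>\<mu>\<in>#K. if \<mu> = x then 2 else 1 :: rat) = 2 ^ count K x" for K
    by (induction K) simp_all
  show ?thesis
    by (rule that[of "\<lambda>\<mu>. if \<mu> = x then 2 else 1"]) (simp add: p x)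
qed

text \<open>The coordinates of a series without constant term can be prescribed freely, so the
  evaluations at pairs of series range over all pairs of assignments. On these, pairs of monomials
  act as distinct characters for pointwise multiplication \<open>m\<close>, and only finitely many
  of them occur in \<open>D\<close> and \<open>D'\<close>.\<close>

lemma is_coord_comult_unique:
  assumes D: "is_coord_comult \<kappa> D" and D': "is_coord_comult \<kappa> D'"
  shows "D = D'"
proof -
  define S where "S = Poly_Mapping.keys D \<union> Poly_Mapping.keys D'"
  define \<chi> :: "'a monom \<times> 'a monom \<Rightarrow> ('a multiset \<Rightarrow> rat) \<times> ('a multiset \<Rightarrow> rat) \<Rightarrow> rat"
    where "\<chi> = (\<lambda>(M, N) (s, t). (\<Prod>\<mu>\<in>#M. s \<mu>) * (\<Prod>\<mu>\<in>#N. t \<mu>))"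
  define m :: "('a multiset \<Rightarrow> rat) \<times> ('a multiset \<Rightarrow> rat) \<Rightarrow> _ \<Rightarrow> _"
    where "m = (\<lambda>(s, t) (s', t'). (\<lambda>\<mu>. s \<mu> * s' \<mu>, \<lambda>\<mu>. t \<mu> * t' \<mu>))"
  have S: "finite S" "S \<subseteq> monomials \<times> monomials"
    using D D' by (auto simp: S_def is_coord_comult_def)
  have zero: "(\<Sum>k\<in>S. (Poly_Mapping.lookup D k - Poly_Mapping.lookup D' k) * \<chi> k u) = 0" for u
  proof -
    obtain s t where u: "u = (s, t)" by (rule prod.exhaust)
    obtain F where F: "F \<in> no_const" "\<And>\<mu>. \<mu> \<noteq> {#} \<Longrightarrow> coord \<mu> F = s \<mu>" 
      using ex_series_with_coords[of s] by blast
    obtain G where G: "G \<in> no_const" "\<And>\<mu>. \<mu> \<noteq> {#} \<Longrightarrow> coord \<mu> G = t \<mu>" 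
      using ex_series_with_coords[of t] by blast
    have em: "eval_monom M F = (\<Prod>\<mu>\<in>#M. s \<mu>)" "eval_monom M G = (\<Prod>\<mu>\<in>#M. t \<mu>)" if "M \<in> monomials" for M
      using that F(2) G(2) unfolding eval_monom_def
      by (auto intro!: arg_cong[of _ _ prod_mset] image_mset_cong simp: monomials_def Lambda_def)
    have "eval_tensor E F G = (\<Sum>k\<in>S. Poly_Mapping.lookup E k * \<chi> k u)" if "Poly_Mapping.keys E \<subseteq> S" for E
      unfolding eval_tensor_lin_fun lin_fun_superset[OF S(1) that]
      using S(2) by (intro sum.cong) (auto simp: \<chi>_def u em)
    moreover have "eval_tensor D F G = eval_tensor D' F G"
      using D D' F(1) G(1) by (simp add: is_coord_comult_def)
    ultimately show ?thesis by (simp add: S_def left_diff_distrib sum_subtractf)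
  qed
  have "Poly_Mapping.lookup D k - Poly_Mapping.lookup D' k = 0" if "k \<in> S" for k
  proof (rule characters_independent[OF S(1), where \<chi> = \<chi> and m = m and e = "(\<lambda>_. 1, \<lambda>_. 1)"])
    show "\<chi> i (m s t) = \<chi> i s * \<chi> i t" for i s t
      by (auto simp: \<chi>_def m_def prod_mset.distrib case_prod_unfold)
    show "\<exists>t. \<chi> i t \<noteq> \<chi> j t" if "i \<noteq> j" for i j
    proof -
      obtain M N M' N' where ij: "i = (M, N)" "j = (M', N')" by (cases i; cases j) auto
      with that consider "M \<noteq> M'" | "N \<noteq> N'" by blast
      then show ?thesis
      proof cases
        case 1
        then obtain t :: "'a multiset \<Rightarrow> rat" where "(\<Prod>\<mu>\<in>#M. t \<mu>) \<noteq> (\<Prod>\<mu>\<in>#M'. t \<mu>)" by (rule monomials_separated)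
        then have "\<chi> i (t, \<lambda>_. 1) \<noteq> \<chi> j (t, \<lambda>_. 1)" by (simp add: \<chi>_def ij)
        then show ?thesis by blast
      next
        case 2
        then obtain t :: "'a multiset \<Rightarrow> rat" where "(\<Prod>\<mu>\<in>#N. t \<mu>) \<noteq> (\<Prod>\<mu>\<in>#N'. t \<mu>)" by (rule monomials_separated)
        then have "\<chi> i (\<lambda>_. 1, t) \<noteq> \<chi> j (\<lambda>_. 1, t)" by (simp add: \<chi>_def ij)
        then show ?thesis by blast
      qed
    qed
  qed (use zero that in \<open>auto simp: \<chi>_def\<close>)
  then show ?thesis
    by (intro poly_mapping_eqI) (metis S_def UnCI eq_iff_diff_eq_0 in_keys_iff)
qed

section \<open>The isomorphism of bialgebras\<close>

lemma lookup_scale [simp]: "Poly_Mapping.lookup (scale c p) k = c * Poly_Mapping.lookup p k"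
  by (simp add: scale_def Poly_Mapping.map.rep_eq when_def)

lemma scale_single [simp]: "scale c (Poly_Mapping.single k d) = Poly_Mapping.single k (c * d)"
  by (rule poly_mapping_eqI) (simp add: lookup_single when_def)

lemma scale_sum: "scale c (\<Sum>x\<in>S. f x) = (\<Sum>x\<in>S. scale c (f x))"
  by (rule poly_mapping_eqI) (simp add: lookup_sum sum_distrib_left)

lemma scale_one [simp]: "scale 1 p = p"
  by (rule poly_mapping_eqI) simp

lemma lookup_lin_ext: "Poly_Mapping.lookup (lin_ext h p) d = lin_fun (\<lambda>b. Poly_Mapping.lookup (h b) d) p"
  by (simp add: lin_ext_def lin_fun_def lookup_sum)

lemma lin_ext_add: "lin_ext h (p + q) = lin_ext h p + lin_ext h q"
  by (rule poly_mapping_eqI) (simp add: lookup_lin_ext lookup_add lin_fun_add)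

lemma lin_ext_single [simp]: "lin_ext h (Poly_Mapping.single b c) = scale c (h b)"
  by (rule poly_mapping_eqI) (simp add: lookup_lin_ext)

lemma lin_ext_one: "lin_ext h 1 = h 0"
  using lin_ext_single[of h 0 1] by simp

lemma lin_fun_scale: "lin_fun \<phi> (scale c p) = c * lin_fun \<phi> p"
proof -
  have "Poly_Mapping.keys (scale c p) \<subseteq> Poly_Mapping.keys p" by (auto simp: in_keys_iff)
  then show ?thesis
    by (simp add: lin_fun_superset[OF finite_keys, of "scale c p" p] lin_fun_def[of \<phi> p] sum_distrib_left mult.assoc)
qed

lemma lin_ext_scale: "lin_ext h (scale c p) = scale c (lin_ext h p)"
  by (rule poly_mapping_eqI) (simp add: lookup_lin_ext lin_fun_scale)

lemma lin_fun_lin_ext: "lin_fun \<phi> (lin_ext h p) = lin_fun (\<lambda>b. lin_fun \<phi> (h b)) p"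
  unfolding lin_ext_def by (simp add: lin_fun_sum lin_fun_scale) (simp add: lin_fun_def)

lemma lin_ext_lin_ext: "lin_ext g (lin_ext h p) = lin_ext (\<lambda>b. lin_ext g (h b)) p"
  by (rule poly_mapping_eqI) (simp add: lookup_lin_ext lin_fun_lin_ext)

lemma lin_fun_cong: "(\<And>b. b \<in> Poly_Mapping.keys p \<Longrightarrow> \<phi> b = \<psi> b) \<Longrightarrow> lin_fun \<phi> p = lin_fun \<psi> p"
  by (simp add: lin_fun_def)

lemma lin_ext_cong: "(\<And>b. b \<in> Poly_Mapping.keys p \<Longrightarrow> g b = h b) \<Longrightarrow> lin_ext g p = lin_ext h p"
  by (simp add: lin_ext_def)

lemma lin_ext_ident: "lin_ext (\<lambda>b. Poly_Mapping.single b 1) p = p"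
proof (rule poly_mapping_eqI)
  fix k
  have "lin_fun (\<lambda>b. if b = k then 1 else 0) p = Poly_Mapping.lookup p k"
    by (simp add: lin_fun_def in_keys_iff if_distrib[of "(*) _"] cong: if_cong)
  then show "Poly_Mapping.lookup (lin_ext (\<lambda>b. Poly_Mapping.single b 1) p) k = Poly_Mapping.lookup p k"
    by (simp add: lookup_lin_ext lookup_single when_def)
qed

lemma keys_lin_ext_single:
  "Poly_Mapping.keys (lin_ext (\<lambda>b. Poly_Mapping.single (\<beta> b) 1) p) \<subseteq> \<beta> ` Poly_Mapping.keys p"
  unfolding lin_ext_def by (rule order_trans[OF keys_sum]) (auto split: if_splits)

lemma tensor_lin_ext: "tensor p q = lin_ext (\<lambda>a. lin_ext (\<lambda>b. Poly_Mapping.single (a, b) 1) q) p"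
  by (simp add: tensor_def lin_ext_def scale_sum)

text \<open>Like the tensor product, multiplication is written as an iterated linear extension, so
  that compatibility of products reduces to pairs of basis elements.\<close>

lemma times_lin_ext:
  "p * q = lin_ext (\<lambda>a. lin_ext (\<lambda>b. Poly_Mapping.single (a + b) 1) q) p"
  for p q :: "'m::comm_monoid_add \<Rightarrow>\<^sub>0 rat"
proof -
  have e: "r = (\<Sum>a\<in>Poly_Mapping.keys r. Poly_Mapping.single a (Poly_Mapping.lookup r a))" for r :: "'m \<Rightarrow>\<^sub>0 rat"
    using lin_ext_ident[of r] by (simp add: lin_ext_def)
  have "p * q = (\<Sum>a\<in>Poly_Mapping.keys p. Poly_Mapping.single a (Poly_Mapping.lookup p a))
      * (\<Sum>b\<in>Poly_Mapping.keys q. Poly_Mapping.single b (Poly_Mapping.lookup q b))"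
    using e[of p] e[of q] by (rule arg_cong2)
  also have "\<dots> = lin_ext (\<lambda>a. lin_ext (\<lambda>b. Poly_Mapping.single (a + b) 1) q) p"
    by (simp add: sum_product mult_single lin_ext_def scale_sum)
  finally show ?thesis .
qed

section \<open>The bijection of bases and its compatibilities\<close>

definition basis_map :: "'y::monoid_mult monom \<Rightarrow> (unit, 'y list) lev list set option" where
  "basis_map M = (if M = {#} then None else Some (tuple_class M))"

lemma bij_betw_basis_map:
  "bij_betw (basis_map :: 'y::monoid_mult monom \<Rightarrow> _) monomials (insert None (Some ` pi0 (simplices (bar Yop) 1)))"
  unfolding bij_betw_def
proof
  show "inj_on (basis_map :: 'y monom \<Rightarrow> _) monomials"
    using inj_on_tuple_class by (auto simp: inj_on_def basis_map_def)
  show "(basis_map :: 'y monom \<Rightarrow> _) ` monomials = insert None (Some ` pi0 (simplices (bar Yop) 1))"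
  proof -
    have "(monomials :: 'y monom set) = insert {#} (monomials - {{#}})" by (auto simp: monomials_def)
    then have "basis_map ` monomials = insert (basis_map {#}) (basis_map ` (monomials - {{#}}) :: (unit, 'y list) lev list set option set)"
      by (metis image_insert)
    also have "basis_map ` (monomials - {{#}}) = Some ` tuple_class ` (monomials - {{#}} :: 'y monom set)"
      unfolding image_image by (intro image_cong) (auto simp: basis_map_def)
    also have "basis_map {#} = None" by (simp add: basis_map_def)
    finally show ?thesis unfolding pi0_bar .
  qed
qed

lemma juxtapose_basis_map:
  assumes "M \<in> monomials" "N \<in> monomials"
  shows "juxtapose (bar Yop) (basis_map M) (basis_map N) = basis_map (M + N)"
proof (cases "M = {#} \<or> N = {#}")
  case True
  then show ?thesis by (auto simp: juxtapose_def basis_map_def)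
next
  case False
  note M = rep_tuple_class[OF assms(1)] and N = rep_tuple_class[OF assms(2)]
  have "rep (tuple_class M) @ rep (tuple_class N) \<in> obj (Sr lev1)"
    using M N False by simp
  from iso_class_bar[OF this] show ?thesis
    using False M N by (simp add: juxtapose_def basis_map_def type_of_tuple_append)
qed

lemma coord_Var_one: "coord \<mu> (Var 1 :: ('y::monoid_mult, rat) mps) = (if \<mu> = {#1#} then 1 else 0)"
  by (simp add: coord_def Var_def mset_fact_def)

text \<open>Sums of nonempty multisets are nonempty, so no term has the unit in either tensor
  factor. This agrees with \<open>delta_comult\<close>, which vanishes at \<open>None\<close> on
  classes of tuples.\<close>

lemma keys_prod_graft_poly:
  fixes M :: "'y::monoid_mult monom"
  assumes "M \<noteq> {#}"
  shows "Poly_Mapping.keys (\<Prod>\<mu>\<in>#M. graft_poly \<mu>) \<subseteq> (monomials - {{#}}) \<times> (monomials - {{#}})"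
  using assms
proof (induction M)
  case (add \<mu> M)
  show ?case
  proof (cases "M = {#}")
    case True
    then show ?thesis using keys_graft_poly by simp
  next
    case False
    let ?I = "monomials - {{#}} :: 'y monom set"
    have I: "a + b \<in> ?I" if "a \<in> ?I" "b \<in> ?I" for a b using that by (auto simp: monomials_def)
    have "Poly_Mapping.keys (graft_poly \<mu> * (\<Prod>\<mu>\<in>#M. graft_poly \<mu>))
      \<subseteq> {a + b |a b. a \<in> Poly_Mapping.keys (graft_poly \<mu>) \<and> b \<in> Poly_Mapping.keys (\<Prod>\<mu>\<in>#M. graft_poly \<mu>)}"
      by (rule keys_mult)
    also have "\<dots> \<subseteq> {a + b |a b. a \<in> ?I \<times> ?I \<and> b \<in> ?I \<times> ?I}"
      using keys_graft_poly[of \<mu>] add.IH[OF False] by blast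
    also have "\<dots> \<subseteq> ?I \<times> ?I"
    proof
      fix p assume "p \<in> {a + b |a b. a \<in> ?I \<times> ?I \<and> b \<in> ?I \<times> ?I}"
      then obtain a b where p: "p = a + b" and ab: "a \<in> ?I \<times> ?I" "b \<in> ?I \<times> ?I" by blast
      show "p \<in> ?I \<times> ?I"
        using ab I unfolding p by (simp only: mem_Times_iff fst_add snd_add)
    qed
    finally show ?thesis by simp
  qed
qed simp

context
  assumes locally_finite: "\<And>m :: 'y::monoid_mult. finite {(n, k). m = n * k}"
begin

lemma coord_comult_eq:
  assumes "\<kappa> \<in> (Lambda :: 'y multiset set)"
  shows "coord_comult \<kappa> = graft_poly \<kappa>"
  unfolding coord_comult_def
  using is_coord_comult_graft_poly[OF locally_finite assms] is_coord_comult_unique by blast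

text \<open>Both sides are compared at each pair of basis elements. A pair of classes selects one
  exponent, by injectivity of \<open>tuple_class\<close>, and its coefficient is an incidence
  coefficient; at every other pair both sides vanish.\<close>

lemma delta_comult_basis_map:
  fixes M :: "'y monom"
  assumes M: "M \<in> monomials"
  shows "delta_comult (bar Yop) (basis_map M)
    = lin_ext (\<lambda>(a, b). Poly_Mapping.single (basis_map a, basis_map b) 1) (\<Prod>\<mu>\<in>#M. graft_poly \<mu>)"
proof (cases "M = {#}")
  case True
  then show ?thesis by (simp add: delta_comult_def basis_map_def lin_ext_one zero_prod_def)
next
  case False
  interpret incidence "bar (Yop :: (unit, unit, 'y list, 'y srarr) operad)"
    using locally_finite by (rule incidence_bar)
  let ?X = "bar (Yop :: (unit, unit, 'y list, 'y srarr) operad)"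
  let ?P = "\<Prod>\<mu>\<in>#M. graft_poly \<mu>"
  let ?I = "monomials - {{#}} :: 'y monom set"
  let ?f = "\<lambda>(v, w). case (v, w) of
       (Some A, Some B) \<Rightarrow> (if A \<in> pi0 (simplices ?X 1) \<and> B \<in> pi0 (simplices ?X 1)
                   then section_coeff ?X (rep (tuple_class M)) (rep A) (rep B) else 0)
     | _ \<Rightarrow> 0"
  note R = rep_tuple_class[OF M False]
  obtain ls where ls: "ls \<noteq> []" "[] \<notin> set ls" "rep (tuple_class M) = map Op ls"
    using R(1) unfolding obj_Sr_lev1 by blast
  have lsM: "mset (map mset ls) = M" using R(2) unfolding ls(3) by simp
  have P: "(\<Prod>l\<leftarrow>ls. graft_poly (mset l)) = ?P"
    using prod_mset_mset[of graft_poly "map mset ls"] lsM by (simp add: o_def)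
  have sc: "section_coeff ?X (rep (tuple_class M)) (rep (tuple_class a)) (rep (tuple_class b)) = Poly_Mapping.lookup ?P (a, b)"
    if "a \<in> ?I" "b \<in> ?I" for a b
    using section_coeff_bar[OF locally_finite ls(1,2), of "rep (tuple_class a)" "rep (tuple_class b)"] that
      rep_tuple_class[of a] rep_tuple_class[of b] by (simp add: P ls(3))
  \<comment> \<open>Needed to evaluate \<open>Abs_poly_mapping\<close>: its lookup returns the given
    coefficients only if their support is finite.\<close>
  have "finite {p. ?f p \<noteq> 0}"
  proof (rule finite_subset)
    let ?S = "{(A, B). A \<in> pi0 (simplices ?X 1) \<and> B \<in> pi0 (simplices ?X 1) \<and>
        section_coeff ?X (rep (tuple_class M)) (rep A) (rep B) \<noteq> 0}"
    show "{p. ?f p \<noteq> 0} \<subseteq> (\<lambda>(A, B). (Some A, Some B)) ` ?S"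
      by (force split: option.splits if_splits)
    show "finite ((\<lambda>(A, B). (Some A, Some B)) ` ?S)"
      using R(1) by (intro finite_imageI finite_section_support) (simp only: bar_simps)
  qed
  then have lk: "Poly_Mapping.lookup (delta_comult ?X (basis_map M)) = ?f"
    using False by (simp add: delta_comult_def basis_map_def)
  show ?thesis
  proof (rule poly_mapping_eqI)
    fix p :: "(unit, 'y list) lev list set option \<times> (unit, 'y list) lev list set option"
    obtain v w where p: "p = (v, w)" by (rule prod.exhaust)
    have R: "Poly_Mapping.lookup (lin_ext (\<lambda>(a, b). Poly_Mapping.single (basis_map a, basis_map b) 1) ?P) p
      = lin_fun (\<lambda>(a, b). if basis_map a = v \<and> basis_map b = w then 1 else 0) ?P"
      unfolding lookup_lin_ext p
      by (rule lin_fun_cong) (auto simp: lookup_single when_def)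
    show "Poly_Mapping.lookup (delta_comult ?X (basis_map M)) p
      = Poly_Mapping.lookup (lin_ext (\<lambda>(a, b). Poly_Mapping.single (basis_map a, basis_map b) 1) ?P) p"
    proof (cases "\<exists>a\<in>?I. \<exists>b\<in>?I. v = Some (tuple_class a) \<and> w = Some (tuple_class b)")
      case True
      then obtain a b where ab: "a \<in> ?I" "b \<in> ?I" and vw: "v = Some (tuple_class a)" "w = Some (tuple_class b)" by blast
      have "lin_fun (\<lambda>(a, b). if basis_map a = v \<and> basis_map b = w then 1 else 0) ?P
        = lin_fun (\<lambda>k. if k = (a, b) then 1 else 0) ?P"
      proof (rule lin_fun_cong)
        fix k assume "k \<in> Poly_Mapping.keys ?P"
        then obtain c d where k: "k = (c, d)" "c \<in> ?I" "d \<in> ?I" using keys_prod_graft_poly[OF False] by blast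
        have inj: "tuple_class x = tuple_class y \<longleftrightarrow> x = y" if "x \<in> ?I" "y \<in> ?I" for x y :: "'y monom"
          using inj_on_eq_iff[OF inj_on_tuple_class that] .
        show "(case k of (a, b) \<Rightarrow> if basis_map a = v \<and> basis_map b = w then 1 else 0)
            = (if k = (a, b) then 1 else 0 :: rat)"
          using k(2,3) ab inj[OF k(2) ab(1)] inj[OF k(3) ab(2)] by (simp add: k(1) vw basis_map_def)
      qed
      also have "\<dots> = Poly_Mapping.lookup ?P (a, b)"
        by (simp add: lin_fun_def in_keys_iff if_distrib[of "(*) _"] cong: if_cong)
      also have "\<dots> = ?f p"
        using ab sc[OF ab] unfolding p vw pi0_bar by simp
      finally show ?thesis unfolding R lk by simp
    next
      case nex: False
      have "lin_fun (\<lambda>(a, b). if basis_map a = v \<and> basis_map b = w then 1 else 0) ?P = lin_fun (\<lambda>_. 0) ?P"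
      proof (rule lin_fun_cong)
        fix k assume "k \<in> Poly_Mapping.keys ?P"
        then obtain c d where k: "k = (c, d)" "c \<in> ?I" "d \<in> ?I" using keys_prod_graft_poly[OF False] by blast
        then show "(case k of (a, b) \<Rightarrow> if basis_map a = v \<and> basis_map b = w then 1 else 0) = (0 :: rat)"
          using nex by (auto simp: basis_map_def)
      qed
      also have "\<dots> = 0" by (simp add: lin_fun_def)
      also have "0 = ?f p"
      proof (cases v)
        case (Some A)
        show ?thesis
        proof (cases w)
          case (Some B)
          have "\<not> (A \<in> pi0 (simplices ?X 1) \<and> B \<in> pi0 (simplices ?X 1))"
            using nex \<open>v = Some A\<close> \<open>w = Some B\<close> unfolding pi0_bar by blast
          then show ?thesis using \<open>v = Some A\<close> \<open>w = Some B\<close> by (simp only: p prod.case option.case if_False)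
        qed (simp add: p Some)
      qed (simp add: p)
      finally show ?thesis unfolding R lk by simp
    qed
  qed
qed

lemma delta_counit_basis_map:
  fixes M :: "'y monom"
  assumes M: "M \<in> monomials"
  shows "delta_counit (bar Yop) (basis_map M) = eval_monom M (Var 1)"
proof (cases "M = {#}")
  case True
  then show ?thesis by (simp add: delta_counit_def basis_map_def eval_monom_def)
next
  case False
  note R = rep_tuple_class[OF M False]
  obtain ls where ls: "ls \<noteq> []" "[] \<notin> set ls" "rep (tuple_class M) = map Op ls"
    using R(1) unfolding obj_Sr_lev1 by blast
  have "mset (map mset ls) = M" using R(2) unfolding ls(3) by simp
  then have "eval_monom M (Var 1) = (\<Prod>l\<leftarrow>ls. if mset l = {#1#} then 1 else 0)"
    using prod_mset_mset[of "\<lambda>\<mu>. coord \<mu> (Var 1 :: ('y, rat) mps)" "map mset ls"]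
    by (simp add: eval_monom_def coord_Var_one o_def)
  then show ?thesis
    using False hcard_degen_bar[OF locally_finite ls(1,2)] by (simp add: delta_counit_def basis_map_def ls(3))
qed

text \<open>The linear extension of a bijection of bases is bijective, with the extension of the
  inverse as its inverse. Compatibility with product, comultiplication and counit is linear in each
  argument and so is tested on monomials.\<close>

lemma bialg_iso_plethystic:
  "bialg_iso (plethystic_bialgebra :: 'y monom bialg) (incidence_bialgebra (bar Yop))
     (lin_ext (\<lambda>M. Poly_Mapping.single (basis_map M) 1))"
proof -
  let ?X = "bar (Yop :: (unit, unit, 'y list, 'y srarr) operad)"
  let ?H = "plethystic_bialgebra :: 'y monom bialg" and ?K = "incidence_bialgebra ?X"
  define \<phi> where "\<phi> = lin_ext (\<lambda>M :: 'y monom. Poly_Mapping.single (basis_map M) (1 :: rat))"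
  have H: "p \<in> carrier_of ?H \<longleftrightarrow> Poly_Mapping.keys p \<subseteq> monomials" for p
    by (simp add: carrier_of_def plethystic_bialgebra_def)
  let ?B = "insert None (Some ` pi0 (simplices ?X 1))"
  have K: "p \<in> carrier_of ?K \<longleftrightarrow> Poly_Mapping.keys p \<subseteq> ?B" for p
    by (simp add: carrier_of_def incidence_bialgebra_def)
  note bij = bij_betw_basis_map[where 'y = 'y]
  have "bij_betw \<phi> (carrier_of ?H) (carrier_of ?K)"
  proof -
    define \<gamma> where "\<gamma> = inv_into (monomials :: 'y monom set) basis_map"
    let ?\<psi> = "lin_ext (\<lambda>u. Poly_Mapping.single (\<gamma> u) (1 :: rat))"
    have \<gamma>: "\<gamma> (basis_map M) = M" if "M \<in> monomials" for M
      unfolding \<gamma>_def using bij that by (simp add: bij_betw_def)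
    have \<gamma>': "basis_map (\<gamma> u) = u" "\<gamma> u \<in> monomials" if "u \<in> ?B" for u
      unfolding \<gamma>_def using bij that by (metis bij_betw_inv_into_right, metis bij_betw_def inv_into_into)
    show ?thesis
    proof (rule bij_betw_byWitness[where f' = ?\<psi>])
      show "\<forall>p\<in>carrier_of ?H. ?\<psi> (\<phi> p) = p"
      proof
        fix p assume "p \<in> carrier_of ?H"
        then have "?\<psi> (\<phi> p) = lin_ext (\<lambda>M. Poly_Mapping.single M 1) p"
          unfolding \<phi>_def lin_ext_lin_ext H by (intro lin_ext_cong) (auto simp: \<gamma>)
        then show "?\<psi> (\<phi> p) = p" by (simp add: lin_ext_ident)
      qed
      show "\<forall>q\<in>carrier_of ?K. \<phi> (?\<psi> q) = q"
      proof
        fix q assume "q \<in> carrier_of ?K"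
        then have "\<phi> (?\<psi> q) = lin_ext (\<lambda>u. Poly_Mapping.single u 1) q"
          unfolding \<phi>_def lin_ext_lin_ext K by (intro lin_ext_cong) (use \<gamma>' in \<open>simp add: subset_iff\<close>)
        then show "\<phi> (?\<psi> q) = q" by (simp add: lin_ext_ident)
      qed
      show "\<phi> ` carrier_of ?H \<subseteq> carrier_of ?K"
      proof (rule image_subsetI)
        fix p assume "p \<in> carrier_of ?H"
        then have "basis_map ` Poly_Mapping.keys p \<subseteq> ?B"
          unfolding H bij_betw_imp_surj_on[OF bij, symmetric] by (rule image_mono)
        then show "\<phi> p \<in> carrier_of ?K"
          unfolding K \<phi>_def by (rule order_trans[OF keys_lin_ext_single])
      qed
      show "?\<psi> ` carrier_of ?K \<subseteq> carrier_of ?H"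
      proof (rule image_subsetI)
        fix q assume "q \<in> carrier_of ?K"
        then have "\<gamma> ` Poly_Mapping.keys q \<subseteq> monomials" unfolding K using \<gamma>'(2) by blast
        then show "?\<psi> q \<in> carrier_of ?H"
          unfolding H by (rule order_trans[OF keys_lin_ext_single])
      qed
    qed
  qed
  moreover have "\<phi> (bmult ?H p q) = bmult ?K (\<phi> p) (\<phi> q)"
    if "p \<in> carrier_of ?H" "q \<in> carrier_of ?H" for p q
  proof -
    have "bmult ?K (\<phi> p) (\<phi> q) = lin_ext (\<lambda>M. lin_ext (\<lambda>N.
        Poly_Mapping.single (juxtapose ?X (basis_map M) (basis_map N)) 1) q) p"
      by (simp add: incidence_bialgebra_def tensor_lin_ext \<phi>_def lin_ext_lin_ext)
    also have "\<dots> = lin_ext (\<lambda>M. lin_ext (\<lambda>N. Poly_Mapping.single (basis_map (M + N)) 1) q) p"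
      using that unfolding H
      by (intro lin_ext_cong arg_cong[of _ _ "\<lambda>u. Poly_Mapping.single u 1"] juxtapose_basis_map) blast+
    also have "\<dots> = \<phi> (bmult ?H p q)"
      by (simp add: plethystic_bialgebra_def times_lin_ext \<phi>_def lin_ext_lin_ext)
    finally show ?thesis by simp
  qed
  moreover have "\<phi> (bone ?H) = bone ?K"
    by (simp add: \<phi>_def plethystic_bialgebra_def incidence_bialgebra_def basis_map_def flip: single_one)
  moreover have "comult ?K (\<phi> p) = tensor_map \<phi> (comult ?H p)" if "p \<in> carrier_of ?H" for p
  proof -
    have T: "(\<lambda>(a, b). tensor (\<phi> (Poly_Mapping.single a 1)) (\<phi> (Poly_Mapping.single b 1)))
      = (\<lambda>(a, b). Poly_Mapping.single (basis_map a, basis_map b) 1)"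
      by (simp add: \<phi>_def tensor_lin_ext)
    have "comult ?K (\<phi> p) = lin_ext (\<lambda>M. delta_comult ?X (basis_map M)) p"
      by (simp add: incidence_bialgebra_def \<phi>_def lin_ext_lin_ext)
    also have "\<dots> = lin_ext (\<lambda>M. lin_ext (\<lambda>(a, b). Poly_Mapping.single (basis_map a, basis_map b) 1)
        (\<Prod>\<mu>\<in>#M. coord_comult \<mu>)) p"
    proof (rule lin_ext_cong)
      fix M assume "M \<in> Poly_Mapping.keys p"
      then have M: "M \<in> monomials" using that H by blast
      \<comment> \<open>The description defining \<open>coord_comult\<close> has been evaluated for
        exponents in \<open>Lambda\<close>; membership of \<open>M\<close> in
        \<open>monomials\<close> puts all its elements there.\<close>
      have "image_mset coord_comult M = image_mset graft_poly M"
        using M by (intro image_mset_cong coord_comult_eq) (auto simp: monomials_def)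
      then show "delta_comult ?X (basis_map M) = lin_ext (\<lambda>(a, b). Poly_Mapping.single (basis_map a, basis_map b) 1)
        (\<Prod>\<mu>\<in>#M. coord_comult \<mu>)"
        using delta_comult_basis_map[OF M] by simp
    qed
    also have "\<dots> = tensor_map \<phi> (comult ?H p)"
      unfolding tensor_map_def T by (simp add: plethystic_bialgebra_def lin_ext_lin_ext)
    finally show ?thesis .
  qed
  moreover have "counit ?K (\<phi> p) = counit ?H p" if "p \<in> carrier_of ?H" for p
  proof -
    have "counit ?K (\<phi> p) = lin_fun (\<lambda>M. delta_counit ?X (basis_map M)) p"
      unfolding \<phi>_def by (simp add: incidence_bialgebra_def lin_fun_lin_ext flip: lin_fun_def)
    also have "\<dots> = lin_fun (\<lambda>M. eval_monom M (Var 1)) p"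
      using that unfolding H by (intro lin_fun_cong delta_counit_basis_map) blast
    also have "\<dots> = counit ?H p"
      by (simp add: plethystic_bialgebra_def eval_poly_def lin_fun_def)
    finally show ?thesis .
  qed
  moreover have "\<phi> (p + q) = \<phi> p + \<phi> q" "\<phi> (scale c p) = scale c (\<phi> p)" for p q c
    by (simp_all add: \<phi>_def lin_ext_add lin_ext_scale)
  ultimately show ?thesis unfolding bialg_iso_def \<phi>_def[symmetric] by blast
qed

end

text \<open>The bialgebra data are meaningful only if the description in \<open>coord_comult\<close>
  has a unique solution and if the homotopy cardinalities and supports are finite. The first two
  conjuncts secure this, so that the isomorphism does not rest on default values.\<close>

theorem theorem5p20:
  assumes "\<And>m :: 'y::monoid_mult. finite {(n, k). m = n * k}"
  shows "(\<forall>\<mu>\<in>(Lambda :: 'y multiset set). \<exists>!D. is_coord_comult \<mu> D)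
    \<and> incidence_finite (bar (T_Sr (monoid_cat :: (unit, unit, 'y, 'y) intcat)))
    \<and> bialg_isomorphic
        (plethystic_bialgebra :: 'y monom bialg)
        (incidence_bialgebra (bar (T_Sr (monoid_cat :: (unit, unit, 'y, 'y) intcat))))"
proof (intro conjI ballI)
  fix \<mu> :: "'y multiset" assume "\<mu> \<in> Lambda"
  then show "\<exists>!D. is_coord_comult \<mu> D"
    using is_coord_comult_graft_poly[OF assms] is_coord_comult_unique by blast
next
  show "incidence_finite (bar (T_Sr (monoid_cat :: (unit, unit, 'y, 'y) intcat)))"
    using incidence.incidence_finite[OF incidence_bar[OF assms]] .
next
  show "bialg_isomorphic (plethystic_bialgebra :: 'y monom bialg)
      (incidence_bialgebra (bar (T_Sr (monoid_cat :: (unit, unit, 'y, 'y) intcat))))"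
    unfolding bialg_isomorphic_def using bialg_iso_plethystic[OF assms] by blast
qed

end
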